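(* Let $\Omega\subsetneq\mathbb{R}^n$ be open and such that $-\Delta d\ge0$ in $\Omega$ in the sense of distributions. Then for all $u\in C_c^\infty(\Omega)$ and all $s>1$, $$\int_\Omega\frac{|\nabla u|}{d^{s-1}}dx\ \ge\ (s-1)\int_\Omega\frac{|u|}{d^s}dx,$$ and the constant $s-1$ is sharp (it cannot be replaced by a larger constant).
   Context: $d(x):=\operatorname{dist}(x,\mathbb{R}^n\setminus\Omega)$. *)

theory Defs
  imports "HOL-Analysis.Analysis"
begin

definition bdist :: "'a::euclidean_space set \<Rightarrow> 'a \<Rightarrow> real" where
  "bdist \<Omega> x = infdist x (- \<Omega>)"

fun dpart :: "'a::euclidean_space list \<Rightarrow> ('a \<Rightarrow> real) \<Rightarrow> 'a \<Rightarrow> real" where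
  "dpart [] f = f"
| "dpart (i # is) f = (\<lambda>x. frechet_derivative (dpart is f) (at x) i)"

definition smooth :: "('a::euclidean_space \<Rightarrow> real) \<Rightarrow> bool" where
  "smooth f \<longleftrightarrow> (\<forall>is. set is \<subseteq> Basis \<longrightarrow> (\<forall>x. dpart is f differentiable at x))"

definition test_fun :: "'a::euclidean_space set \<Rightarrow> ('a \<Rightarrow> real) \<Rightarrow> bool" where
  "test_fun \<Omega> u \<longleftrightarrow> smooth u \<and> compact (closure {x. u x \<noteq> 0})
      \<and> closure {x. u x \<noteq> 0} \<subseteq> \<Omega>"

definition grad :: "('a::euclidean_space \<Rightarrow> real) \<Rightarrow> 'a \<Rightarrow> 'a" where
  "grad u x = (\<Sum>i\<in>Basis. dpart [i] u x *\<^sub>R i)"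

definition laplacian :: "('a::euclidean_space \<Rightarrow> real) \<Rightarrow> 'a \<Rightarrow> real" where
  "laplacian u x = (\<Sum>i\<in>Basis. dpart [i, i] u x)"

text \<open>-Delta f \<ge> 0 in the sense of distributions on Omega:
  for every nonnegative test function phi, <-Delta f, phi> = - int f Delta phi \<ge> 0.\<close>
definition neg_laplacian_nonneg :: "'a::euclidean_space set \<Rightarrow> ('a \<Rightarrow> real) \<Rightarrow> bool" where
  "neg_laplacian_nonneg \<Omega> f \<longleftrightarrow>
     (\<forall>\<phi>. test_fun \<Omega> \<phi> \<and> (\<forall>x. \<phi> x \<ge> 0) \<longrightarrow> integral \<Omega> (\<lambda>x. f x * laplacian \<phi> x) \<le> 0)"

end

theory Submission
  imports Defs "HOL-Computational_Algebra.Polynomial"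
begin

text \<open>
  Superharmonicity of d enters only through averages: moving the radius of a radial smooth kernel k
  gives that the mean of d over any ball inside Omega is at most the value at the centre. Write
  N_r(x) for the nonnegative difference between the two, weighted by k. For compactly supported f,
  twice the integral of f N_r equals the integral over x of the k-mean over z of
  (f(x + r z) - f x) (d(x + r z) - d x).

  For the inequality, take f = |u| d^(1-s). Since d is a minimum of distances to points it
  satisfies d(x + h) <= d x + v.h + O(|h|^2) with v the unit vector away from a nearest
  boundary point; applying this to h and -h bounds |d(x + r z) - d x - r v.z| by the second
  difference of d, whose k-mean is 2 N_r(x) up to O(r^2), and the integral of N_r is O(r^2) by the
  same identity. So to order r^2 the identity yields
  0 <= integral of d^(1-s) |grad u| - (s-1) |u| d^(-s), without differentiating d.

  For sharpness, let p be a boundary point touched by a ball in Omega with inner normal v. The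
  rescalings d(p + l x)/l are asymptotically at least x.v, coincide with it on the normal ray, and
  are superharmonic, so by the strong minimum principle they converge to x.v on the half space
  as l tends to 0. This reduces the claim to the half space, where functions that increase in x.v
  from 0 near the boundary are nearly optimal.
\<close>

section \<open>Smooth functions built from the flat function\<close>

text \<open>Formally the inequality is -Delta d tested against f = |u| d^(1-s): grad f . grad d is
  at most d^(1-s) |grad u| - (s-1) |u| d^(-s) because |grad d| = 1. But f is not an admissible test
  function and d is only Lipschitz, so averages act as a discrete integration by parts. Two points
  make this work. The direction v attached to x is chosen without any measurability in x; after
  averaging over z it survives only through the mean of (v . z)^2, which is the same for all unit
  vectors, so the bound to be integrated over x does not contain v. And the kernel has a primitive:
  a smooth bump with grad bump(z) = - ker(z) z. This yields the second moments by one integration by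
  parts and turns the radius derivative of the averages into a pairing with the Laplacian of a
  rescaled bump. For sharpness, both energies scale by the same power of l under the blow-up, so
  their quotient depends on l only through the rescaled weight.\<close>

primrec flat_poly :: "nat \<Rightarrow> real poly" where
  "flat_poly 0 = 1"
| "flat_poly (Suc k) = [:0, 0, 1:] * (flat_poly k - pderiv (flat_poly k))"

text \<open>The k-th derivative of exp(-1/t), extended by 0 to t \<le> 0. With y = 1/t, d/dt (P(y)
  exp(-y)) = y^2 (P(y) - P'(y)) exp(-y), which is the recursion of \<open>flat_poly\<close>.\<close>

definition flat :: "nat \<Rightarrow> real \<Rightarrow> real" where
  "flat k t = (if 0 < t then poly (flat_poly k) (1 / t) * exp (- (1 / t)) else 0)"

lemma poly_times_exp_tendsto_0:
  "((\<lambda>x::real. poly p x * exp (- x)) \<longlongrightarrow> 0) at_top"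
proof -
  have "((\<lambda>x. \<Sum>i\<le>degree p. coeff p i * (x ^ i / exp x)) \<longlongrightarrow> (\<Sum>i\<le>degree p. coeff p i * 0)) at_top"
    by (intro tendsto_sum tendsto_mult tendsto_const tendsto_power_div_exp_0)
  moreover have "(\<Sum>i\<le>degree p. coeff p i * (x ^ i / exp x)) = poly p x * exp (- x)" for x :: real
    by (simp add: poly_altdef sum_distrib_right exp_minus divide_inverse mult_ac sum_distrib_left)
  ultimately show ?thesis by simp
qed

lemma flat_tendsto_0: "((\<lambda>t. poly p (1 / t) * exp (- (1 / t))) \<longlongrightarrow> 0) (at_right (0::real))"
proof -
  have "filterlim (\<lambda>t::real. 1 / t) at_top (at_right 0)"
    using filterlim_inverse_at_top_right by (simp add: inverse_eq_divide)
  from filterlim_compose[OF poly_times_exp_tendsto_0 this] show ?thesis by simp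
qed

lemma flat_has_derivative: "(flat k has_real_derivative flat (Suc k) t) (at t)"
proof -
  consider "t < 0" | "t = 0" | "0 < t" by linarith
  then show ?thesis
  proof cases
    case 1
    have "((\<lambda>_. 0) has_real_derivative 0) (at t)" by simp
    moreover have "eventually (\<lambda>x. x < 0) (nhds t)"
      using 1 by (intro order_tendstoD) (auto intro: filterlim_ident)
    then have "eventually (\<lambda>x. flat k x = 0) (nhds t)"
      by eventually_elim (simp add: flat_def)
    ultimately show ?thesis using 1
      by (subst DERIV_cong_ev[OF refl _ refl]) (auto simp: flat_def)
  next
    case 2
    have "((\<lambda>h. (flat k (0 + h) - flat k 0) / h) \<longlongrightarrow> 0) (at 0)"
    proof (rule filterlim_split_at_real)
      have "eventually (\<lambda>h::real. h < 0) (at_left 0)" by (simp add: eventually_at_filter)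
      then have "eventually (\<lambda>h. (flat k (0 + h) - flat k 0) / h = 0) (at_left 0)"
        by eventually_elim (simp add: flat_def)
      then show "((\<lambda>h. (flat k (0 + h) - flat k 0) / h) \<longlongrightarrow> 0) (at_left 0)"
        by (rule tendsto_eventually)
    next
      have "eventually (\<lambda>h::real. 0 < h) (at_right 0)" by (simp add: eventually_at_filter)
      \<comment> \<open>Dividing by h raises every power of 1/h by one, hence
        \<open>pCons 0\<close>; the quotient keeps the form treated in
        \<open>flat_tendsto_0\<close>.\<close>
      then have "eventually (\<lambda>h. poly (pCons 0 (flat_poly k)) (1 / h) * exp (- (1 / h))
          = (flat k (0 + h) - flat k 0) / h) (at_right 0)"
        by eventually_elim (simp add: flat_def)
      with flat_tendsto_0[of "pCons 0 (flat_poly k)"]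
      show "((\<lambda>h. (flat k (0 + h) - flat k 0) / h) \<longlongrightarrow> 0) (at_right 0)"
        by (rule Lim_transform_eventually)
    qed
    then show ?thesis using 2 by (simp add: DERIV_def flat_def)
  next
    case 3
    have "((\<lambda>t. poly (flat_poly k) (1 / t) * exp (- (1 / t))) has_real_derivative
        flat (Suc k) t) (at t)"
    proof -
      have i: "((\<lambda>t. 1 / t) has_real_derivative - (1 / t\<^sup>2)) (at t)"
        using 3 by (auto intro!: derivative_eq_intros simp: power2_eq_square)
      have "((\<lambda>t. poly (flat_poly k) (1 / t) * exp (- (1 / t))) has_real_derivative
          poly (flat_poly k) (1 / t) * (exp (- (1 / t)) * - (- (1 / t\<^sup>2)))
          + poly (pderiv (flat_poly k)) (1 / t) * - (1 / t\<^sup>2) * exp (- (1 / t))) (at t)"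
        by (intro DERIV_mult' DERIV_chain2[OF poly_DERIV i] DERIV_chain2[OF DERIV_exp DERIV_minus[OF i]])
      then show ?thesis
        using 3 by (simp add: flat_def algebra_simps power2_eq_square)
    qed
    moreover have "eventually (\<lambda>x. 0 < x) (nhds t)"
      using 3 by (intro order_tendstoD) (auto intro: filterlim_ident)
    then have "eventually (\<lambda>x. flat k x = poly (flat_poly k) (1 / x) * exp (- (1 / x))) (nhds t)"
      by eventually_elim (simp add: flat_def)
    ultimately show ?thesis
      by (subst DERIV_cong_ev[OF refl _ refl]) auto
  qed
qed

lemma flat_0: "flat 0 t = (if 0 < t then exp (- (1 / t)) else 0)"
  by (simp add: flat_def)

lemma flat_1: "flat (Suc 0) t = (if 0 < t then exp (- (1 / t)) / t\<^sup>2 else 0)"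
  by (simp add: flat_def power2_eq_square)

lemma continuous_on_flat [continuous_intros]:
  "continuous_on S f \<Longrightarrow> continuous_on S (\<lambda>x. flat k (f x))"
  by (rule continuous_on_compose2[of UNIV "flat k"])
     (auto intro: DERIV_continuous_on flat_has_derivative)

text \<open>\<open>smooth\<close> quantifies over all iterated partial derivatives. A class closed
  under directional differentiation reduces this to one induction on the list of directions. The
  radial test functions and the near-optimal functions on the half space are built inside
  it.\<close>

inductive_set flat_alg :: "('a::euclidean_space \<Rightarrow> real) set" where
  const: "(\<lambda>_. c) \<in> flat_alg"
| inner: "(\<lambda>x. x \<bullet> v) \<in> flat_alg"
| add: "f \<in> flat_alg \<Longrightarrow> g \<in> flat_alg \<Longrightarrow> (\<lambda>x. f x + g x) \<in> flat_alg"
| mult: "f \<in> flat_alg \<Longrightarrow> g \<in> flat_alg \<Longrightarrow> (\<lambda>x. f x * g x) \<in> flat_alg"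
| flat: "f \<in> flat_alg \<Longrightarrow> (\<lambda>x. flat k (f x)) \<in> flat_alg"

lemma flat_alg_derivative:
  assumes "f \<in> flat_alg"
  shows "\<exists>D. (\<forall>x. (f has_derivative D x) (at x)) \<and> (\<forall>v. (\<lambda>x. D x v) \<in> flat_alg)"
  using assms
proof induction
  case (const c)
  show ?case by (rule exI[of _ "\<lambda>_ _. 0"]) (auto intro: flat_alg.const)
next
  case (inner v)
  show ?case
    by (rule exI[of _ "\<lambda>_ h. h \<bullet> v"])
       (auto intro: flat_alg.const bounded_linear_imp_has_derivative bounded_linear_inner_left)
next
  case (add f g)
  then obtain D E where "\<And>x. (f has_derivative D x) (at x)" "\<And>x. (g has_derivative E x) (at x)"
    "\<And>v. (\<lambda>x. D x v) \<in> flat_alg" "\<And>v. (\<lambda>x. E x v) \<in> flat_alg" by metis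
  then show ?case
    by (intro exI[of _ "\<lambda>x h. D x h + E x h"]) (auto intro: flat_alg.add has_derivative_add)
next
  case (mult f g)
  then obtain D E where "\<And>x. (f has_derivative D x) (at x)" "\<And>x. (g has_derivative E x) (at x)"
    "\<And>v. (\<lambda>x. D x v) \<in> flat_alg" "\<And>v. (\<lambda>x. E x v) \<in> flat_alg" by metis
  with mult show ?case
    by (intro exI[of _ "\<lambda>x h. f x * E x h + D x h * g x"])
       (auto intro!: flat_alg.add flat_alg.mult has_derivative_mult)
next
  case (flat f k)
  then obtain D where D: "\<And>x. (f has_derivative D x) (at x)" "\<And>v. (\<lambda>x. D x v) \<in> flat_alg"
    by metis
  have "((\<lambda>x. flat k (f x)) has_derivative (\<lambda>h. flat (Suc k) (f x) * D x h)) (at x)" for x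
    using has_derivative_compose[OF D(1) flat_has_derivative[unfolded has_field_derivative_def]]
    by simp
  with flat D show ?case
    by (intro exI[of _ "\<lambda>x h. flat (Suc k) (f x) * D x h"])
       (auto intro!: flat_alg.mult flat_alg.flat)
qed

lemma smooth_flat_alg:
  fixes f :: "'a::euclidean_space \<Rightarrow> real"
  assumes "f \<in> flat_alg"
  shows "smooth f"
proof -
  have "dpart is f \<in> flat_alg" for "is" :: "'a list"
  proof (induction "is")
    case (Cons i js)
    from flat_alg_derivative[OF this] obtain D where
      D: "\<And>x. (dpart js f has_derivative D x) (at x)" "\<And>v. (\<lambda>x. D x v) \<in> flat_alg" by metis
    have "dpart (i # js) f = (\<lambda>x. D x i)"
      using frechet_derivative_at[OF D(1)] by (auto simp: fun_eq_iff)
    with D show ?case by simp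
  qed (use assms in simp)
  then show ?thesis
    unfolding smooth_def differentiable_def using flat_alg_derivative by metis
qed

section \<open>Gradients of test functions and their affine rescaling\<close>

lemma smooth_dpart_has_derivative:
  fixes u :: "'a::euclidean_space \<Rightarrow> real"
  assumes "smooth u" "set is \<subseteq> Basis"
  shows "(dpart is u has_derivative frechet_derivative (dpart is u) (at x)) (at x)"
  using assms by (simp add: smooth_def frechet_derivative_works)

lemma has_derivative_grad:
  fixes u :: "'a::euclidean_space \<Rightarrow> real"
  assumes "smooth u"
  shows "(u has_derivative (\<lambda>h. grad u x \<bullet> h)) (at x)"
proof -
  have D: "(u has_derivative frechet_derivative u (at x)) (at x)"
    using smooth_dpart_has_derivative[OF assms, of "[]"] by simp
  interpret bounded_linear "frechet_derivative u (at x)" by (rule has_derivative_bounded_linear[OF D])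
  have "frechet_derivative u (at x) h = grad u x \<bullet> h" for h
  proof -
    have "frechet_derivative u (at x) h = (\<Sum>b\<in>Basis. (h \<bullet> b) * frechet_derivative u (at x) b)"
      by (subst (1) euclidean_representation[of h, symmetric]) (simp only: sum scaleR real_scaleR_def)
    then show ?thesis
      by (simp add: grad_def inner_sum_right inner_commute[of _ h] mult.commute)
  qed
  then have "frechet_derivative u (at x) = (\<lambda>h. grad u x \<bullet> h)" by (rule ext)
  with D show ?thesis by simp
qed

lemma grad_eqI:
  fixes u :: "'a::euclidean_space \<Rightarrow> real"
  assumes "smooth u" "(u has_derivative (\<lambda>h. g \<bullet> h)) (at x)"
  shows "grad u x = g"
proof -
  have "(\<lambda>h. grad u x \<bullet> h) = (\<lambda>h. g \<bullet> h)"
    using has_derivative_unique[OF has_derivative_grad[OF assms(1)] assms(2)] .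
  then have "\<forall>h. grad u x \<bullet> h = g \<bullet> h" by (simp add: fun_eq_iff)
  then show ?thesis by (simp only: vector_eq_rdot)
qed

lemma continuous_on_grad:
  fixes u :: "'a::euclidean_space \<Rightarrow> real"
  assumes "smooth u"
  shows "continuous_on S (grad u)"
proof -
  have "continuous_on S (dpart [i] u)" if "i \<in> Basis" for i
    using that
    by (intro continuous_at_imp_continuous_on ballI
        has_derivative_continuous[OF smooth_dpart_has_derivative[OF assms]]) simp
  then show ?thesis unfolding grad_def [abs_def] by (intro continuous_intros)
qed

lemma continuous_on_smooth: "smooth u \<Longrightarrow> continuous_on S u"
  by (intro continuous_at_imp_continuous_on ballI has_derivative_continuous[OF has_derivative_grad])

lemma test_fun_zero: "test_fun \<Omega> u \<Longrightarrow> x \<notin> closure {x. u x \<noteq> 0} \<Longrightarrow> u x = 0"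
  using closure_subset[of "{x. u x \<noteq> 0}"] by blast

lemma test_fun_grad_zero:
  assumes "test_fun \<Omega> u" "x \<notin> closure {x. u x \<noteq> 0}"
  shows "grad u x = 0"
proof (rule grad_eqI)
  show "smooth u" using assms(1) unfolding test_fun_def by blast
  have ev: "eventually (\<lambda>y. y \<in> - closure {x. u x \<noteq> 0}) (at x)"
    by (rule topological_tendstoD[OF tendsto_ident_at])
       (simp_all only: open_Compl closed_closure Compl_iff assms(2) not_False_eq_True)
  have "((\<lambda>_. 0) has_derivative (\<lambda>h. 0 \<bullet> h)) (at x)" by simp
  then show "(u has_derivative (\<lambda>h. 0 \<bullet> h)) (at x)"
  proof (rule has_derivative_transform_eventually)
    show "eventually (\<lambda>y. 0 = u y) (at x)"
      using ev by (rule eventually_mono) (rule test_fun_zero[OF assms(1), symmetric], blast)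
    show "0 = u x" by (rule test_fun_zero[OF assms, symmetric])
  qed blast
qed

text \<open>The two claims go through one induction: the formula for \<open>dpart (i # js)\<close>
  is read off from the derivative that the second claim supplies for \<open>js\<close>.\<close>

lemma dpart_affine:
  fixes u :: "'a::euclidean_space \<Rightarrow> real"
  assumes "smooth u" "l \<noteq> 0" "set is \<subseteq> Basis"
  shows "dpart is (\<lambda>x. u ((x - p) /\<^sub>R l)) = (\<lambda>x. inverse l ^ length is * dpart is u ((x - p) /\<^sub>R l))"
    and "((\<lambda>x. inverse l ^ length is * dpart is u ((x - p) /\<^sub>R l)) has_derivative
      (\<lambda>h. inverse l ^ length is * frechet_derivative (dpart is u) (at ((x - p) /\<^sub>R l)) (h /\<^sub>R l))) (at x)"
  using assms(3)
proof (induction "is" arbitrary: x)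
  case Nil
  { case 1 show ?case by simp }
  { case 2
    have "((\<lambda>x. (x - p) /\<^sub>R l) has_derivative (\<lambda>h. h /\<^sub>R l)) (at x)"
      by (auto intro!: derivative_eq_intros)
    from has_derivative_compose[OF this smooth_dpart_has_derivative[OF assms(1) 2]]
    show ?case by simp }
next
  case (Cons i js)
  { case 1
    then have js: "set js \<subseteq> Basis" and i: "i \<in> Basis" by auto
    have lin: "linear (frechet_derivative (dpart js u) (at y))" for y
      using smooth_dpart_has_derivative[OF assms(1) js] has_derivative_linear by blast
    show ?case
      using frechet_derivative_at[OF Cons.IH(2)[OF js], symmetric] Cons.IH(1)[OF js]
      by (simp add: linear_scale[OF lin] mult_ac) }
  { case 2
    have "((\<lambda>x. (x - p) /\<^sub>R l) has_derivative (\<lambda>h. h /\<^sub>R l)) (at x)"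
      by (auto intro!: derivative_eq_intros)
    from has_derivative_compose[OF this smooth_dpart_has_derivative[OF assms(1) 2]]
    show ?case by (rule has_derivative_mult_right) }
qed

lemma smooth_affine:
  assumes "smooth u" "l \<noteq> 0"
  shows "smooth (\<lambda>x. u ((x - p) /\<^sub>R l))"
  unfolding smooth_def differentiable_def
  using dpart_affine[OF assms] by (metis (no_types, lifting))

lemma grad_affine:
  assumes "smooth u" "l \<noteq> 0"
  shows "grad (\<lambda>x. u ((x - p) /\<^sub>R l)) x = grad u ((x - p) /\<^sub>R l) /\<^sub>R l"
proof (rule grad_eqI[OF smooth_affine[OF assms]])
  have "((\<lambda>x. (x - p) /\<^sub>R l) has_derivative (\<lambda>h. h /\<^sub>R l)) (at x)"
    by (auto intro!: derivative_eq_intros)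
  from has_derivative_compose[OF this has_derivative_grad[OF assms(1)]]
  show "((\<lambda>x. u ((x - p) /\<^sub>R l)) has_derivative (\<lambda>h. (grad u ((x - p) /\<^sub>R l) /\<^sub>R l) \<bullet> h)) (at x)"
    by simp
qed

section \<open>Integrals of compactly supported functions, translation and scaling\<close>

lemma integrable_compact_support:
  fixes f :: "'a::euclidean_space \<Rightarrow> real"
  assumes "compact S" "continuous_on S f" "\<And>x. x \<notin> S \<Longrightarrow> f x = 0"
  shows "integrable lborel f"
proof -
  have "(\<lambda>x. indicator S x *\<^sub>R f x) = f" using assms(3) by (auto simp: indicator_def fun_eq_iff)
  with borel_integrable_compact[OF assms(1,2)] show ?thesis by simp
qed

text \<open>Bridge between the gauge integral, in which the theorem and the Leibniz rule are
  phrased, and the Lebesgue integral, in which Fubini, substitution and dominated convergence are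
  used.\<close>

lemma integral_eq_lborel:
  fixes f :: "'a::euclidean_space \<Rightarrow> real"
  assumes "integrable lborel f" "\<And>x. x \<notin> S \<Longrightarrow> f x = 0"
  shows "integral S f = (\<integral>x. f x \<partial>lborel)"
proof -
  have "(\<lambda>x. if x \<in> S then f x else 0) = f" using assms(2) by auto
  then show ?thesis
    using integral_restrict_UNIV[of S f] integral_lborel[OF assms(1)] by simp
qed

lemma integral_shift:
  fixes f :: "'a::euclidean_space \<Rightarrow> real"
  assumes [measurable]: "f \<in> borel_measurable borel"
  shows "(\<integral>x. f (x + c) \<partial>lborel) = (\<integral>x. f x \<partial>lborel)"
proof -
  have "(\<integral>x. f x \<partial>lborel) = (\<integral>x. f x \<partial>distr lborel borel ((+) c))"
    by (simp add: lborel_distr_plus)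
  also have "\<dots> = (\<integral>x. f (c + x) \<partial>lborel)"
    by (rule integral_distr) auto
  finally show ?thesis by (simp add: add.commute)
qed

lemma integral_scale:
  fixes f :: "'a::euclidean_space \<Rightarrow> real"
  assumes [measurable]: "f \<in> borel_measurable borel" and "c \<noteq> 0"
  shows "(\<integral>x. f x \<partial>lborel) = \<bar>c\<bar> ^ DIM('a) * (\<integral>x. f (t + c *\<^sub>R x) \<partial>lborel)"
proof -
  have "(\<integral>x. f x \<partial>lborel) = (\<integral>x. f x \<partial>density (distr lborel borel (\<lambda>x. t + c *\<^sub>R x)) (\<lambda>_. \<bar>c\<bar>^DIM('a)))"
    by (subst lborel_affine[OF assms(2), of t]) (rule refl)
  also have "\<dots> = (\<integral>x. \<bar>c\<bar>^DIM('a) *\<^sub>R f x \<partial>distr lborel borel (\<lambda>x. t + c *\<^sub>R x))"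
    by (subst integral_density) auto
  also have "\<dots> = (\<integral>x. \<bar>c\<bar>^DIM('a) *\<^sub>R f (t + c *\<^sub>R x) \<partial>lborel)"
    by (rule integral_distr) auto
  finally show ?thesis by simp
qed

section \<open>Radial kernels\<close>

text \<open>The integral of F(x + t v) over x does not depend on t, so differentiating under the
  integral sign at t = 0 gives 0. Only the derivative along \<open>v\<close> has to be
  continuous.\<close>

lemma integral_directional_derivative:
  fixes F :: "'a::euclidean_space \<Rightarrow> real"
  assumes S: "compact S" and zero: "\<And>x. x \<notin> S \<Longrightarrow> F x = 0"
    and der: "\<And>x. (F has_derivative F' x) (at x)"
    and cont: "continuous_on UNIV (\<lambda>x. F' x v)"
  shows "integrable lborel (\<lambda>x. F' x v)" "(\<integral>x. F' x v \<partial>lborel) = 0"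
proof -
  have F'0: "F' x v = 0" if "x \<notin> S" for x
  proof -
    have "eventually (\<lambda>y. y \<in> - S) (at x)"
      by (rule topological_tendstoD[OF tendsto_ident_at])
         (use that S in \<open>simp_all add: open_Compl compact_imp_closed\<close>)
    then have "eventually (\<lambda>y. F y = 0) (at x)"
      by (rule eventually_mono) (use zero in blast)
    from der[of x] this have "((\<lambda>_. 0) has_derivative F' x) (at x)"
      by (rule has_derivative_transform_eventually) (auto simp: zero[OF that])
    then have "F' x = (\<lambda>_. 0)"
      by (rule has_derivative_unique) (rule has_derivative_const)
    then show ?thesis by simp
  qed
  show int: "integrable lborel (\<lambda>x. F' x v)"
    using continuous_on_subset[OF cont] F'0 by (intro integrable_compact_support[OF S]) auto
  have contF: "continuous_on A F" for A
    using der by (intro continuous_at_imp_continuous_on ballI has_derivative_continuous)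
  have F [measurable]: "F \<in> borel_measurable borel"
    by (rule borel_measurable_continuous_onI[OF contF])
  obtain B where B: "\<And>x. x \<in> S \<Longrightarrow> norm x \<le> B"
    using compact_imp_bounded[OF S] bounded_iff by blast
  \<comment> \<open>A fixed box for the Leibniz rule that contains the support of every translate
    with |t| \<le> 1.\<close>
  obtain c where c: "cball 0 (B + norm v) \<subseteq> cbox (- c) (c :: 'a)"
    using bounded_subset_cbox_symmetric[OF bounded_cball] by blast
  have out: "x + t *\<^sub>R v \<notin> S" if "x \<notin> cbox (- c) c" "t \<in> {-1..1}" for x t
  proof
    assume "x + t *\<^sub>R v \<in> S"
    then have "norm (x + t *\<^sub>R v) \<le> B" by (rule B)
    moreover have "norm x \<le> norm (x + t *\<^sub>R v) + norm (t *\<^sub>R v)"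
      using norm_triangle_ineq4[of "x + t *\<^sub>R v" "t *\<^sub>R v"] by simp
    moreover have "norm (t *\<^sub>R v) \<le> norm v"
      using that(2) by (simp add: mult_left_le_one_le abs_le_iff)
    ultimately have "x \<in> cball 0 (B + norm v)" by simp
    with c that(1) show False by blast
  qed
  define I where "I = (\<integral>x. F x \<partial>lborel)"
  have const: "integral (cbox (- c) c) (\<lambda>x. F (x + t *\<^sub>R v)) = I" if "t \<in> {-1..1}" for t
  proof -
    have z: "F (x + t *\<^sub>R v) = 0" if "x \<notin> cbox (- c) c" for x
      using out[OF that \<open>t \<in> {-1..1}\<close>] zero by blast
    have "continuous_on A (\<lambda>x. F (x + t *\<^sub>R v))" for A
      by (rule continuous_on_compose2[OF contF[of UNIV]]) (auto intro!: continuous_intros)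
    then have "integrable lborel (\<lambda>x. F (x + t *\<^sub>R v))"
      using z by (intro integrable_compact_support[of "cbox (- c) c"]) auto
    then show ?thesis
      using integral_eq_lborel[of "\<lambda>x. F (x + t *\<^sub>R v)" "cbox (- c) c"] z integral_shift[OF F]
      by (simp add: I_def)
  qed
  have "((\<lambda>t. integral (cbox (- c) c) (\<lambda>x. F (x + t *\<^sub>R v))) has_real_derivative
      integral (cbox (- c) c) (\<lambda>x. F' (x + 0 *\<^sub>R v) v)) (at 0 within {-1..1})"
  proof (rule leibniz_rule_field_derivative[where fx = "\<lambda>t x. F' (x + t *\<^sub>R v) v"])
    fix t :: real and x assume t: "t \<in> {-1..1}" "x \<in> cbox (- c) c"
    have "((\<lambda>t. x + t *\<^sub>R v) has_derivative (\<lambda>h. h *\<^sub>R v)) (at t within {-1..1})"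
      by (auto intro!: derivative_eq_intros)
    from has_derivative_compose[OF this der]
    have "((\<lambda>t. F (x + t *\<^sub>R v)) has_derivative (\<lambda>h. F' (x + t *\<^sub>R v) (h *\<^sub>R v))) (at t within {-1..1})" .
    moreover have "F' (x + t *\<^sub>R v) (h *\<^sub>R v) = F' (x + t *\<^sub>R v) v * h" for h
      using linear_scale[OF has_derivative_linear[OF der]] by simp
    ultimately show "((\<lambda>t. F (x + t *\<^sub>R v)) has_real_derivative F' (x + t *\<^sub>R v) v) (at t within {-1..1})"
      by (simp add: has_field_derivative_def)
  next
    fix t :: real
    show "(\<lambda>x. F (x + t *\<^sub>R v)) integrable_on cbox (- c) c"
      by (rule integrable_continuous, rule continuous_on_compose2[OF contF[of UNIV]])
         (auto intro!: continuous_intros)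
  next
    show "continuous_on ({-1..1} \<times> cbox (- c) c) (\<lambda>(t, x). F' (x + t *\<^sub>R v) v)"
      unfolding split_beta
      by (rule continuous_on_compose2[OF cont]) (auto intro!: continuous_intros)
  qed auto
  moreover have "((\<lambda>t. integral (cbox (- c) c) (\<lambda>x. F (x + t *\<^sub>R v))) has_real_derivative 0)
      (at 0 within {-1..1})"
    by (rule has_field_derivative_transform_within[of "\<lambda>_. I" 0 0 "{-1..1}" 1]) (use const in auto)
  ultimately have "integral (cbox (- c) c) (\<lambda>x. F' (x + 0 *\<^sub>R v) v) = 0"
    by (rule has_field_derivative_unique) (simp add: at_within_Icc_at)
  moreover have "integral (cbox (- c) c) (\<lambda>x. F' x v) = (\<integral>x. F' x v \<partial>lborel)"
    using out[of _ 0] F'0 by (intro integral_eq_lborel[OF int]) simp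
  ultimately show "(\<integral>x. F' x v \<partial>lborel) = 0" by simp
qed

definition bump :: "'a::euclidean_space \<Rightarrow> real" where
  "bump z = flat 0 (1 - z \<bullet> z)"

text \<open>\<open>flat (Suc 0)\<close> is the derivative of \<open>flat 0\<close>, and the factor 2
  comes from z . z, so that the gradient of \<open>bump\<close> at z is
  \<open>- ker z *\<^sub>R z\<close>.\<close>

definition ker :: "'a::euclidean_space \<Rightarrow> real" where
  "ker z = 2 * flat (Suc 0) (1 - z \<bullet> z)"

lemma flat_nonneg: "0 \<le> flat 0 t" "0 \<le> flat (Suc 0) t"
  by (simp_all add: flat_0 flat_1)

lemma flat_nonpos_eq_0: "t \<le> 0 \<Longrightarrow> flat k t = 0"
  by (simp add: flat_def)

lemma ker_nonneg: "0 \<le> ker z" and bump_nonneg: "0 \<le> bump z"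
  by (simp_all add: ker_def bump_def flat_nonneg)

lemma inner_self_ge_1: "1 \<le> norm z \<Longrightarrow> 1 \<le> z \<bullet> z"
  by (simp add: dot_square_norm)

lemma ker_eq_0: "1 \<le> norm z \<Longrightarrow> ker z = 0" and bump_eq_0: "1 \<le> norm z \<Longrightarrow> bump z = 0"
  using inner_self_ge_1[of z] by (simp_all add: ker_def bump_def flat_nonpos_eq_0)

lemma ker_pos: "norm z < 1 \<Longrightarrow> 0 < ker z" and bump_pos: "norm z < 1 \<Longrightarrow> 0 < bump z"
proof -
  assume "norm z < 1"
  then have "z \<bullet> z < 1" by (simp add: dot_square_norm power_less_one_iff abs_square_less_1)
  then show "0 < ker z" "0 < bump z" by (simp_all add: ker_def bump_def flat_0 flat_1)
qed

lemma ker_minus [simp]: "ker (- z) = ker z"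
  by (simp add: ker_def)

lemma continuous_on_ker [continuous_intros]:
  "continuous_on S f \<Longrightarrow> continuous_on S (\<lambda>x. ker (f x))"
  and continuous_on_bump [continuous_intros]:
  "continuous_on S f \<Longrightarrow> continuous_on S (\<lambda>x. bump (f x))"
  unfolding ker_def bump_def by (intro continuous_intros; assumption)+

lemma bump_has_derivative: "(bump has_derivative (\<lambda>h. - ker z * (z \<bullet> h))) (at z)"
proof -
  have "((\<lambda>z. 1 - z \<bullet> z) has_derivative (\<lambda>h. - (2 * (z \<bullet> h)))) (at z)"
    by (auto intro!: derivative_eq_intros simp: inner_commute)
  from has_derivative_compose[OF this flat_has_derivative[unfolded has_field_derivative_def]]
  show ?thesis by (simp add: bump_def [abs_def] ker_def mult_ac)
qed

lemma integrable_ker_mult: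
  assumes "continuous_on (cball 0 1) f"
  shows "integrable lborel (\<lambda>z::'a::euclidean_space. ker z * f z)"
  by (rule integrable_compact_support[of "cball 0 1"]) (auto intro!: continuous_intros assms ker_eq_0)

text \<open>The derivative of bump(z) (b . z) along a is bump(z) (a . b) - ker(z) (a . z) (b . z),
  and its integral vanishes. In particular all unit directions have the same second moment, the
  integral of \<open>bump\<close>.\<close>

lemma ker_second_moment:
  fixes a b :: "'a::euclidean_space"
  shows "(\<integral>z. ker z * ((a \<bullet> z) * (b \<bullet> z)) \<partial>lborel) = (a \<bullet> b) * integral\<^sup>L lborel (bump :: 'a \<Rightarrow> real)"
proof -
  define G :: "'a \<Rightarrow> 'a \<Rightarrow> real" where
    "G z h = bump z * (b \<bullet> h) + (- ker z * (z \<bullet> h)) * (b \<bullet> z)" for z h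
  have "((\<lambda>z. bump z * (b \<bullet> z)) has_derivative G z) (at z)" for z
    unfolding G_def [abs_def]
    by (rule has_derivative_mult[OF bump_has_derivative])
       (rule bounded_linear_imp_has_derivative[OF bounded_linear_inner_right])
  moreover have "continuous_on UNIV (\<lambda>z. G z a)"
    unfolding G_def by (intro continuous_intros)
  ultimately have "(\<integral>z. G z a \<partial>lborel) = 0"
    by (intro integral_directional_derivative(2)[of "cball 0 1" "\<lambda>z. bump z * (b \<bullet> z)"]) (auto intro: bump_eq_0)
  moreover have "(\<integral>z. G z a \<partial>lborel) =
      (\<integral>z. bump (z :: 'a) * (b \<bullet> a) \<partial>lborel) - (\<integral>z. ker z * ((a \<bullet> z) * (b \<bullet> z)) \<partial>lborel)"
  proof -
    have "G z a = bump z * (b \<bullet> a) - ker z * ((a \<bullet> z) * (b \<bullet> z))" for z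
      by (simp add: G_def inner_commute)
    moreover have "integrable lborel (\<lambda>z::'a. bump z * (b \<bullet> a))"
      by (rule integrable_compact_support[of "cball 0 1"]) (auto intro!: continuous_intros bump_eq_0)
    moreover have "integrable lborel (\<lambda>z. ker z * ((a \<bullet> z) * (b \<bullet> z)))"
      by (intro integrable_ker_mult continuous_intros)
    ultimately show ?thesis by simp
  qed
  ultimately show ?thesis by (simp add: inner_commute mult.commute)
qed

lemma integral_pos_on_ball:
  fixes f :: "'a::euclidean_space \<Rightarrow> real"
  assumes "integrable lborel f" "\<And>x. 0 \<le> f x" "0 < r" "\<And>x. x \<in> ball c r \<Longrightarrow> 0 < f x"
  shows "0 < (\<integral>x. f x \<partial>lborel)"
proof -
  have "(\<integral>x. f x \<partial>lborel) \<noteq> 0"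
  proof
    assume "(\<integral>x. f x \<partial>lborel) = 0"
    then have "AE x in lborel. f x = 0"
      using integral_nonneg_eq_0_iff_AE[OF assms(1)] assms(2) by simp
    then have "AE x in lborel. x \<notin> ball c r"
      by eventually_elim (use assms(4) in force)
    then have "emeasure lborel (ball c r) = 0"
      by (subst (asm) AE_iff_measurable[of "ball c r"]) auto
    then show False
      using content_ball_pos[OF assms(3), of c] by (simp add: measure_def)
  qed
  moreover have "0 \<le> (\<integral>x. f x \<partial>lborel)" using assms(2) by simp
  ultimately show ?thesis by linarith
qed

lemma integral_ker_pos: "0 < integral\<^sup>L lborel (ker :: 'a::euclidean_space \<Rightarrow> real)"
  and integral_bump_pos: "0 < integral\<^sup>L lborel (bump :: 'a::euclidean_space \<Rightarrow> real)"
proof -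
  have "integrable lborel (ker :: 'a \<Rightarrow> real)" "integrable lborel (bump :: 'a \<Rightarrow> real)"
    by (rule integrable_compact_support[of "cball 0 1"]; auto intro!: continuous_intros ker_eq_0 bump_eq_0)+
  then show "0 < integral\<^sup>L lborel (ker :: 'a \<Rightarrow> real)" "0 < integral\<^sup>L lborel (bump :: 'a \<Rightarrow> real)"
    by (auto intro!: integral_pos_on_ball[where r = 1 and c = 0] ker_nonneg bump_nonneg ker_pos bump_pos)
qed

section \<open>Radial test functions and their Laplacian\<close>

lemma flat_alg_sum: "finite A \<Longrightarrow> (\<And>b. b \<in> A \<Longrightarrow> g b \<in> flat_alg) \<Longrightarrow> (\<lambda>x. \<Sum>b\<in>A. g b x) \<in> flat_alg"
  by (induction A rule: finite_induct) (auto intro: flat_alg.intros)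

lemma flat_alg_sq_dist: "(\<lambda>y. (y - x) \<bullet> (y - x)) \<in> flat_alg"
proof -
  have "(\<lambda>y. y \<bullet> b + - (x \<bullet> b)) \<in> flat_alg" for b
    by (intro flat_alg.intros)
  then have "(\<lambda>y. \<Sum>b\<in>Basis. (y \<bullet> b + - (x \<bullet> b)) * (y \<bullet> b + - (x \<bullet> b))) \<in> flat_alg"
    by (intro flat_alg_sum flat_alg.mult) auto
  moreover have "(y - x) \<bullet> (y - x) = (\<Sum>b\<in>Basis. (y \<bullet> b + - (x \<bullet> b)) * (y \<bullet> b + - (x \<bullet> b)))" for y
    by (subst euclidean_inner) (simp add: inner_diff_left)
  ultimately show ?thesis by simp
qed

lemma flat_alg_smul: "f \<in> flat_alg \<Longrightarrow> (\<lambda>x. c * f x) \<in> flat_alg"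
  by (intro flat_alg.mult flat_alg.const)

lemma flat_alg_diff: "f \<in> flat_alg \<Longrightarrow> g \<in> flat_alg \<Longrightarrow> (\<lambda>x. f x - g x) \<in> flat_alg"
  using flat_alg.add[of f "\<lambda>x. - 1 * g x"] flat_alg_smul[of g "- 1"] by simp

text \<open>With \<open>c = inverse (r\<^sup>2)\<close>, \<open>radial 0 c x\<close> is
  \<open>bump\<close> rescaled to the ball of radius r about x, and twice
  \<open>radial (Suc 0) c x\<close> is \<open>ker\<close> rescaled in the same way. The parameter c
  keeps the argument of \<open>flat\<close> polynomial in y.\<close>

definition radial :: "nat \<Rightarrow> real \<Rightarrow> 'a::euclidean_space \<Rightarrow> 'a \<Rightarrow> real" where
  "radial k c x y = flat k (1 - c * ((y - x) \<bullet> (y - x)))"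

lemma smooth_radial: "smooth (radial k c x)"
  unfolding radial_def [abs_def]
  by (intro smooth_flat_alg flat_alg.flat flat_alg_diff flat_alg_smul flat_alg_sq_dist flat_alg.const)

lemma radial_eq_0:
  assumes "0 < r" "y \<notin> cball x r"
  shows "radial k (inverse (r\<^sup>2)) x y = 0"
proof -
  have "r\<^sup>2 \<le> (y - x) \<bullet> (y - x)"
    using assms by (simp add: dot_square_norm dist_norm norm_minus_commute power_mono)
  with assms(1) show ?thesis
    by (simp add: radial_def flat_nonpos_eq_0 field_simps)
qed

lemma test_fun_radial:
  assumes "0 < r" "cball x r \<subseteq> \<Omega>"
  shows "test_fun \<Omega> (radial k (inverse (r\<^sup>2)) x)"
proof -
  let ?A = "{y. radial k (inverse (r\<^sup>2)) x y \<noteq> 0}"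
  have "?A \<subseteq> cball x r" using radial_eq_0[OF assms(1)] by blast
  then have sub: "closure ?A \<subseteq> cball x r" by (rule closure_minimal) (rule closed_cball)
  then have "compact (closure ?A)"
    unfolding compact_eq_bounded_closed
    by (intro conjI closed_closure bounded_subset[OF bounded_cball sub])
  then show ?thesis
    unfolding test_fun_def by (intro conjI smooth_radial order_trans[OF sub assms(2)])
qed

lemma radial_has_derivative:
  "(radial k c x has_derivative (\<lambda>h. radial (Suc k) c x y * (- 2 * c * ((y - x) \<bullet> h)))) (at y)"
proof -
  have "((\<lambda>y. 1 - c * ((y - x) \<bullet> (y - x))) has_derivative (\<lambda>h. - 2 * c * ((y - x) \<bullet> h))) (at y)"
    by (auto intro!: derivative_eq_intros simp: inner_commute)
  from has_derivative_compose[OF this flat_has_derivative[unfolded has_field_derivative_def]]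
  show ?thesis by (simp add: radial_def [abs_def])
qed

lemma laplacian_radial:
  fixes x y :: "'a::euclidean_space"
  shows "laplacian (radial 0 c x) y =
    4 * c\<^sup>2 * ((y - x) \<bullet> (y - x)) * radial (Suc (Suc 0)) c x y
    - 2 * c * DIM('a) * radial (Suc 0) c x y"
proof -
  have d1: "dpart [i] (radial 0 c x) = (\<lambda>y. radial (Suc 0) c x y * (- 2 * c * ((y - x) \<bullet> i)))" for i
    by (rule ext) (simp add: frechet_derivative_at[OF radial_has_derivative[of 0 c x], symmetric])
  have d2: "dpart [i, i] (radial 0 c x) y =
      4 * c\<^sup>2 * ((y - x) \<bullet> i)\<^sup>2 * radial (Suc (Suc 0)) c x y - 2 * c * radial (Suc 0) c x y"
    if "i \<in> Basis" for i
  proof -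
    have l: "((\<lambda>y. - 2 * c * ((y - x) \<bullet> i)) has_derivative (\<lambda>h. - 2 * c * (h \<bullet> i))) (at y)"
      by (auto intro!: derivative_eq_intros)
    have "((\<lambda>y. radial (Suc 0) c x y * (- 2 * c * ((y - x) \<bullet> i))) has_derivative
        (\<lambda>h. radial (Suc 0) c x y * (- 2 * c * (h \<bullet> i))
          + radial (Suc (Suc 0)) c x y * (- 2 * c * ((y - x) \<bullet> h)) * (- 2 * c * ((y - x) \<bullet> i)))) (at y)"
      by (rule has_derivative_mult[OF radial_has_derivative l])
    then have "dpart [i, i] (radial 0 c x) y = radial (Suc 0) c x y * (- 2 * c * (i \<bullet> i))
          + radial (Suc (Suc 0)) c x y * (- 2 * c * ((y - x) \<bullet> i)) * (- 2 * c * ((y - x) \<bullet> i))"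
      by (simp only: dpart.simps(2)[of i "[i]"] d1 frechet_derivative_at[symmetric])
    with that show ?thesis by (simp add: power2_eq_square)
  qed
  have "(\<Sum>i\<in>Basis. ((y - x) \<bullet> i)\<^sup>2) = (y - x) \<bullet> (y - x)"
    by (subst euclidean_inner) (simp add: power2_eq_square)
  moreover have "laplacian (radial 0 c x) y = (\<Sum>i\<in>Basis.
      4 * c\<^sup>2 * ((y - x) \<bullet> i)\<^sup>2 * radial (Suc (Suc 0)) c x y - 2 * c * radial (Suc 0) c x y)"
    unfolding laplacian_def by (rule sum.cong[OF refl d2])
  ultimately show ?thesis
    by (simp add: sum_subtractf sum_distrib_left [symmetric] sum_distrib_right [symmetric])
qed

section \<open>The mean value inequality\<close>

text \<open>With n the dimension and q = |y - x|^2 this reads d/dt (t^-n ker(w/t)) = t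
  Laplacian(t^-n bump(w/t)), w = y - x. Reason: the left side is - t^(-n-1) times the divergence of
  z ker(z) at z = w/t, and z ker(z) = - grad bump(z).\<close>

lemma scaled_inverse_power_has_derivative:
  fixes q t :: real
  assumes "0 < t"
  shows "((\<lambda>t. inverse t ^ n * (2 * flat (Suc 0) (1 - inverse (t\<^sup>2) * q))) has_real_derivative
    t * inverse t ^ n * (4 * (inverse (t\<^sup>2))\<^sup>2 * q * flat (Suc (Suc 0)) (1 - inverse (t\<^sup>2) * q)
      - 2 * inverse (t\<^sup>2) * n * flat (Suc 0) (1 - inverse (t\<^sup>2) * q))) (at t)"
proof -
  let ?c = "inverse (t\<^sup>2)"
  define i where "i = inverse t"
  have i: "t * i = 1" and c: "?c = i * i" using assms by (simp_all add: i_def power2_eq_square)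
  have "((\<lambda>t. inverse t ^ n) has_real_derivative of_nat n * (- (i * 1 * i) * i ^ (n - Suc 0))) (at t)"
    unfolding i_def using assms by (intro DERIV_power DERIV_inverse' DERIV_ident) simp
  \<comment> \<open>For n = 0 the exponent \<open>n - Suc 0\<close> is truncated, which is harmless
    because the factor n vanishes.\<close>
  moreover have "of_nat n * (- (i * 1 * i) * i ^ (n - Suc 0)) = t * i ^ n * (- n * ?c)"
  proof (cases n)
    case (Suc m)
    have e: "t * i ^ n = i ^ m" using i Suc by (simp add: mult.assoc [symmetric])
    show ?thesis unfolding e c by (simp add: Suc algebra_simps)
  qed simp
  ultimately have p: "((\<lambda>t. inverse t ^ n) has_real_derivative t * inverse t ^ n * (- n * ?c)) (at t)"
    unfolding i_def by (rule DERIV_cong)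
  have "((\<lambda>t. t\<^sup>2) has_real_derivative 2 * t) (at t)"
    by (auto intro!: derivative_eq_intros)
  then have "((\<lambda>t. 1 - inverse (t\<^sup>2) * q) has_real_derivative 0 - - (?c * (2 * t) * ?c) * q) (at t)"
    using assms by (intro DERIV_diff DERIV_const DERIV_cmult_right DERIV_inverse') simp_all
  then have "((\<lambda>t. 1 - inverse (t\<^sup>2) * q) has_real_derivative 2 * t * ?c\<^sup>2 * q) (at t)"
    by (rule DERIV_cong) (simp add: power2_eq_square mult_ac)
  from DERIV_chain2[OF flat_has_derivative[of "Suc 0"] this]
  have "((\<lambda>t. 2 * flat (Suc 0) (1 - inverse (t\<^sup>2) * q)) has_real_derivative
      2 * (flat (Suc (Suc 0)) (1 - ?c * q) * (2 * t * ?c\<^sup>2 * q))) (at t)"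
    by (rule DERIV_cmult)
  from DERIV_mult[OF p this] show ?thesis
    by (rule DERIV_cong) (simp add: algebra_simps)
qed

lemma ker_average_tendsto:
  fixes f :: "'a::euclidean_space \<Rightarrow> real"
  assumes cont: "continuous_on UNIV f" and "0 < e"
  shows "\<exists>s>0. \<forall>r. 0 < r \<and> r \<le> s \<longrightarrow>
    (\<integral>z. ker z * f (x + r *\<^sub>R z) \<partial>lborel) \<le> (f x + e) * integral\<^sup>L lborel (ker :: 'a \<Rightarrow> real)"
proof -
  have "isCont f x" using cont by (simp add: continuous_on_eq_continuous_at)
  then obtain s where s: "0 < s" "\<And>y. dist y x < s \<Longrightarrow> dist (f y) (f x) < e"
    using \<open>0 < e\<close> unfolding continuous_at_eps_delta by blast
  show ?thesis
  proof (intro exI[of _ "s / 2"] conjI allI impI)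
    fix r assume r: "0 < r \<and> r \<le> s / 2"
    have c: "continuous_on A (\<lambda>z. f (x + r *\<^sub>R z))" for A
      by (rule continuous_on_compose2[OF cont]) (auto intro!: continuous_intros)
    have "(\<integral>z. ker z * f (x + r *\<^sub>R z) \<partial>lborel) \<le> (\<integral>z. ker (z :: 'a) * (f x + e) \<partial>lborel)"
    proof (intro integral_mono integrable_ker_mult c continuous_intros)
      fix z :: 'a
      show "ker z * f (x + r *\<^sub>R z) \<le> ker z * (f x + e)"
      proof (cases "norm z < 1")
        case True
        have "r * norm z \<le> s / 2 * 1" using r True by (intro mult_mono) auto
        then have "dist (x + r *\<^sub>R z) x < s" using r s(1) by (simp add: dist_norm)
        from s(2)[OF this] show ?thesis
          by (intro mult_left_mono ker_nonneg) (simp add: dist_real_def abs_less_iff)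
      qed (simp add: ker_eq_0)
    qed
    then show "(\<integral>z. ker z * f (x + r *\<^sub>R z) \<partial>lborel) \<le> (f x + e) * integral\<^sup>L lborel (ker :: 'a \<Rightarrow> real)"
      by (simp add: mult.commute)
  qed (use s in simp)
qed

(* The derivative in r of the average over balls of radius r is a positive multiple of
   the pairing of f with the Laplacian of a radial test function. *)
lemma ker_mean_value:
  fixes f :: "'a::euclidean_space \<Rightarrow> real"
  assumes cont: "continuous_on UNIV f" and super: "neg_laplacian_nonneg \<Omega> f"
    and r: "0 < r" and sub: "cball x r \<subseteq> \<Omega>"
  shows "(\<integral>z. ker z * f (x + r *\<^sub>R z) \<partial>lborel) \<le> f x * integral\<^sup>L lborel (ker :: 'a \<Rightarrow> real)"
proof -
  define n where "n = DIM('a)"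
  define M where "M t = (\<integral>z. ker z * f (x + t *\<^sub>R z) \<partial>lborel)" for t
  obtain c where c: "cball x r \<subseteq> cbox (- c) (c :: 'a)"
    using bounded_subset_cbox_symmetric[OF bounded_cball] by blast
  \<comment> \<open>The substitution y = x + t z moves t from the argument of \<open>f\<close>,
    which is merely continuous, into the smooth kernel, where it can be differentiated.\<close>
  define G where "G t y = f y * (inverse t ^ n * (2 * radial (Suc 0) (inverse (t\<^sup>2)) x y))" for t y
  define P where "P t = integral (cbox (- c) c) (G t)" for t
  have cf: "continuous_on A f" for A using cont continuous_on_subset by blast
  have crad: "continuous_on A (radial k s x)" for A k s
    by (rule continuous_on_smooth[OF smooth_radial])
  have cG: "continuous_on A (G t)" for A t
    unfolding G_def by (intro continuous_intros cf crad)
  have PM: "P t = M t" if t: "0 < t" "t \<le> r" for t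
  proof -
    have z: "G t y = 0" if "y \<notin> cbox (- c) c" for y
    proof -
      have "cball x t \<subseteq> cball x r" using t(2) by auto
      then have "y \<notin> cball x t" using that c by blast
      then show ?thesis by (simp add: G_def radial_eq_0[OF t(1)])
    qed
    have "P t = (\<integral>y. G t y \<partial>lborel)"
      unfolding P_def using z by (intro integral_eq_lborel integrable_compact_support[of "cbox (- c) c"] cG) auto
    also have "\<dots> = \<bar>t\<bar> ^ n * (\<integral>z. G t (x + t *\<^sub>R z) \<partial>lborel)"
      unfolding n_def using t by (intro integral_scale borel_measurable_continuous_onI cG) auto
    also have "(\<lambda>z. G t (x + t *\<^sub>R z)) = (\<lambda>z. inverse t ^ n * (ker z * f (x + t *\<^sub>R z)))"
      using t by (auto simp: fun_eq_iff G_def radial_def ker_def power2_eq_square field_simps)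
    also have "\<bar>t\<bar> ^ n * (\<integral>z. inverse t ^ n * (ker z * f (x + t *\<^sub>R z)) \<partial>lborel) = M t"
      using t by (simp add: M_def power_inverse)
    finally show ?thesis .
  qed
  have dP: "\<exists>y. (P has_real_derivative y) (at t) \<and> y \<le> 0" if t: "0 < t" "t \<le> r" for t
  proof -
    define H where "H t y = f y * (t * inverse t ^ n *
      (4 * (inverse (t\<^sup>2))\<^sup>2 * ((y - x) \<bullet> (y - x)) * radial (Suc (Suc 0)) (inverse (t\<^sup>2)) x y
       - 2 * inverse (t\<^sup>2) * n * radial (Suc 0) (inverse (t\<^sup>2)) x y))" for t y
    have "((\<lambda>t. integral (cbox (- c) c) (G t)) has_real_derivative integral (cbox (- c) c) (H t)) (at t within {0<..})"
    proof (rule leibniz_rule_field_derivative)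
      fix t y assume "t \<in> {0::real<..}"
      then have "0 < t" by simp
      from DERIV_cmult[OF scaled_inverse_power_has_derivative[OF this, of n "(y - x) \<bullet> (y - x)"], of "f y"]
      show "((\<lambda>t. G t y) has_real_derivative H t y) (at t within {0<..})"
        unfolding G_def H_def radial_def by (rule has_field_derivative_at_within)
    next
      show "continuous_on ({0<..} \<times> cbox (- c) c) (\<lambda>(t, y). H t y)"
        unfolding H_def radial_def split_beta
        by (intro continuous_intros continuous_on_compose2[OF cont _ subset_UNIV]) auto
    qed (use t in \<open>auto intro!: integrable_continuous cG\<close>)
    then have "(P has_real_derivative integral (cbox (- c) c) (H t)) (at t)"
      using t by (simp add: P_def [abs_def] at_within_open[of t "{0<..}"])
    moreover have "integral (cbox (- c) c) (H t) \<le> 0"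
    proof -
      define L where "L y = f y * laplacian (radial 0 (inverse (t\<^sup>2)) x) y" for y
      have HL: "H t y = (t * inverse t ^ n) * L y" for y
        unfolding H_def L_def laplacian_radial n_def by (simp add: algebra_simps)
      have zL: "L y = 0" if "y \<notin> cball x t" for y
        using radial_eq_0[OF t(1) that] by (simp add: L_def laplacian_radial)
      have "continuous_on (cball x t) L"
        unfolding L_def laplacian_radial by (intro continuous_intros cf crad)
      then have intL: "integrable lborel L"
        using zL by (rule integrable_compact_support[OF compact_cball])
      have in\<Omega>: "cball x t \<subseteq> \<Omega>" and inc: "cball x t \<subseteq> cbox (- c) c"
        using t sub c by (auto simp: subset_iff)
      have "integral \<Omega> L \<le> 0"
        using super test_fun_radial[OF t(1) in\<Omega>, of 0]
        unfolding neg_laplacian_nonneg_def L_def [abs_def] by (simp add: radial_def flat_nonneg)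
      also have "integral \<Omega> L = integral (cbox (- c) c) L"
      proof -
        have "L y = 0" if "y \<notin> \<Omega>" for y using zL in\<Omega> that by blast
        moreover have "L y = 0" if "y \<notin> cbox (- c) c" for y using zL inc that by blast
        ultimately show ?thesis
          using integral_eq_lborel[OF intL, of \<Omega>] integral_eq_lborel[OF intL, of "cbox (- c) c"] by simp
      qed
      finally show ?thesis
        using t by (simp add: HL [abs_def] mult_nonneg_nonpos)
    qed
    ultimately show ?thesis by blast
  qed
  have mono: "M r \<le> M t" if "0 < t" "t \<le> r" for t
  proof -
    have "P r \<le> P t"
      by (rule DERIV_nonpos_imp_nonincreasing[OF that(2)]) (use dP that in auto)
    with PM that r show ?thesis by simp
  qed
  have "M r \<le> (f x + e) * integral\<^sup>L lborel (ker :: 'a \<Rightarrow> real)" if e: "0 < e" for e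
  proof -
    obtain s where s: "0 < s" "\<And>t. 0 < t \<Longrightarrow> t \<le> s \<Longrightarrow> M t \<le> (f x + e) * integral\<^sup>L lborel (ker :: 'a \<Rightarrow> real)"
      using ker_average_tendsto[OF cont e] unfolding M_def by blast
    have "M r \<le> M (min r s)" using r s by (intro mono) auto
    also have "\<dots> \<le> (f x + e) * integral\<^sup>L lborel (ker :: 'a \<Rightarrow> real)" using r s by (intro s) auto
    finally show ?thesis .
  qed
  then have "M r / integral\<^sup>L lborel (ker :: 'a \<Rightarrow> real) \<le> f x + e" if "0 < e" for e
    using that integral_ker_pos[where 'a = 'a] by (simp add: pos_divide_le_eq)
  then have "M r / integral\<^sup>L lborel (ker :: 'a \<Rightarrow> real) \<le> f x"
    by (rule field_le_epsilon)
  then show ?thesis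
    using integral_ker_pos[where 'a = 'a] by (simp add: pos_divide_le_eq M_def)
qed

section \<open>Symmetrization of averaged differences\<close>

lemma integrable_pair_compact_support:
  fixes H :: "'a::euclidean_space \<Rightarrow> 'b::euclidean_space \<Rightarrow> real"
  assumes "compact S" "compact T" "continuous_on UNIV (case_prod H)"
    "\<And>x z. x \<notin> S \<or> z \<notin> T \<Longrightarrow> H x z = 0"
  shows "integrable (lborel \<Otimes>\<^sub>M lborel) (case_prod H)"
  unfolding lborel_prod
  by (rule integrable_compact_support[of "S \<times> T"])
     (use assms continuous_on_subset[OF assms(3)] in \<open>auto intro: compact_Times\<close>)

lemma integral_reflect:
  fixes f :: "'a::euclidean_space \<Rightarrow> real"
  assumes "f \<in> borel_measurable borel"
  shows "(\<integral>x. f (- x) \<partial>lborel) = (\<integral>x. f x \<partial>lborel)"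
  using integral_scale[OF assms, of "- 1" 0] by simp

text \<open>Split the integrand of J into the parts carrying f(x) and f(x + r z). Reflecting z,
  under which \<open>ker\<close> is even, and then shifting x by r z maps one part to the other, so
  both contribute equally. This is the discrete form of: the integral of grad f . grad d equals that
  of f (-Delta d).\<close>

lemma ker_symmetrize:
  fixes f d :: "'a::euclidean_space \<Rightarrow> real" and r :: real
  assumes S: "compact S" "\<And>x. x \<notin> S \<Longrightarrow> f x = 0"
    and cf: "continuous_on UNIV f" and cd: "continuous_on UNIV d"
  defines "N \<equiv> \<lambda>x. \<integral>z. ker z * (d x - d (x + r *\<^sub>R z)) \<partial>lborel"
    and "J \<equiv> \<lambda>x. \<integral>z. ker z * ((f (x + r *\<^sub>R z) - f x) * (d (x + r *\<^sub>R z) - d x)) \<partial>lborel"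
  shows "integrable lborel J" "integrable lborel (\<lambda>x. f x * N x)"
    "(\<integral>x. J x \<partial>lborel) = 2 * (\<integral>x. f x * N x \<partial>lborel)"
proof -
  obtain B where B: "\<And>x. x \<in> S \<Longrightarrow> norm x \<le> B"
    using compact_imp_bounded[OF S(1)] bounded_iff by blast
  define H where "H x z = ker z * (f x * (d x - d (x + r *\<^sub>R z)))" for x z
  define K where "K x z = ker z * (f (x + r *\<^sub>R z) * (d (x + r *\<^sub>R z) - d x))" for x z
  note ci = continuous_intros continuous_on_compose2[OF cf _ subset_UNIV] continuous_on_compose2[OF cd _ subset_UNIV]
  have "f x = 0" if "norm x > B" for x using B[of x] S(2)[of x] that by force
  moreover have "f (x + r *\<^sub>R z) = 0" if "norm x > B + \<bar>r\<bar>" "norm z \<le> 1" for x z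
  proof -
    have "norm x \<le> norm (x + r *\<^sub>R z) + norm (r *\<^sub>R z)"
      using norm_triangle_ineq4[of "x + r *\<^sub>R z" "r *\<^sub>R z"] by simp
    moreover have "norm (r *\<^sub>R z) \<le> \<bar>r\<bar>" using that(2) by (simp add: mult_left_le)
    ultimately have "norm (x + r *\<^sub>R z) > B" using that by linarith
    then show ?thesis using B[of "x + r *\<^sub>R z"] S(2)[of "x + r *\<^sub>R z"] by force
  qed
  ultimately have zero: "H x z = 0" "K x z = 0" if "x \<notin> cball 0 (B + \<bar>r\<bar>) \<or> z \<notin> cball 0 1" for x z
    using that ker_eq_0[of z] by (auto simp: H_def K_def not_le) (meson less_eq_real_def not_le)+
  have cH: "continuous_on UNIV (case_prod H)" and cK: "continuous_on UNIV (case_prod K)"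
    unfolding H_def K_def split_beta by (intro ci)+
  have iH: "integrable (lborel \<Otimes>\<^sub>M lborel) (case_prod H)" and iK: "integrable (lborel \<Otimes>\<^sub>M lborel) (case_prod K)"
    by (rule integrable_pair_compact_support[OF compact_cball[of 0 "B + \<bar>r\<bar>"] compact_cball[of 0 1]];
        use cH cK zero in blast)+
  have H1: "integrable lborel (H x)" and K1: "integrable lborel (K x)" for x
    unfolding H_def K_def by (intro integrable_ker_mult ci)+
  have fN: "f x * N x = (\<integral>z. H x z \<partial>lborel)" for x
    unfolding N_def H_def by (subst integral_mult_right_zero [symmetric]) (simp add: mult_ac)
  then show "integrable lborel (\<lambda>x. f x * N x)"
    using lborel_pair.integrable_fst[OF iH] by simp
  have HK: "ker z * ((f (x + r *\<^sub>R z) - f x) * (d (x + r *\<^sub>R z) - d x)) = H x z + K x z" for x z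
    by (simp add: H_def K_def algebra_simps)
  have J: "J = (\<lambda>x. (\<integral>z. H x z \<partial>lborel) + (\<integral>z. K x z \<partial>lborel))"
    unfolding J_def HK by (rule ext) (rule Bochner_Integration.integral_add[OF H1 K1])
  show "integrable lborel J"
    unfolding J using lborel_pair.integrable_fst[OF iH] lborel_pair.integrable_fst[OF iK] by simp
  have "(\<integral>x. (\<integral>z. H x z \<partial>lborel) \<partial>lborel) = (\<integral>z. (\<integral>x. H x z \<partial>lborel) \<partial>lborel)"
    by (rule lborel_pair.Fubini_integral[OF iH, symmetric])
  also have "\<dots> = (\<integral>z. (\<integral>x. H x (- z) \<partial>lborel) \<partial>lborel)"
    by (rule integral_reflect[symmetric])
       (use lborel_pair.integrable_snd[OF iH] in simp)
  also have "\<dots> = (\<integral>z. (\<integral>x. K x z \<partial>lborel) \<partial>lborel)"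
  proof (rule arg_cong[where f = "integral\<^sup>L lborel"], rule ext)
    fix z
    have "continuous_on UNIV (\<lambda>x. H x (- z))"
      unfolding H_def by (intro ci)
    then have "(\<integral>x. H x (- z) \<partial>lborel) = (\<integral>x. H (x + r *\<^sub>R z) (- z) \<partial>lborel)"
      by (intro integral_shift[symmetric] borel_measurable_continuous_onI)
    also have "(\<lambda>x. H (x + r *\<^sub>R z) (- z)) = (\<lambda>x. K x z)"
      by (simp add: H_def K_def fun_eq_iff)
    finally show "(\<integral>x. H x (- z) \<partial>lborel) = (\<integral>x. K x z \<partial>lborel)" .
  qed
  also have "\<dots> = (\<integral>x. (\<integral>z. K x z \<partial>lborel) \<partial>lborel)"
    by (rule lborel_pair.Fubini_integral[OF iK])
  finally have "(\<integral>x. (\<integral>z. H x z \<partial>lborel) \<partial>lborel) = (\<integral>x. (\<integral>z. K x z \<partial>lborel) \<partial>lborel)" .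
  then show "(\<integral>x. J x \<partial>lborel) = 2 * (\<integral>x. f x * N x \<partial>lborel)"
    unfolding J fN
    using lborel_pair.integrable_fst[OF iH] lborel_pair.integrable_fst[OF iK] by simp
qed

section \<open>The distance function and test functions\<close>

lemma bdist_lipschitz: "\<bar>bdist \<Omega> x - bdist \<Omega> y\<bar> \<le> dist x y"
  unfolding bdist_def
  using infdist_triangle[of x "- \<Omega>" y] infdist_triangle[of y "- \<Omega>" x] by (simp add: dist_commute abs_le_iff)

lemma continuous_on_bdist: "continuous_on S (bdist \<Omega>)"
  unfolding bdist_def [abs_def] by (intro continuous_on_infdist continuous_on_id)

lemma bdist_nonneg: "0 \<le> bdist \<Omega> x"
  by (simp add: bdist_def infdist_nonneg)

lemma bdist_pos:
  assumes "open \<Omega>" "\<Omega> \<noteq> UNIV" "x \<in> \<Omega>"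
  shows "0 < bdist \<Omega> x"
proof -
  have "closed (- \<Omega>)" "- \<Omega> \<noteq> {}" using assms by auto
  then have "infdist x (- \<Omega>) \<noteq> 0" using in_closed_iff_infdist_zero[of "- \<Omega>" x] assms(3) by simp
  then show ?thesis using infdist_nonneg[of x "- \<Omega>"] by (simp add: bdist_def)
qed

lemma bdist_le: "y \<notin> \<Omega> \<Longrightarrow> bdist \<Omega> x \<le> dist x y"
  by (simp add: bdist_def infdist_le)

lemma cball_subset_bdist:
  assumes "r < bdist \<Omega> x"
  shows "cball x r \<subseteq> \<Omega>"
proof
  fix y assume "y \<in> cball x r"
  then have "\<not> bdist \<Omega> x \<le> dist x y" using assms by simp
  then show "y \<in> \<Omega>" using bdist_le[of y \<Omega> x] by blast
qed

lemma bdist_attained: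
  assumes "open \<Omega>" "\<Omega> \<noteq> UNIV"
  obtains y where "y \<notin> \<Omega>" "bdist \<Omega> x = dist x y"
proof -
  have "closed (- \<Omega>)" "- \<Omega> \<noteq> {}" using assms by auto
  from infdist_attains_inf[OF this, of x] obtain y where "y \<in> - \<Omega>" "infdist x (- \<Omega>) = dist x y" by blast
  then show ?thesis by (intro that[of y]) (simp_all add: bdist_def)
qed

text \<open>Expand (norm (v + h) - norm v)^2 \<ge> 0. The bound serves twice: from above for d
  around a nearest boundary point, and from below for d near the touching ball.\<close>

lemma norm_add_le_quadratic:
  fixes v h :: "'a::real_inner"
  assumes "0 < norm v"
  shows "norm (v + h) \<le> norm v + (v \<bullet> h) / norm v + (norm h)\<^sup>2 / (2 * norm v)"
proof -
  have "0 \<le> (norm (v + h) - norm v)\<^sup>2" by simp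
  then have "2 * norm v * norm (v + h) \<le> (norm v)\<^sup>2 + (norm (v + h))\<^sup>2"
    by (simp add: power2_diff algebra_simps)
  also have "\<dots> = 2 * (norm v)\<^sup>2 + 2 * (v \<bullet> h) + (norm h)\<^sup>2"
    by (simp add: power2_norm_eq_inner inner_add_left inner_add_right inner_commute)
  finally have "norm (v + h) \<le> (2 * (norm v)\<^sup>2 + 2 * (v \<bullet> h) + (norm h)\<^sup>2) / (2 * norm v)"
    using assms by (simp add: pos_le_divide_eq mult.commute)
  also have "\<dots> = norm v + (v \<bullet> h) / norm v + (norm h)\<^sup>2 / (2 * norm v)"
    using assms by (simp add: add_divide_distrib power2_eq_square)
  finally show ?thesis .
qed

lemma bdist_semiconcave:
  assumes "open \<Omega>" "\<Omega> \<noteq> UNIV" "x \<in> \<Omega>"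
  obtains \<nu> where "norm \<nu> = 1"
    "\<And>h. bdist \<Omega> (x + h) \<le> bdist \<Omega> x + \<nu> \<bullet> h + (norm h)\<^sup>2 / (2 * bdist \<Omega> x)"
proof -
  obtain y where y: "y \<notin> \<Omega>" "bdist \<Omega> x = dist x y" using bdist_attained[OF assms(1,2)] .
  define v where "v = x - y"
  have D: "bdist \<Omega> x = norm v" using y(2) by (simp add: v_def dist_norm)
  have pos: "0 < norm v" using bdist_pos[OF assms] by (simp only: D)
  show ?thesis
  proof (rule that[of "inverse (norm v) *\<^sub>R v"])
    show "norm (inverse (norm v) *\<^sub>R v) = 1" using pos by simp
    fix h
    have "bdist \<Omega> (x + h) \<le> norm (v + h)"
      using bdist_le[OF y(1), of "x + h"] by (simp add: v_def dist_norm add_diff_eq diff_add_eq)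
    also have "\<dots> \<le> norm v + (v \<bullet> h) / norm v + (norm h)\<^sup>2 / (2 * norm v)"
      by (rule norm_add_le_quadratic[OF pos])
    also have "(v \<bullet> h) / norm v = (inverse (norm v) *\<^sub>R v) \<bullet> h"
      by (simp add: divide_inverse)
    finally show "bdist \<Omega> (x + h) \<le> bdist \<Omega> x + (inverse (norm v) *\<^sub>R v) \<bullet> h + (norm h)\<^sup>2 / (2 * bdist \<Omega> x)"
      by (simp only: D)
  qed
qed

section \<open>Uniform first-order estimates for test functions and powers\<close>

lemma smooth_mvt:
  fixes u :: "'a::euclidean_space \<Rightarrow> real"
  assumes "smooth u"
  obtains t where "0 \<le> t" "t \<le> 1" "u (x + h) - u x = grad u (x + t *\<^sub>R h) \<bullet> h"
proof -
  have "((\<lambda>t. u (x + t *\<^sub>R h)) has_real_derivative grad u (x + t *\<^sub>R h) \<bullet> h) (at t)" for t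
  proof -
    have "((\<lambda>t. x + t *\<^sub>R h) has_derivative (\<lambda>k. k *\<^sub>R h)) (at t)"
      by (auto intro!: derivative_eq_intros)
    from has_derivative_compose[OF this has_derivative_grad[OF assms]]
    show ?thesis by (simp add: has_field_derivative_def mult_commute_abs)
  qed
  from MVT2[of 0 1 "\<lambda>t. u (x + t *\<^sub>R h)", OF _ this] obtain t
    where "0 < t" "t < 1" "u (x + h) - u x = grad u (x + t *\<^sub>R h) \<bullet> h" by auto
  then show ?thesis using that[of t] by simp
qed

lemma compact_support_uniformly_continuous:
  fixes f :: "'a::euclidean_space \<Rightarrow> 'b::real_normed_vector"
  assumes "compact S" "\<And>x. x \<notin> S \<Longrightarrow> f x = 0" "continuous_on UNIV f" "0 < e"
  obtains r where "0 < r" "\<And>x y. dist x y \<le> r \<Longrightarrow> dist (f x) (f y) \<le> e"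
proof -
  obtain B where B: "\<And>x. x \<in> S \<Longrightarrow> norm x \<le> B"
    using compact_imp_bounded[OF assms(1)] bounded_iff by blast
  have "uniformly_continuous_on (cball 0 (B + 1)) f"
    by (intro compact_uniformly_continuous continuous_on_subset[OF assms(3)]) auto
  then obtain d where d: "0 < d"
    "\<And>x y. x \<in> cball 0 (B + 1) \<Longrightarrow> y \<in> cball 0 (B + 1) \<Longrightarrow> dist y x < d \<Longrightarrow> dist (f y) (f x) < e"
    unfolding uniformly_continuous_on_def using assms(4) by blast
  show ?thesis
  proof (rule that[of "min 1 (d / 2)"])
    fix x y :: 'a assume xy: "dist x y \<le> min 1 (d / 2)"
    have tri: "norm x \<le> norm y + dist x y" "norm y \<le> norm x + dist x y"
      using norm_triangle_ineq2[of x y] norm_triangle_ineq2[of y x] by (simp_all add: dist_norm norm_minus_commute)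
    show "dist (f x) (f y) \<le> e"
    proof (cases "x \<in> S \<or> y \<in> S")
      case True
      then have "x \<in> cball 0 (B + 1)" "y \<in> cball 0 (B + 1)"
        using B[of x] B[of y] tri xy by auto
      moreover have "dist x y < d" using xy d(1) by auto
      ultimately have "dist (f x) (f y) < e" by (intro d(2))
      then show ?thesis by simp
    qed (use assms in auto)
  qed (use d in auto)
qed

lemma test_fun_taylor:
  fixes u :: "'a::euclidean_space \<Rightarrow> real"
  assumes "test_fun \<Omega> u" "0 < e"
  obtains r where "0 < r" "\<And>x h. norm h \<le> r \<Longrightarrow> \<bar>u (x + h) - u x - grad u x \<bullet> h\<bar> \<le> e * norm h"
proof -
  let ?S = "closure {x. u x \<noteq> 0}"
  have sm: "smooth u" and S: "compact ?S" using assms(1) unfolding test_fun_def by blast+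
  obtain r where r: "0 < r" "\<And>x y. dist x y \<le> r \<Longrightarrow> dist (grad u x) (grad u y) \<le> e"
    by (rule compact_support_uniformly_continuous[OF S test_fun_grad_zero[OF assms(1)] continuous_on_grad[OF sm] assms(2)], assumption) (rule that; blast)
  show ?thesis
  proof (rule that[OF r(1)])
    fix x h :: 'a assume h: "norm h \<le> r"
    obtain t where t: "0 \<le> t" "t \<le> 1" "u (x + h) - u x = grad u (x + t *\<^sub>R h) \<bullet> h"
      using smooth_mvt[OF sm] .
    have "t * norm h \<le> 1 * norm h" using t by (intro mult_right_mono) auto
    then have "dist (x + t *\<^sub>R h) x \<le> r" using t h by (simp add: dist_norm)
    then have "norm (grad u (x + t *\<^sub>R h) - grad u x) \<le> e" using r(2) by (simp add: dist_norm)
    then have "norm (grad u (x + t *\<^sub>R h) - grad u x) * norm h \<le> e * norm h" by (intro mult_right_mono) auto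
    moreover have "\<bar>(grad u (x + t *\<^sub>R h) - grad u x) \<bullet> h\<bar> \<le> norm (grad u (x + t *\<^sub>R h) - grad u x) * norm h"
      by (rule Cauchy_Schwarz_ineq2)
    ultimately show "\<bar>u (x + h) - u x - grad u x \<bullet> h\<bar> \<le> e * norm h"
      by (simp add: t(3) inner_diff_left)
  qed
qed

lemma compact_support_bounded:
  fixes f :: "'a::euclidean_space \<Rightarrow> 'b::real_normed_vector"
  assumes "compact S" "\<And>x. x \<notin> S \<Longrightarrow> f x = 0" "continuous_on UNIV f"
  obtains B where "0 \<le> B" "\<And>x. norm (f x) \<le> B"
proof -
  have "bounded (f ` S)"
    by (intro compact_imp_bounded compact_continuous_image continuous_on_subset[OF assms(3)] assms(1)) auto
  then obtain B where B: "\<And>x. x \<in> S \<Longrightarrow> norm (f x) \<le> B" unfolding bounded_iff by auto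
  show ?thesis
  proof (rule that[of "max 0 B"])
    fix x show "norm (f x) \<le> max 0 B"
      using B[of x] assms(2)[of x] by (cases "x \<in> S") auto
  qed simp
qed

lemma test_fun_bounds:
  fixes u :: "'a::euclidean_space \<Rightarrow> real"
  assumes "test_fun \<Omega> u"
  obtains L where "0 \<le> L" "\<And>x. \<bar>u x\<bar> \<le> L" "\<And>x. norm (grad u x) \<le> L" "\<And>x h. \<bar>u (x + h) - u x\<bar> \<le> L * norm h"
proof -
  let ?S = "closure {x. u x \<noteq> 0}"
  have sm: "smooth u" and S: "compact ?S" using assms(1) unfolding test_fun_def by blast+
  obtain A where A: "0 \<le> A" "\<And>x. norm (u x) \<le> A"
    by (rule compact_support_bounded[OF S test_fun_zero[OF assms] continuous_on_smooth[OF sm]], assumption) (rule that; blast)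
  obtain B where B: "0 \<le> B" "\<And>x. norm (grad u x) \<le> B"
    by (rule compact_support_bounded[OF S test_fun_grad_zero[OF assms(1)] continuous_on_grad[OF sm]], assumption) (rule that; blast)
  show ?thesis
  proof (rule that[of "max A B"])
    fix x h :: 'a
    obtain t where t: "u (x + h) - u x = grad u (x + t *\<^sub>R h) \<bullet> h"
      using smooth_mvt[OF sm] by metis
    have "\<bar>grad u (x + t *\<^sub>R h) \<bullet> h\<bar> \<le> norm (grad u (x + t *\<^sub>R h)) * norm h"
      by (rule Cauchy_Schwarz_ineq2)
    also have "\<dots> \<le> max A B * norm h"
      using B(2)[of "x + t *\<^sub>R h"] by (intro mult_right_mono) auto
    finally show "\<bar>u (x + h) - u x\<bar> \<le> max A B * norm h" by (simp add: t)
  qed (use A B in \<open>auto simp: le_max_iff_disj\<close>)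
qed

text \<open>By the mean value theorem the slope of t^(1-s) between a and b is -(s-1) t^(-s) at a
  point t \<le> c, hence at most -(s-1) c^(-s). This is the source of the term (s-1) |u| d^(-s); it
  keeps the squared increment of d, so no derivative of d is taken.\<close>

lemma powr_monotone_gap:
  fixes a b c s :: real
  assumes "0 < a" "0 < b" "a \<le> c" "b \<le> c" "1 < s"
  shows "(b powr (1 - s) - a powr (1 - s)) * (b - a) \<le> - (s - 1) * c powr (- s) * (b - a)\<^sup>2"
proof -
  have less: "(b powr (1 - s) - a powr (1 - s)) * (b - a) \<le> - (s - 1) * c powr (- s) * (b - a)\<^sup>2"
    if "0 < a" "a < b" "b \<le> c" for a b
  proof -
    have "((\<lambda>t. t powr (1 - s)) has_real_derivative (1 - s) * t powr (- s)) (at t)" if "a \<le> t" for t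
      using has_real_derivative_powr[of t "1 - s"] that \<open>0 < a\<close> by simp
    then obtain t where t: "a < t" "t < b" "b powr (1 - s) - a powr (1 - s) = (b - a) * ((1 - s) * t powr (- s))"
      using MVT2[OF \<open>a < b\<close>, of "\<lambda>t. t powr (1 - s)" "\<lambda>t. (1 - s) * t powr (- s)"] by blast
    have "c powr (- s) \<le> t powr (- s)"
      using \<open>0 < a\<close> \<open>b \<le> c\<close> t assms(5) by (intro powr_mono2') auto
    then have "(s - 1) * c powr (- s) * (b - a)\<^sup>2 \<le> (s - 1) * t powr (- s) * (b - a)\<^sup>2"
      using assms(5) by (intro mult_right_mono mult_left_mono) auto
    then show ?thesis unfolding t(3) by (simp add: power2_eq_square algebra_simps)
  qed
  show ?thesis
  proof (cases a b rule: linorder_cases)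
    case greater
    have "(b powr (1 - s) - a powr (1 - s)) * (b - a) = (a powr (1 - s) - b powr (1 - s)) * (a - b)"
      by (simp add: algebra_simps)
    with less[OF assms(2) greater assms(3)] show ?thesis by (simp add: power2_commute)
  qed (use less assms in auto)
qed

text \<open>Replaces the value at d(x) + r, which \<open>powr_monotone_gap\<close> produces, by the
  value at d(x) with an error linear in r.\<close>

lemma powr_neg_shift:
  fixes a r s t :: real
  assumes "0 < t" "t \<le> a" "0 \<le> r" "0 < s"
  shows "a powr (- s) - s * t powr (- s - 1) * r \<le> (a + r) powr (- s)"
proof (cases "r = 0")
  case False
  have "((\<lambda>x. x powr (- s)) has_real_derivative (- s) * x powr (- s - 1)) (at x)" if "a \<le> x" for x
    using has_real_derivative_powr[of x "- s"] that assms by simp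
  then obtain x where x: "a < x" "(a + r) powr (- s) - a powr (- s) = r * ((- s) * x powr (- s - 1))"
    using MVT2[of a "a + r" "\<lambda>x. x powr (- s)" "\<lambda>x. (- s) * x powr (- s - 1)"] assms False by auto
  have "x powr (- s - 1) \<le> t powr (- s - 1)"
    using x(1) assms by (intro powr_mono2') auto
  then have "r * s * x powr (- s - 1) \<le> r * s * t powr (- s - 1)"
    using assms by (intro mult_left_mono) auto
  with x(2) show ?thesis by (simp add: mult_ac)
qed simp

section \<open>The local estimate\<close>

text \<open>Pure real algebra for one pair x, y = x + r z. Dictionary: \<open>ux\<close>,
  \<open>uy\<close> are values of |u|; \<open>wx\<close>, \<open>wy\<close> of d^(1-s);
  \<open>n\<close> is v . z; \<open>g\<close> is grad u . z; \<open>E\<close> is the error of the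
  linear approximation r n to d(y) - d(x); \<open>c\<close> is (d(x) + r)^(-s) and \<open>p\<close>
  is d(x)^(-s). The product difference is split as uy (wy - wx) + wx (uy - ux); the first summand
  gives the negative term, the second the gradient term.\<close>

lemma hardy_integrand_bound:
  fixes A C :: real
  assumes r: "0 \<le> r" and e: "0 \<le> e" and s: "1 < s"
    and n: "\<bar>n\<bar> \<le> 1" and D: "\<bar>r * n + E\<bar> \<le> r"
    and u: "0 \<le> ux" "ux \<le> L" "0 \<le> uy" "\<bar>uy - ux\<bar> \<le> L * r" "\<bar>uy - ux\<bar> \<le> r * \<bar>g\<bar> + e * r" "\<bar>g\<bar> \<le> L"
    and w: "(wy - wx) * (r * n + E) \<le> - (s - 1) * c * (r * n + E)\<^sup>2" "0 \<le> wx" "wx \<le> W"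
    and c: "p - C0 * r \<le> c" "0 \<le> c" "c \<le> P" "0 \<le> p" "p \<le> P" "0 \<le> C0"
  defines "A \<equiv> 2 * (s - 1) * L * P + W * L" and "C \<equiv> (s - 1) * (L * P + L * C0) + W"
  shows "(uy * wy - ux * wx) * (r * n + E) \<le>
    r\<^sup>2 * (wx * (\<bar>g\<bar> * \<bar>n\<bar>) - (s - 1) * ux * p * n\<^sup>2) + A * r * \<bar>E\<bar> + C * (r ^ 3 + e * r\<^sup>2)"
proof -
  define d where "d = r * n + E"
  have L: "0 \<le> L" and P: "0 \<le> P" and W: "0 \<le> W" using u w c by linarith+
  have d2: "d\<^sup>2 \<le> r\<^sup>2" using D by (simp add: d_def abs_le_square_iff [symmetric] r)
  have "ux * p - (L * P + L * C0) * r \<le> uy * c"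
  proof -
    have "ux * (p - C0 * r) - L * r * P \<le> ux * c - L * r * c"
      using u c r L by (intro diff_mono mult_left_mono) auto
    also have "\<dots> = (ux - L * r) * c" by (simp add: algebra_simps)
    also have "\<dots> \<le> uy * c" using u(4) c by (intro mult_right_mono) auto
    finally have "ux * (p - C0 * r) - L * r * P \<le> uy * c" .
    moreover have "ux * (C0 * r) \<le> L * (C0 * r)" using u c r by (intro mult_right_mono) auto
    ultimately show ?thesis by (simp add: algebra_simps)
  qed
  then have "(s - 1) * d\<^sup>2 * (ux * p - (L * P + L * C0) * r) \<le> (s - 1) * d\<^sup>2 * (uy * c)"
    using s by (intro mult_left_mono) auto
  moreover have "uy * ((wy - wx) * d) \<le> uy * (- (s - 1) * c * d\<^sup>2)"
    using w(1) u(3) unfolding d_def by (rule mult_left_mono)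
  moreover have "(s - 1) * ((L * P + L * C0) * r) * d\<^sup>2 \<le> (s - 1) * ((L * P + L * C0) * r) * r\<^sup>2"
    using s L P c r d2 by (intro mult_left_mono mult_nonneg_nonneg add_nonneg_nonneg) auto
  ultimately have T1: "uy * ((wy - wx) * d) \<le> - (s - 1) * (ux * p) * d\<^sup>2 + (s - 1) * (L * P + L * C0) * r ^ 3"
    by (simp add: algebra_simps power2_eq_square power3_eq_cube)
  have "(r * n)\<^sup>2 - 2 * r * \<bar>E\<bar> \<le> d\<^sup>2"
  proof -
    have "\<bar>r * n\<bar> * \<bar>E\<bar> \<le> r * \<bar>E\<bar>"
      using n r by (intro mult_right_mono) (auto simp: abs_mult mult_left_le)
    then have "- (r * n * E) \<le> r * \<bar>E\<bar>"
      by (simp add: abs_mult [symmetric])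
    moreover have "d\<^sup>2 = (r * n)\<^sup>2 + 2 * (r * n * E) + E\<^sup>2"
      by (simp add: d_def power2_sum)
    moreover have "0 \<le> E\<^sup>2" by simp
    ultimately show ?thesis by linarith
  qed
  then have "(s - 1) * (ux * p) * ((r * n)\<^sup>2 - 2 * r * \<bar>E\<bar>) \<le> (s - 1) * (ux * p) * d\<^sup>2"
    using s u c by (intro mult_left_mono) auto
  moreover have "(s - 1) * (ux * p) * (2 * r * \<bar>E\<bar>) \<le> (s - 1) * (L * P) * (2 * r * \<bar>E\<bar>)"
    using s u c r L by (intro mult_right_mono mult_left_mono mult_mono) auto
  ultimately have T1': "- (s - 1) * (ux * p) * d\<^sup>2 \<le>
      - (s - 1) * (ux * p) * (r * n)\<^sup>2 + 2 * (s - 1) * L * P * r * \<bar>E\<bar>"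
    by (simp add: algebra_simps)
  have "(uy - ux) * d \<le> \<bar>uy - ux\<bar> * \<bar>d\<bar>" by (metis abs_ge_self abs_mult)
  also have "\<dots> \<le> (r * \<bar>g\<bar> + e * r) * \<bar>d\<bar>" using u by (intro mult_right_mono) auto
  also have "\<dots> = r * \<bar>g\<bar> * \<bar>d\<bar> + e * r * \<bar>d\<bar>" by (simp add: algebra_simps)
  also have "\<dots> \<le> r * \<bar>g\<bar> * (r * \<bar>n\<bar> + \<bar>E\<bar>) + e * r * r"
  proof (intro add_mono mult_left_mono)
    show "\<bar>d\<bar> \<le> r * \<bar>n\<bar> + \<bar>E\<bar>"
      unfolding d_def using abs_triangle_ineq[of "r * n" E] r by (simp add: abs_mult)
  qed (use D r e in \<open>auto simp: d_def\<close>)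
  also have "\<dots> \<le> r\<^sup>2 * (\<bar>g\<bar> * \<bar>n\<bar>) + r * L * \<bar>E\<bar> + e * r\<^sup>2"
  proof -
    have "r * \<bar>g\<bar> * \<bar>E\<bar> \<le> r * L * \<bar>E\<bar>" using r u by (intro mult_right_mono mult_left_mono) auto
    then show ?thesis by (simp add: algebra_simps power2_eq_square)
  qed
  finally have "wx * ((uy - ux) * d) \<le> wx * (r\<^sup>2 * (\<bar>g\<bar> * \<bar>n\<bar>) + (r * L * \<bar>E\<bar> + e * r\<^sup>2))"
    using w(2) by (intro mult_left_mono) auto
  moreover have "wx * (r * L * \<bar>E\<bar> + e * r\<^sup>2) \<le> W * (r * L * \<bar>E\<bar> + e * r\<^sup>2)"
    using w L e r by (intro mult_right_mono) auto
  ultimately have T2: "wx * ((uy - ux) * d) \<le> r\<^sup>2 * (wx * (\<bar>g\<bar> * \<bar>n\<bar>)) + W * (r * L * \<bar>E\<bar>) + W * (e * r\<^sup>2)"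
    by (simp add: algebra_simps)
  \<comment> \<open>Nonnegative terms added at the end so that r^3 and e r^2 can share the single
    constant C.\<close>
  have T3: "W * r ^ 3 \<ge> 0" "(s - 1) * (L * P + L * C0) * (e * r\<^sup>2) \<ge> 0"
    using W r s L P c e by auto
  have "(uy * wy - ux * wx) * d = uy * ((wy - wx) * d) + wx * ((uy - ux) * d)"
    by (simp add: algebra_simps)
  also have "\<dots> \<le> (- (s - 1) * (ux * p) * (r * n)\<^sup>2 + 2 * (s - 1) * L * P * r * \<bar>E\<bar>
      + (s - 1) * (L * P + L * C0) * r ^ 3)
      + (r\<^sup>2 * (wx * (\<bar>g\<bar> * \<bar>n\<bar>)) + W * (r * L * \<bar>E\<bar>) + W * (e * r\<^sup>2))"
    using T1 T1' T2 by linarith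
  also have "\<dots> = r\<^sup>2 * (wx * (\<bar>g\<bar> * \<bar>n\<bar>) - (s - 1) * ux * p * n\<^sup>2) + A * r * \<bar>E\<bar>
      + (s - 1) * (L * P + L * C0) * r ^ 3 + W * (e * r\<^sup>2)"
    by (simp add: A_def algebra_simps power_mult_distrib)
  also have "\<dots> \<le> r\<^sup>2 * (wx * (\<bar>g\<bar> * \<bar>n\<bar>) - (s - 1) * ux * p * n\<^sup>2) + A * r * \<bar>E\<bar> + C * (r ^ 3 + e * r\<^sup>2)"
    using T3 by (simp add: C_def algebra_simps)
  finally show ?thesis by (simp add: d_def)
qed

text \<open>Let E(h) be the linearization error and q = r^2/(2\<delta>). Semiconcavity gives E(h)
  \<le> q and E(-h) \<le> q, and the second difference on the right is - E(h) - E(-h). The two signs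
  of the absolute value require 2 E(h) + E(-h) \<le> 4q and E(-h) \<le> 4q.\<close>

lemma bdist_linear_error:
  assumes \<nu>: "\<And>h. bdist \<Omega> (x + h) \<le> bdist \<Omega> x + \<nu> \<bullet> h + (norm h)\<^sup>2 / (2 * bdist \<Omega> x)"
    and "0 < \<delta>" "\<delta> \<le> bdist \<Omega> x" "norm h \<le> r"
  shows "\<bar>bdist \<Omega> (x + h) - bdist \<Omega> x - \<nu> \<bullet> h\<bar> \<le>
    (bdist \<Omega> x - bdist \<Omega> (x + h)) + (bdist \<Omega> x - bdist \<Omega> (x - h)) + 2 * r\<^sup>2 / \<delta>"
proof -
  have "(norm h)\<^sup>2 / (2 * bdist \<Omega> x) \<le> r\<^sup>2 / (2 * \<delta>)"
    using assms by (intro frac_le power_mono) auto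
  moreover have "bdist \<Omega> (x - h) \<le> bdist \<Omega> x - \<nu> \<bullet> h + (norm h)\<^sup>2 / (2 * bdist \<Omega> x)"
    using \<nu>[of "- h"] by simp
  moreover have "2 * r\<^sup>2 / \<delta> = 4 * (r\<^sup>2 / (2 * \<delta>))" by simp
  moreover have "0 \<le> r\<^sup>2 / (2 * \<delta>)" using assms by simp
  ultimately show ?thesis unfolding abs_le_iff using \<nu>[of h] by (intro conjI; linarith)
qed

text \<open>The quantity N_r. For smooth f it is, to leading order, - (r^2 / 2) Laplacian f times
  the integral of \<open>bump\<close>.\<close>

definition deficit :: "('a::euclidean_space \<Rightarrow> real) \<Rightarrow> real \<Rightarrow> 'a \<Rightarrow> real" where
  "deficit f r x = (\<integral>z. ker z * (f x - f (x + r *\<^sub>R z)) \<partial>lborel)"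

lemma deficit_nonneg:
  assumes "neg_laplacian_nonneg \<Omega> (bdist \<Omega>)" "0 < r" "r < bdist \<Omega> x"
  shows "0 \<le> deficit (bdist \<Omega>) r x"
proof -
  let ?d = "bdist \<Omega>"
  have i: "integrable lborel (\<lambda>z. ker z * ?d (x + r *\<^sub>R z))" "integrable lborel (\<lambda>z. ker z * ?d x)"
    by (intro integrable_ker_mult continuous_on_compose2[OF continuous_on_bdist[of UNIV] _ subset_UNIV] continuous_intros)+
  have "deficit ?d r x = ?d x * integral\<^sup>L lborel (ker :: 'a \<Rightarrow> real) - (\<integral>z. ker z * ?d (x + r *\<^sub>R z) \<partial>lborel)"
    using Bochner_Integration.integral_diff[OF i(2,1)]
    by (simp add: deficit_def right_diff_distrib mult.commute)
  then show ?thesis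
    using ker_mean_value[OF continuous_on_bdist assms(1,2) cball_subset_bdist[OF assms(3)]] by simp
qed

lemma integrable_ker: "integrable lborel (ker :: 'a::euclidean_space \<Rightarrow> real)"
  using integrable_ker_mult[of "\<lambda>_::'a. 1"] by (simp add: continuous_on_const)

text \<open>The direction \<nu> is picked at this x alone. It enters the majorant only through
  (\<nu> . z)^2, whose average is \<sigma> for every unit vector, so \<nu> is absent from the
  conclusion. Since 2\<delta> \<le> d(x) and r \<le> \<delta>, d stays above \<delta> on the
  averaged ball, which turns all weights into powers of \<delta>.\<close>

lemma hardy_local_bound:
  fixes \<Omega> :: "'a::euclidean_space set" and u :: "'a \<Rightarrow> real"
  defines "\<sigma> \<equiv> integral\<^sup>L lborel (bump :: 'a \<Rightarrow> real)" and "\<kappa> \<equiv> integral\<^sup>L lborel (ker :: 'a \<Rightarrow> real)"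
    and "d \<equiv> bdist \<Omega>"
  assumes \<Omega>: "open \<Omega>" "\<Omega> \<noteq> UNIV" and s: "1 < s" and \<delta>: "0 < \<delta>" "2 * \<delta> \<le> d x"
    and r: "0 < r" "r \<le> \<delta>" and e: "0 < e"
    and cu: "continuous_on UNIV u"
    and L: "\<bar>u x\<bar> \<le> L" "norm g \<le> L" "\<And>h. \<bar>u (x + h) - u x\<bar> \<le> L * norm h"
    and T: "\<And>h. norm h \<le> r \<Longrightarrow> \<bar>u (x + h) - u x - g \<bullet> h\<bar> \<le> e * norm h"
  defines "A \<equiv> 2 * (s - 1) * L * \<delta> powr (- s) + \<delta> powr (1 - s) * L"
    and "C \<equiv> (s - 1) * (L * \<delta> powr (- s) + L * (s * \<delta> powr (- s - 1))) + \<delta> powr (1 - s)"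
  shows "(\<integral>z. ker z * ((\<bar>u (x + r *\<^sub>R z)\<bar> * d (x + r *\<^sub>R z) powr (1 - s) - \<bar>u x\<bar> * d x powr (1 - s))
      * (d (x + r *\<^sub>R z) - d x)) \<partial>lborel)
    \<le> r\<^sup>2 * \<sigma> * (d x powr (1 - s) * norm g - (s - 1) * (\<bar>u x\<bar> * d x powr (- s)))
      + A * r * (2 * deficit d r x + 2 * r\<^sup>2 / \<delta> * \<kappa>) + C * (r ^ 3 + e * r\<^sup>2) * \<kappa>"
proof -
  have lip: "\<bar>d a - d b\<bar> \<le> dist a b" for a b unfolding d_def by (rule bdist_lipschitz)
  have "x \<in> \<Omega>"
  proof (rule ccontr)
    assume "x \<notin> \<Omega>"
    then show False using bdist_le[of x \<Omega> x] \<delta> by (simp add: d_def)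
  qed
  then obtain \<nu> where \<nu>1: "norm \<nu> = 1"
    and \<nu>0: "\<And>h. bdist \<Omega> (x + h) \<le> bdist \<Omega> x + \<nu> \<bullet> h + (norm h)\<^sup>2 / (2 * bdist \<Omega> x)"
    by (rule bdist_semiconcave[OF \<Omega>]) (rule that; blast)
  have \<nu>: "d (x + h) \<le> d x + \<nu> \<bullet> h + (norm h)\<^sup>2 / (2 * d x)" for h
    unfolding d_def by (rule \<nu>0)
  have cd: "continuous_on S d" for S unfolding d_def by (rule continuous_on_bdist)
  note ci = continuous_intros continuous_on_compose2[OF cd[of UNIV] _ subset_UNIV]
    continuous_on_compose2[OF cu _ subset_UNIV]
  define F where "F z = ker z * (d x - d (x + r *\<^sub>R z))" for z
  define wx where "wx = d x powr (1 - s)"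
  define p where "p = d x powr (- s)"
  have L0: "0 \<le> L" using L(2) norm_ge_zero[of g] by linarith
  have A0: "0 \<le> A" using s \<delta> L0 by (auto simp: A_def)
  have C0: "0 \<le> C" using s \<delta> L0 by (auto simp: C_def intro!: add_nonneg_nonneg mult_nonneg_nonneg)
  have iF: "integrable lborel F" "integrable lborel (\<lambda>z. F (- z))"
    unfolding F_def ker_minus by (intro integrable_ker_mult ci)+
  have IF: "(\<integral>z. F z \<partial>lborel) = deficit d r x" "(\<integral>z. F (- z) \<partial>lborel) = deficit d r x"
    using integral_reflect[of F] iF(1) by (simp_all add: F_def deficit_def)
  have i\<nu>: "integrable lborel (\<lambda>z. ker z * ((\<nu> \<bullet> z) * (\<nu> \<bullet> z)))" and ig: "integrable lborel (\<lambda>z. ker z * ((g \<bullet> z) * (g \<bullet> z)))"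
    by (intro integrable_ker_mult ci)+
  have I\<nu>: "(\<integral>z. ker z * ((\<nu> \<bullet> z) * (\<nu> \<bullet> z)) \<partial>lborel) = \<sigma>"
    and Ig: "(\<integral>z. ker z * ((g \<bullet> z) * (g \<bullet> z)) \<partial>lborel) = (norm g)\<^sup>2 * \<sigma>"
    unfolding ker_second_moment \<sigma>_def using \<nu>1 by (simp_all add: power2_norm_eq_inner [symmetric])
  \<comment> \<open>Coefficients of a majorant R that is quadratic in z up to the second difference
    of d. After integration the gradient parts of c1 and c2 contribute (norm g)/2 each, so the sharp
    factor norm g is recovered. If g = 0, division by zero makes c2 = 0, which is the correct
    value.\<close>
  define c1 c2 c3 c4 where "c1 = r\<^sup>2 * (wx * (norm g / 2) - (s - 1) * \<bar>u x\<bar> * p)"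
    and "c2 = r\<^sup>2 * wx / (2 * norm g)" and "c3 = A * r"
    and "c4 = A * r * (2 * r\<^sup>2 / \<delta>) + C * (r ^ 3 + e * r\<^sup>2)"
  define R where "R z = c1 * (ker z * ((\<nu> \<bullet> z) * (\<nu> \<bullet> z))) + c2 * (ker z * ((g \<bullet> z) * (g \<bullet> z)))
      + c3 * (F z + F (- z)) + c4 * ker z" for z
  have hR: "has_bochner_integral lborel R
      (c1 * \<sigma> + c2 * ((norm g)\<^sup>2 * \<sigma>) + c3 * (deficit d r x + deficit d r x) + c4 * \<kappa>)"
    unfolding R_def
    by (intro has_bochner_integral_add has_bochner_integral_mult_right)
       (simp_all add: has_bochner_integral_iff i\<nu> ig iF integrable_ker I\<nu> Ig IF \<kappa>_def)
  have iR: "integrable lborel R" using hR by (simp add: has_bochner_integral_iff)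
  have "(\<integral>z. R z \<partial>lborel) = c1 * \<sigma> + c2 * ((norm g)\<^sup>2 * \<sigma>) + c3 * (deficit d r x + deficit d r x) + c4 * \<kappa>"
    using hR by (simp add: has_bochner_integral_iff)
  also have "\<dots> = r\<^sup>2 * \<sigma> * (wx * norm g - (s - 1) * (\<bar>u x\<bar> * p))
      + A * r * (2 * deficit d r x + 2 * r\<^sup>2 / \<delta> * \<kappa>) + C * (r ^ 3 + e * r\<^sup>2) * \<kappa>"
    by (cases "norm g = 0") (simp_all add: c1_def c2_def c3_def c4_def algebra_simps power2_eq_square)
  finally have IR: "(\<integral>z. R z \<partial>lborel) = \<dots>" .
  have "(\<integral>z. ker z * ((\<bar>u (x + r *\<^sub>R z)\<bar> * d (x + r *\<^sub>R z) powr (1 - s) - \<bar>u x\<bar> * d x powr (1 - s))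
      * (d (x + r *\<^sub>R z) - d x)) \<partial>lborel) \<le> (\<integral>z. R z \<partial>lborel)"
  proof (rule integral_mono[OF _ iR])
    have far: "\<delta> \<le> d (x + r *\<^sub>R z)" if "norm z \<le> 1" for z
    proof -
      have "r * norm z \<le> \<delta> * 1" using that r by (intro mult_mono) auto
      then show ?thesis using lip[of "x + r *\<^sub>R z" x] \<delta> r by (simp add: dist_norm abs_le_iff)
    qed
    show "integrable lborel (\<lambda>z. ker z * ((\<bar>u (x + r *\<^sub>R z)\<bar> * d (x + r *\<^sub>R z) powr (1 - s) - \<bar>u x\<bar> * d x powr (1 - s))
      * (d (x + r *\<^sub>R z) - d x)))"
      by (intro integrable_ker_mult ci) (use far \<delta> in force)+
    fix z :: 'a
    show "ker z * ((\<bar>u (x + r *\<^sub>R z)\<bar> * d (x + r *\<^sub>R z) powr (1 - s) - \<bar>u x\<bar> * d x powr (1 - s))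
      * (d (x + r *\<^sub>R z) - d x)) \<le> R z"
    proof (cases "norm z < 1")
      case True
      define y where "y = x + r *\<^sub>R z"
      define n where "n = \<nu> \<bullet> z"
      define E where "E = d y - d x - r * n"
      have nz: "norm (r *\<^sub>R z) \<le> r" using True r by (simp add: mult_left_le)
      have Dd: "r * n + E = d y - d x" by (simp add: E_def)
      have D: "\<bar>r * n + E\<bar> \<le> r" using lip[of y x] nz by (simp add: Dd y_def dist_norm)
      have n1: "\<bar>n\<bar> \<le> 1" using Cauchy_Schwarz_ineq2[of \<nu> z] True \<nu>1 by (simp add: n_def)
      have dy: "\<delta> \<le> d y" unfolding y_def using True by (intro far) simp
      have gz: "\<bar>g \<bullet> z\<bar> \<le> L"
        using Cauchy_Schwarz_ineq2[of g z] True L(2) mult_left_le[of "norm z" "norm g"] by simp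
      have Eb: "\<bar>E\<bar> \<le> (d x - d (x + r *\<^sub>R z)) + (d x - d (x - r *\<^sub>R z)) + 2 * r\<^sup>2 / \<delta>"
        using bdist_linear_error[of \<Omega> x \<nu> \<delta> "r *\<^sub>R z" r] \<nu> \<delta> nz
        by (simp add: d_def E_def y_def n_def)
      have u2: "\<bar>\<bar>u y\<bar> - \<bar>u x\<bar>\<bar> \<le> L * r"
      proof -
        have "\<bar>\<bar>u y\<bar> - \<bar>u x\<bar>\<bar> \<le> \<bar>u y - u x\<bar>" by simp
        also have "\<dots> \<le> L * norm (r *\<^sub>R z)" unfolding y_def by (rule L(3))
        also have "\<dots> \<le> L * r" using nz L0 by (rule mult_left_mono)
        finally show ?thesis .
      qed
      have u3: "\<bar>\<bar>u y\<bar> - \<bar>u x\<bar>\<bar> \<le> r * \<bar>g \<bullet> z\<bar> + e * r"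
      proof -
        have "\<bar>\<bar>u y\<bar> - \<bar>u x\<bar>\<bar> \<le> \<bar>u y - u x\<bar>" by simp
        also have "\<dots> \<le> \<bar>g \<bullet> (r *\<^sub>R z)\<bar> + e * norm (r *\<^sub>R z)"
          using T[OF nz] unfolding y_def by linarith
        also have "\<dots> \<le> r * \<bar>g \<bullet> z\<bar> + e * r"
          using nz e r by (intro add_mono mult_left_mono) (auto simp: abs_mult)
        finally show ?thesis .
      qed
      have dyr: "d y \<le> d x + r" using lip[of y x] nz by (simp add: y_def dist_norm abs_le_iff)
      have w1: "(d y powr (1 - s) - wx) * (r * n + E) \<le> - (s - 1) * (d x + r) powr (- s) * (r * n + E)\<^sup>2"
        unfolding Dd wx_def using \<delta> dy dyr r s by (intro powr_monotone_gap) auto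
      have c1': "p - (s * \<delta> powr (- s - 1)) * r \<le> (d x + r) powr (- s)"
        unfolding p_def using powr_neg_shift[of \<delta> "d x" r s] \<delta> r s by simp
      have "(\<bar>u y\<bar> * d y powr (1 - s) - \<bar>u x\<bar> * wx) * (r * n + E) \<le>
        r\<^sup>2 * (wx * (\<bar>g \<bullet> z\<bar> * \<bar>n\<bar>) - (s - 1) * \<bar>u x\<bar> * p * n\<^sup>2) + A * r * \<bar>E\<bar> + C * (r ^ 3 + e * r\<^sup>2)"
        unfolding A_def C_def
        by (rule hardy_integrand_bound[OF _ _ s n1 D _ L(1) _ u2 u3 gz w1 _ _ c1'])
           (use r e s \<delta> in \<open>auto simp: wx_def p_def intro!: powr_mono2'\<close>)
      also have "\<dots> \<le> r\<^sup>2 * (wx * (norm g / 2 * n\<^sup>2 + (g \<bullet> z)\<^sup>2 / (2 * norm g)) - (s - 1) * \<bar>u x\<bar> * p * n\<^sup>2)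
        + A * r * ((d x - d (x + r *\<^sub>R z)) + (d x - d (x - r *\<^sub>R z)) + 2 * r\<^sup>2 / \<delta>) + C * (r ^ 3 + e * r\<^sup>2)"
      proof (intro add_mono mult_left_mono diff_mono Eb order_refl)
        \<comment> \<open>Young's inequality with weight norm g, chosen because the averages of (g .
          z)^2 and n^2 have ratio (norm g)^2; nothing is lost compared with the Cauchy-Schwarz
          inequality for these averages.\<close>
        show "\<bar>g \<bullet> z\<bar> * \<bar>n\<bar> \<le> norm g / 2 * n\<^sup>2 + (g \<bullet> z)\<^sup>2 / (2 * norm g)"
        proof (cases "norm g = 0")
          case False
          have "0 \<le> (norm g * \<bar>n\<bar> - \<bar>g \<bullet> z\<bar>)\<^sup>2" by simp
          then have "\<bar>g \<bullet> z\<bar> * \<bar>n\<bar> * (2 * norm g) \<le> (norm g)\<^sup>2 * n\<^sup>2 + (g \<bullet> z)\<^sup>2"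
            by (simp add: power2_diff power_mult_distrib algebra_simps)
          then have "\<bar>g \<bullet> z\<bar> * \<bar>n\<bar> \<le> ((norm g)\<^sup>2 * n\<^sup>2 + (g \<bullet> z)\<^sup>2) / (2 * norm g)"
            using False by (simp add: pos_le_divide_eq)
          also have "\<dots> = norm g / 2 * n\<^sup>2 + (g \<bullet> z)\<^sup>2 / (2 * norm g)"
            using False by (simp add: add_divide_distrib power2_eq_square)
          finally show ?thesis .
        qed simp
      qed (use A0 C0 r e s in \<open>auto simp: wx_def p_def\<close>)
      finally have "ker z * ((\<bar>u y\<bar> * d y powr (1 - s) - \<bar>u x\<bar> * wx) * (r * n + E)) \<le> ker z * \<dots>"
        using ker_nonneg by (rule mult_left_mono)
      also have "\<dots> = R z"
        by (simp add: R_def c1_def c2_def c3_def c4_def F_def n_def power2_eq_square algebra_simps)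
      finally show ?thesis unfolding Dd y_def wx_def .
    qed (simp add: ker_eq_0 R_def F_def)
  qed
  then show ?thesis unfolding IR wx_def p_def .
qed

section \<open>The Hardy inequality\<close>

text \<open>The factor 3 leaves two layers around the support: d \<ge> 2\<delta> within distance
  \<delta>, where the local bound is applied, and d \<ge> \<delta> within distance 2\<delta>, where
  the cut-off lives.\<close>

lemma test_fun_margin:
  fixes u :: "'a::euclidean_space \<Rightarrow> real"
  assumes "open \<Omega>" "\<Omega> \<noteq> UNIV" "test_fun \<Omega> u"
  obtains \<delta> where "0 < \<delta>"
    "\<And>x y. y \<in> closure {x. u x \<noteq> 0} \<Longrightarrow> 3 * \<delta> \<le> bdist \<Omega> x + dist x y"
proof -
  let ?S = "closure {x. u x \<noteq> 0}"
  have S: "compact ?S" "?S \<subseteq> \<Omega>" using assms(3) unfolding test_fun_def by blast+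
  obtain m where m: "0 < m" "\<And>y. y \<in> ?S \<Longrightarrow> m \<le> bdist \<Omega> y"
  proof (cases "?S = {}")
    case True
    then show ?thesis by (intro that[of 1]) (simp_all only: empty_iff zero_less_one)
  next
    case False
    obtain x0 where "x0 \<in> ?S" "\<forall>y\<in>?S. bdist \<Omega> x0 \<le> bdist \<Omega> y"
      using continuous_attains_inf[OF S(1) False continuous_on_bdist] by blast
    then show ?thesis using bdist_pos[OF assms(1,2), of x0] S(2) by (intro that[of "bdist \<Omega> x0"]) blast+
  qed
  show ?thesis
  proof (rule that[of "m / 3"])
    fix x y assume "y \<in> ?S"
    then show "3 * (m / 3) \<le> bdist \<Omega> x + dist x y"
      using m(2)[of y] bdist_lipschitz[of \<Omega> x y] by (simp add: abs_le_iff)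
  qed (use m in simp)
qed

lemma integrable_weighted:
  fixes u :: "'a::euclidean_space \<Rightarrow> real"
  assumes \<Omega>: "open \<Omega>" "\<Omega> \<noteq> UNIV" and u: "test_fun \<Omega> u"
  shows "integrable lborel (\<lambda>x. norm (grad u x) * bdist \<Omega> x powr a)"
    and "integrable lborel (\<lambda>x. \<bar>u x\<bar> * bdist \<Omega> x powr a)"
proof -
  let ?S = "closure {x. u x \<noteq> 0}"
  have S: "compact ?S" "?S \<subseteq> \<Omega>" and sm: "smooth u" using u unfolding test_fun_def by blast+
  have pos: "bdist \<Omega> x \<noteq> 0" if "x \<in> ?S" for x using bdist_pos[OF \<Omega>, of x] S(2) that by fastforce
  show "integrable lborel (\<lambda>x. norm (grad u x) * bdist \<Omega> x powr a)"
  proof (rule integrable_compact_support[OF S(1)])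
    show "continuous_on ?S (\<lambda>x. norm (grad u x) * bdist \<Omega> x powr a)"
      by (intro continuous_intros continuous_on_grad[OF sm] continuous_on_bdist) (use pos in blast)
    show "norm (grad u x) * bdist \<Omega> x powr a = 0" if "x \<notin> ?S" for x
      using test_fun_grad_zero[OF u that] by (simp only: norm_zero mult_zero_left)
  qed
  show "integrable lborel (\<lambda>x. \<bar>u x\<bar> * bdist \<Omega> x powr a)"
  proof (rule integrable_compact_support[OF S(1)])
    show "continuous_on ?S (\<lambda>x. \<bar>u x\<bar> * bdist \<Omega> x powr a)"
      by (intro continuous_intros continuous_on_smooth[OF sm] continuous_on_bdist) (use pos in blast)
    show "\<bar>u x\<bar> * bdist \<Omega> x powr a = 0" if "x \<notin> ?S" for x
      using test_fun_zero[OF u that] by (simp only: abs_zero mult_zero_left)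
  qed
qed

text \<open>Pointwise, the Lipschitz bound on d makes the deficit only of order r, too weak for an
  error term A r times the deficit. Symmetrizing moves one difference onto \<psi>; a product of two
  Lipschitz increments has order r^2 on a fixed ball.\<close>

lemma deficit_integral_bound:
  fixes \<psi> d :: "'a::euclidean_space \<Rightarrow> real"
  assumes r: "0 \<le> r" "r \<le> \<delta>" and supp: "\<And>x. B < norm x \<Longrightarrow> \<psi> x = 0"
    and lip: "\<And>x y. \<bar>\<psi> x - \<psi> y\<bar> \<le> M * dist x y" "0 \<le> M" "\<And>x y. \<bar>d x - d y\<bar> \<le> dist x y"
  shows "integrable lborel (\<lambda>x. \<psi> x * deficit d r x)"
    and "2 * (\<integral>x. \<psi> x * deficit d r x \<partial>lborel)
      \<le> M * integral\<^sup>L lborel (ker :: 'a \<Rightarrow> real) * measure lborel (cball (0 :: 'a) (B + \<delta>)) * r\<^sup>2"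
proof -
  have c1: "continuous_on UNIV \<psi>"
    by (rule lipschitz_on_continuous_on[where L = M], rule lipschitz_onI) (simp_all add: dist_real_def lip)
  have c2: "continuous_on UNIV d"
    by (rule lipschitz_on_continuous_on[where L = 1], rule lipschitz_onI) (simp_all add: dist_real_def lip)
  note ci = continuous_intros continuous_on_compose2[OF c1 _ subset_UNIV] continuous_on_compose2[OF c2 _ subset_UNIV]
  define J where "J x = (\<integral>z. ker z * ((\<psi> (x + r *\<^sub>R z) - \<psi> x) * (d (x + r *\<^sub>R z) - d x)) \<partial>lborel)" for x
  have zero: "\<psi> x = 0" if "x \<notin> cball 0 B" for x using supp[of x] that by simp
  have sym: "integrable lborel J" "integrable lborel (\<lambda>x. \<psi> x * deficit d r x)"
    "(\<integral>x. J x \<partial>lborel) = 2 * (\<integral>x. \<psi> x * deficit d r x \<partial>lborel)"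
    unfolding J_def deficit_def by (rule ker_symmetrize[OF compact_cball zero c1 c2]; assumption)+
  show "integrable lborel (\<lambda>x. \<psi> x * deficit d r x)" by (rule sym(2))
  define c where "c = M * r\<^sup>2 * integral\<^sup>L lborel (ker :: 'a \<Rightarrow> real)"
  have "(\<integral>x. J x \<partial>lborel) \<le> (\<integral>x. indicator (cball 0 (B + \<delta>)) (x :: 'a) * c \<partial>lborel)"
  proof (rule integral_mono[OF sym(1)])
    show "integrable lborel (\<lambda>x::'a. indicator (cball 0 (B + \<delta>)) x * c)"
      by (intro integrable_mult_left integrable_real_indicator emeasure_bounded_finite bounded_cball) simp
    fix x :: 'a
    show "J x \<le> indicator (cball 0 (B + \<delta>)) x * c"
    proof (cases "norm x \<le> B + \<delta>")
      case True
      have "J x \<le> (\<integral>z. ker (z :: 'a) * (M * r\<^sup>2) \<partial>lborel)"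
        unfolding J_def
      proof (intro integral_mono integrable_ker_mult ci)
        fix z :: 'a
        show "ker z * ((\<psi> (x + r *\<^sub>R z) - \<psi> x) * (d (x + r *\<^sub>R z) - d x)) \<le> ker z * (M * r\<^sup>2)"
        proof (cases "norm z < 1")
          case True
          have nz: "norm (r *\<^sub>R z) \<le> r" using True r by (simp add: mult_left_le)
          have "(\<psi> (x + r *\<^sub>R z) - \<psi> x) * (d (x + r *\<^sub>R z) - d x) \<le>
              \<bar>\<psi> (x + r *\<^sub>R z) - \<psi> x\<bar> * \<bar>d (x + r *\<^sub>R z) - d x\<bar>"
            by (metis abs_ge_self abs_mult)
          also have "\<dots> \<le> (M * r) * r"
          proof (intro mult_mono)
            have "M * norm (r *\<^sub>R z) \<le> M * r" using nz lip(2) by (intro mult_left_mono)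
            then show "\<bar>\<psi> (x + r *\<^sub>R z) - \<psi> x\<bar> \<le> M * r"
              using lip(1)[of "x + r *\<^sub>R z" x] by (simp add: dist_norm)
            show "\<bar>d (x + r *\<^sub>R z) - d x\<bar> \<le> r"
              using lip(3)[of "x + r *\<^sub>R z" x] nz by (simp add: dist_norm)
          qed (use lip(2) r in auto)
          finally show ?thesis by (intro mult_left_mono ker_nonneg) (simp add: power2_eq_square mult_ac)
        qed (simp add: ker_eq_0)
      qed
      also have "\<dots> = c" by (simp add: c_def)
      finally show ?thesis using True by simp
    next
      case False
      have zz: "ker z * ((\<psi> (x + r *\<^sub>R z) - \<psi> x) * (d (x + r *\<^sub>R z) - d x)) = 0" for z
      proof (cases "norm z < 1")
        case True
        have nz: "norm (r *\<^sub>R z) \<le> r" using True r by (simp add: mult_left_le)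
        have "norm x \<le> norm (x + r *\<^sub>R z) + norm (r *\<^sub>R z)"
          using norm_triangle_ineq4[of "x + r *\<^sub>R z" "r *\<^sub>R z"] by simp
        then have "B < norm (x + r *\<^sub>R z)" using False nz r by linarith
        moreover have "B < norm x" using False r by linarith
        ultimately show ?thesis by (simp add: supp)
      qed (simp add: ker_eq_0)
      have "J x = 0" unfolding J_def zz by simp
      then show ?thesis using False by simp
    qed
  qed
  also have "\<dots> = measure lborel (cball (0 :: 'a) (B + \<delta>)) * c" by simp
  finally show "2 * (\<integral>x. \<psi> x * deficit d r x \<partial>lborel)
      \<le> M * integral\<^sup>L lborel (ker :: 'a \<Rightarrow> real) * measure lborel (cball (0 :: 'a) (B + \<delta>)) * r\<^sup>2"
    unfolding sym(3) [symmetric] by (simp add: c_def mult_ac)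
qed

lemma hardy_inequality:
  fixes \<Omega> :: "'a::euclidean_space set"
  assumes \<Omega>: "open \<Omega>" "\<Omega> \<noteq> UNIV" and super: "neg_laplacian_nonneg \<Omega> (bdist \<Omega>)"
    and u: "test_fun \<Omega> u" and s: "1 < s"
  shows "(s - 1) * (\<integral>x. \<bar>u x\<bar> * bdist \<Omega> x powr (- s) \<partial>lborel)
    \<le> (\<integral>x. norm (grad u x) * bdist \<Omega> x powr (1 - s) \<partial>lborel)"
proof (cases "closure {x. u x \<noteq> 0} = {}")
  \<comment> \<open>Treated apart because \<open>infdist\<close> to the empty set is 0 by
    convention, so distances to the support would be meaningless.\<close>
  case True
  have n: "x \<notin> closure {x. u x \<noteq> 0}" for x unfolding True by blast
  show ?thesis by (simp only: test_fun_zero[OF u n] test_fun_grad_zero[OF u n]) simp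
next
  case False
  define S where "S = closure {x. u x \<noteq> 0}"
  define d where "d = bdist \<Omega>"
  define \<sigma> where "\<sigma> = integral\<^sup>L lborel (bump :: 'a \<Rightarrow> real)"
  define \<kappa> where "\<kappa> = integral\<^sup>L lborel (ker :: 'a \<Rightarrow> real)"
  have S: "compact S" "S \<subseteq> \<Omega>" "S \<noteq> {}" and sm: "smooth u"
    using u False unfolding test_fun_def S_def by blast+
  have zero: "u x = 0" "grad u x = 0" if "x \<notin> S" for x
    using test_fun_zero[OF u, of x] test_fun_grad_zero[OF u, of x] that by (simp_all only: S_def not_False_eq_True)
  obtain \<delta> where \<delta>: "0 < \<delta>"
    and margin: "\<And>x y. y \<in> closure {x. u x \<noteq> 0} \<Longrightarrow> 3 * \<delta> \<le> bdist \<Omega> x + dist x y"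
    by (rule test_fun_margin[OF \<Omega> u]) (rule that; blast)
  have far0: "3 * \<delta> \<le> d x + dist x y" if "y \<in> S" for x y
    unfolding d_def by (rule margin) (use that in \<open>simp only: S_def\<close>)
  obtain L where L: "0 \<le> L" "\<And>x. \<bar>u x\<bar> \<le> L" "\<And>x. norm (grad u x) \<le> L"
    "\<And>x h. \<bar>u (x + h) - u x\<bar> \<le> L * norm h"
    by (rule test_fun_bounds[OF u]) (rule that; blast)
  obtain B where B: "\<And>x. x \<in> S \<Longrightarrow> norm x \<le> B"
    using compact_imp_bounded[OF S(1)] bounded_iff by blast
  have attain: "\<exists>y\<in>S. infdist x S = dist x y" for x
    using infdist_attains_inf[OF compact_imp_closed[OF S(1)] S(3)] by blast
  have far: "3 * \<delta> \<le> d x + infdist x S" for x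
  proof -
    obtain y where "y \<in> S" "infdist x S = dist x y" using attain by blast
    then show ?thesis using far0[of y x] by simp
  qed
  \<comment> \<open>Weight for the deficit when it is integrated over x: it is 1 wherever J can be
    nonzero, it vanishes before d can fall below \<delta>, and it is Lipschitz as
    \<open>deficit_integral_bound\<close> requires.\<close>
  define \<psi> where "\<psi> x = max 0 (min 1 (2 - infdist x S / \<delta>))" for x
  have \<psi>0: "0 \<le> \<psi> x" for x by (simp add: \<psi>_def)
  have \<psi>1: "\<psi> x = 1" if "infdist x S \<le> \<delta>" for x
  proof -
    have "infdist x S / \<delta> \<le> 1" using that \<delta> by (simp add: pos_divide_le_eq)
    then show ?thesis by (simp add: \<psi>_def)
  qed
  have \<psi>supp: "\<psi> x = 0" if "2 * \<delta> \<le> infdist x S" for x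
  proof -
    have "2 \<le> infdist x S / \<delta>" using that \<delta> by (simp add: pos_le_divide_eq)
    then show ?thesis by (simp add: \<psi>_def)
  qed
  have \<psi>lip: "\<bar>\<psi> x - \<psi> y\<bar> \<le> 1 / \<delta> * dist x y" for x y
  proof -
    have "\<bar>\<psi> x - \<psi> y\<bar> \<le> \<bar>infdist x S / \<delta> - infdist y S / \<delta>\<bar>"
    proof -
      have "\<bar>max 0 (min 1 (2 - a)) - max 0 (min 1 (2 - b))\<bar> \<le> \<bar>a - b\<bar>" for a b :: real
        by linarith
      then show ?thesis unfolding \<psi>_def .
    qed
    also have "\<dots> = 1 / \<delta> * \<bar>infdist x S - infdist y S\<bar>"
      using \<delta> by (simp add: diff_divide_distrib [symmetric])
    also have "\<dots> \<le> 1 / \<delta> * dist x y"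
      using \<delta> infdist_triangle[of x S y] infdist_triangle[of y S x]
      by (intro mult_left_mono) (auto simp: abs_le_iff dist_commute)
    finally show ?thesis .
  qed
  have \<psi>norm: "\<psi> x = 0" if "B + 2 * \<delta> < norm x" for x
  proof -
    obtain y where "y \<in> S" "infdist x S = dist x y" using attain by blast
    moreover have "norm x \<le> norm y + dist x y"
      using norm_triangle_ineq2[of x y] by (simp add: dist_norm)
    ultimately show ?thesis using B[of y] that by (intro \<psi>supp) simp
  qed
  have lipd: "\<bar>d x - d y\<bar> \<le> dist x y" for x y unfolding d_def by (rule bdist_lipschitz)
  have cd: "continuous_on A d" for A unfolding d_def by (rule continuous_on_bdist)
  define f where "f x = \<bar>u x\<bar> * d x powr (1 - s)" for x
  define h where "h x = d x powr (1 - s) * norm (grad u x) - (s - 1) * (\<bar>u x\<bar> * d x powr (- s))" for x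
  have f0: "f x = 0" if "x \<notin> S" for x using zero(1)[OF that] by (simp add: f_def)
  have cf: "continuous_on UNIV f"
  proof -
    have "continuous_on \<Omega> f"
      unfolding f_def
      by (intro continuous_intros continuous_on_smooth[OF sm] cd) (use bdist_pos[OF \<Omega>] in \<open>force simp: d_def\<close>)
    moreover have "continuous_on (- S) f"
      by (rule continuous_on_eq[where f = "\<lambda>_. 0"]) (simp_all add: f0)
    ultimately have "continuous_on (\<Omega> \<union> - S) f"
      using \<Omega>(1) compact_imp_closed[OF S(1)] by (intro continuous_on_open_Un) auto
    moreover have "\<Omega> \<union> - S = UNIV" using S(2) by blast
    ultimately show ?thesis by simp
  qed
  have ih: "integrable lborel h"
    unfolding h_def d_def using integrable_weighted[OF \<Omega> u]
    by (intro Bochner_Integration.integrable_diff integrable_mult_right) (simp_all add: mult.commute)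
  have i\<psi>: "integrable lborel \<psi>"
  proof (rule integrable_compact_support[OF compact_cball])
    show "\<psi> x = 0" if "x \<notin> cball 0 (B + 2 * \<delta>)" for x using that \<psi>norm by simp
    show "continuous_on (cball 0 (B + 2 * \<delta>)) \<psi>"
      unfolding \<psi>_def using \<delta> by (intro continuous_intros) auto
  qed
  define A where "A = 2 * (s - 1) * L * \<delta> powr (- s) + \<delta> powr (1 - s) * L"
  define C where "C = (s - 1) * (L * \<delta> powr (- s) + L * (s * \<delta> powr (- s - 1))) + \<delta> powr (1 - s)"
  have A0: "0 \<le> A" and C0: "0 \<le> C"
    using s \<delta> L(1) by (auto simp: A_def C_def intro!: add_nonneg_nonneg mult_nonneg_nonneg)
  have \<kappa>0: "0 < \<kappa>" and \<sigma>0: "0 < \<sigma>"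
    unfolding \<kappa>_def \<sigma>_def by (rule integral_ker_pos integral_bump_pos)+
  define M where "M = 1 / \<delta> * \<kappa> * measure lborel (cball (0 :: 'a) (B + 2 * \<delta> + \<delta>))"
  \<comment> \<open>K collects all error terms after division by r^2 e; it does not depend on e, so
    e can tend to 0.\<close>
  define K where "K = A * M + (2 * A * \<kappa> / \<delta> + 2 * C * \<kappa>) * (\<integral>x. \<psi> x \<partial>lborel)"
  have K0: "0 \<le> K"
    unfolding K_def M_def using A0 C0 \<kappa>0 \<delta> \<psi>0 by (intro add_nonneg_nonneg mult_nonneg_nonneg Bochner_Integration.integral_nonneg) auto
  have key: "0 \<le> \<sigma> * (\<integral>x. h x \<partial>lborel) + e * K" if e: "0 < e" for e
  proof -
    obtain r0 where r0: "0 < r0" and T: "\<And>x h. norm h \<le> r0 \<Longrightarrow> \<bar>u (x + h) - u x - grad u x \<bullet> h\<bar> \<le> e * norm h"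
      by (rule test_fun_taylor[OF u e]) (rule that; blast)
    \<comment> \<open>Half of \<delta> gives the strict r < \<delta> under which the deficit is
      nonnegative near the support; r \<le> e turns the errors of order r^3 into errors of order e
      r^2.\<close>
    define r where "r = min (min r0 (\<delta> / 2)) e"
    have r: "0 < r" "r \<le> r0" "r \<le> \<delta>" "r < \<delta>" "r \<le> e" using r0 \<delta> e by (auto simp: r_def)
    define J where "J x = (\<integral>z. ker z * ((f (x + r *\<^sub>R z) - f x) * (d (x + r *\<^sub>R z) - d x)) \<partial>lborel)" for x
    have sym: "integrable lborel J" "(\<integral>x. J x \<partial>lborel) = 2 * (\<integral>x. f x * deficit d r x \<partial>lborel)"
      unfolding J_def deficit_def by (rule ker_symmetrize[OF S(1) f0 cf cd]; assumption)+
    have dn: "0 \<le> deficit d r x" if "infdist x S \<le> 2 * \<delta>" for x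
      using deficit_nonneg[OF super r(1), of x] far[of x] r(4) that by (simp add: d_def)
    define c where "c = A * r * (2 * r\<^sup>2 / \<delta> * \<kappa>) + C * (r ^ 3 + e * r\<^sup>2) * \<kappa>"
    have c0: "0 \<le> c" using A0 C0 \<kappa>0 \<delta> r e by (auto simp: c_def intro!: add_nonneg_nonneg mult_nonneg_nonneg)
    have Jle: "J x \<le> r\<^sup>2 * \<sigma> * h x + A * r * (2 * (\<psi> x * deficit d r x)) + c * \<psi> x" for x
    proof (cases "infdist x S \<le> \<delta>")
      case True
      have "J x \<le> r\<^sup>2 * \<sigma> * (d x powr (1 - s) * norm (grad u x) - (s - 1) * (\<bar>u x\<bar> * d x powr (- s)))
        + A * r * (2 * deficit d r x + 2 * r\<^sup>2 / \<delta> * \<kappa>) + C * (r ^ 3 + e * r\<^sup>2) * \<kappa>"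
        unfolding J_def f_def A_def C_def \<sigma>_def \<kappa>_def d_def
        by (rule hardy_local_bound[OF \<Omega> s \<delta>])
           (use far[of x] True r e L T continuous_on_smooth[OF sm] in \<open>auto simp: d_def\<close>)
      then show ?thesis using \<psi>1[OF True] by (simp add: h_def c_def algebra_simps)
    next
      \<comment> \<open>Away from the support J and h vanish, and the right side is nonnegative
        because \<psi> is 0 wherever the sign of the deficit is unknown.\<close>
      case False
      have zz: "ker z * ((f (x + r *\<^sub>R z) - f x) * (d (x + r *\<^sub>R z) - d x)) = 0" for z
      proof (cases "norm z < 1")
        case True
        have "dist x (x + r *\<^sub>R z) \<le> r" using True r by (simp add: dist_norm mult_left_le)
        then have "x + r *\<^sub>R z \<notin> S" using infdist_le[of "x + r *\<^sub>R z" S x] False r by linarith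
        moreover have "x \<notin> S" using False \<delta> by auto
        ultimately show ?thesis by (simp add: f0)
      qed (simp add: ker_eq_0)
      have "J x = 0" unfolding J_def zz by simp
      moreover have "h x = 0" using zero[of x] False \<delta> by (force simp: h_def)
      moreover have "0 \<le> \<psi> x * deficit d r x"
        using \<psi>0[of x] dn[of x] \<psi>supp[of x] by (cases "infdist x S \<le> 2 * \<delta>") auto
      ultimately show ?thesis using A0 r c0 \<psi>0[of x] by simp
    qed
    have D: "integrable lborel (\<lambda>x. \<psi> x * deficit d r x)"
      "2 * (\<integral>x. \<psi> x * deficit d r x \<partial>lborel) \<le> M * r\<^sup>2"
      unfolding M_def \<kappa>_def
      by (rule deficit_integral_bound[of r \<delta> "B + 2 * \<delta>" \<psi> "1 / \<delta>" d]; use r \<delta> \<psi>norm \<psi>lip lipd in simp)+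
    have "0 \<le> (\<integral>x. f x * deficit d r x \<partial>lborel)"
    proof (rule Bochner_Integration.integral_nonneg)
      fix x show "0 \<le> f x * deficit d r x"
      proof (cases "x \<in> S")
        case True
        then have "0 \<le> deficit d r x" using \<delta> by (intro dn) simp
        moreover have "0 \<le> f x" by (simp add: f_def)
        ultimately show ?thesis by simp
      qed (simp add: f0)
    qed
    then have "0 \<le> (\<integral>x. J x \<partial>lborel)" unfolding sym(2) by simp
    also have "\<dots> \<le> (\<integral>x. r\<^sup>2 * \<sigma> * h x + A * r * (2 * (\<psi> x * deficit d r x)) + c * \<psi> x \<partial>lborel)"
      by (intro integral_mono Jle sym(1) Bochner_Integration.integrable_add integrable_mult_right ih D(1) i\<psi>)
    also have "\<dots> = r\<^sup>2 * \<sigma> * (\<integral>x. h x \<partial>lborel) + A * r * (2 * (\<integral>x. \<psi> x * deficit d r x \<partial>lborel)) + c * (\<integral>x. \<psi> x \<partial>lborel)"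
      using ih D(1) i\<psi> by simp
    also have "\<dots> \<le> r\<^sup>2 * \<sigma> * (\<integral>x. h x \<partial>lborel) + A * e * (M * r\<^sup>2)
        + (r\<^sup>2 * e * (2 * A * \<kappa> / \<delta> + 2 * C * \<kappa>)) * (\<integral>x. \<psi> x \<partial>lborel)"
    proof (intro add_mono order_refl mult_right_mono)
      have "A * r * (2 * (\<integral>x. \<psi> x * deficit d r x \<partial>lborel)) \<le> A * r * (M * r\<^sup>2)"
        using D(2) A0 r by (intro mult_left_mono) auto
      also have "\<dots> \<le> A * e * (M * r\<^sup>2)"
        using A0 r \<kappa>0 \<delta> by (intro mult_right_mono mult_left_mono) (auto simp: M_def)
      finally show "A * r * (2 * (\<integral>x. \<psi> x * deficit d r x \<partial>lborel)) \<le> A * e * (M * r\<^sup>2)" .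
      have "c = r * (r\<^sup>2 * (2 * A * \<kappa> / \<delta> + C * \<kappa>)) + r\<^sup>2 * e * (C * \<kappa>)"
        by (simp add: c_def algebra_simps power2_eq_square power3_eq_cube)
      also have "\<dots> \<le> e * (r\<^sup>2 * (2 * A * \<kappa> / \<delta> + C * \<kappa>)) + r\<^sup>2 * e * (C * \<kappa>)"
        using r A0 C0 \<kappa>0 \<delta> by (intro add_right_mono mult_right_mono) auto
      also have "\<dots> = r\<^sup>2 * e * (2 * A * \<kappa> / \<delta> + 2 * C * \<kappa>)"
        by (simp add: algebra_simps)
      finally show "c \<le> r\<^sup>2 * e * (2 * A * \<kappa> / \<delta> + 2 * C * \<kappa>)" .
    qed (use \<psi>0 in simp)
    also have "\<dots> = r\<^sup>2 * (\<sigma> * (\<integral>x. h x \<partial>lborel) + e * K)"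
      by (simp add: K_def algebra_simps)
    finally show ?thesis using r(1) by (simp add: zero_le_mult_iff)
  qed
  have "0 \<le> \<sigma> * (\<integral>x. h x \<partial>lborel) + t" if "0 < t" for t
  proof -
    have "t / (K + 1) * K \<le> t"
      using K0 that by (simp add: field_simps)
    then show ?thesis using key[of "t / (K + 1)"] K0 that by simp
  qed
  then have "0 \<le> \<sigma> * (\<integral>x. h x \<partial>lborel)" by (rule field_le_epsilon)
  then have "0 \<le> (\<integral>x. h x \<partial>lborel)" using \<sigma>0 by (simp add: zero_le_mult_iff)
  also have "\<dots> = (\<integral>x. norm (grad u x) * d x powr (1 - s) \<partial>lborel) - (s - 1) * (\<integral>x. \<bar>u x\<bar> * d x powr (- s) \<partial>lborel)"
    unfolding h_def using integrable_weighted[OF \<Omega> u, folded d_def] by (simp add: mult.commute)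
  finally show ?thesis by (simp add: d_def)
qed

section \<open>Near-optimal functions on a half space\<close>

lemma nn_integral_shift:
  fixes f :: "'a::euclidean_space \<Rightarrow> ennreal"
  assumes [measurable]: "f \<in> borel_measurable borel"
  shows "(\<integral>\<^sup>+x. f (x + c) \<partial>lborel) = (\<integral>\<^sup>+x. f x \<partial>lborel)"
proof -
  have "(\<integral>\<^sup>+x. f x \<partial>lborel) = (\<integral>\<^sup>+x. f x \<partial>distr lborel borel ((+) c))"
    by (simp add: lborel_distr_plus)
  also have "\<dots> = (\<integral>\<^sup>+x. f (c + x) \<partial>lborel)"
    by (rule nn_integral_distr) auto
  finally show ?thesis by (simp add: add.commute)
qed

(* Functions of the form f(x . v) b(x), with b constant along v: as a functional of f the
   integral is translation invariant, hence a multiple of Lebesgue measure. *)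
lemma nn_integral_slab:
  fixes \<nu> :: "'a::euclidean_space" and f :: "real \<Rightarrow> ennreal" and b :: "'a \<Rightarrow> ennreal"
  assumes [measurable]: "f \<in> borel_measurable borel" "b \<in> borel_measurable borel"
    and \<nu>: "norm \<nu> = 1" and b: "\<And>x t. b (x + t *\<^sub>R \<nu>) = b x"
  shows "(\<integral>\<^sup>+x. f (x \<bullet> \<nu>) * b x \<partial>lborel) =
    (\<integral>\<^sup>+x. indicator {0..1} (x \<bullet> \<nu>) * b x \<partial>lborel) * (\<integral>\<^sup>+t. f t \<partial>lborel)"
proof -
  have \<nu>\<nu>: "\<nu> \<bullet> \<nu> = 1" using \<nu> by (simp add: dot_square_norm)
  let ?I = "indicator {0..1::real} :: real \<Rightarrow> ennreal"
  \<comment> \<open>Inserting the factor 1, the length of [0,1], brings in a second variable \<tau>.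
    Shifting x by \<tau> \<nu> and applying Tonelli twice then exchanges the roles of f and the
    indicator.\<close>
  have "(\<integral>\<^sup>+x. f (x \<bullet> \<nu>) * b x \<partial>lborel) = (\<integral>\<^sup>+\<tau>. ?I \<tau> \<partial>lborel) * (\<integral>\<^sup>+x. f (x \<bullet> \<nu>) * b x \<partial>lborel)"
    by simp
  also have "\<dots> = (\<integral>\<^sup>+\<tau>. ?I \<tau> * (\<integral>\<^sup>+x. f (x \<bullet> \<nu>) * b x \<partial>lborel) \<partial>lborel)"
    by (rule nn_integral_multc[symmetric]) simp
  also have "\<dots> = (\<integral>\<^sup>+\<tau>. (\<integral>\<^sup>+x. ?I \<tau> * (f (x \<bullet> \<nu> + \<tau>) * b x) \<partial>lborel) \<partial>lborel)"
  proof (rule nn_integral_cong)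
    fix \<tau> :: real
    have "(\<integral>\<^sup>+x. f (x \<bullet> \<nu>) * b x \<partial>lborel) = (\<integral>\<^sup>+x. f ((x + \<tau> *\<^sub>R \<nu>) \<bullet> \<nu>) * b (x + \<tau> *\<^sub>R \<nu>) \<partial>lborel)"
      by (rule nn_integral_shift[symmetric]) simp
    also have "\<dots> = (\<integral>\<^sup>+x. f (x \<bullet> \<nu> + \<tau>) * b x \<partial>lborel)"
      by (simp add: b inner_add_left \<nu>\<nu>)
    finally show "?I \<tau> * (\<integral>\<^sup>+x. f (x \<bullet> \<nu>) * b x \<partial>lborel) = (\<integral>\<^sup>+x. ?I \<tau> * (f (x \<bullet> \<nu> + \<tau>) * b x) \<partial>lborel)"
      by (simp add: nn_integral_cmult)
  qed
  also have "\<dots> = (\<integral>\<^sup>+x. (\<integral>\<^sup>+\<tau>. ?I \<tau> * (f (x \<bullet> \<nu> + \<tau>) * b x) \<partial>lborel) \<partial>lborel)"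
    by (rule lborel_pair.Fubini') simp
  also have "\<dots> = (\<integral>\<^sup>+x. (\<integral>\<^sup>+\<tau>. ?I (\<tau> - x \<bullet> \<nu>) * (f \<tau> * b x) \<partial>lborel) \<partial>lborel)"
  proof (rule nn_integral_cong)
    fix x :: 'a
    have "(\<integral>\<^sup>+\<tau>. ?I (\<tau> - x \<bullet> \<nu>) * (f \<tau> * b x) \<partial>lborel)
        = (\<integral>\<^sup>+\<tau>. ?I (\<tau> + x \<bullet> \<nu> - x \<bullet> \<nu>) * (f (\<tau> + x \<bullet> \<nu>) * b x) \<partial>lborel)"
      by (rule nn_integral_shift[symmetric]) simp
    then show "(\<integral>\<^sup>+\<tau>. ?I \<tau> * (f (x \<bullet> \<nu> + \<tau>) * b x) \<partial>lborel) = (\<integral>\<^sup>+\<tau>. ?I (\<tau> - x \<bullet> \<nu>) * (f \<tau> * b x) \<partial>lborel)"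
      by (simp add: add.commute)
  qed
  also have "\<dots> = (\<integral>\<^sup>+\<tau>. (\<integral>\<^sup>+x. ?I (\<tau> - x \<bullet> \<nu>) * (f \<tau> * b x) \<partial>lborel) \<partial>lborel)"
    by (rule lborel_pair.Fubini'[symmetric]) simp
  also have "\<dots> = (\<integral>\<^sup>+\<tau>. (\<integral>\<^sup>+x. ?I (x \<bullet> \<nu>) * b x \<partial>lborel) * f \<tau> \<partial>lborel)"
  proof (rule nn_integral_cong)
    fix \<tau> :: real
    \<comment> \<open>The shift by \<tau> - 1 rather than \<tau> makes the argument 1 - x . \<nu>,
      and t \<mapsto> 1 - t preserves [0,1].\<close>
    have "(\<integral>\<^sup>+x. ?I (\<tau> - x \<bullet> \<nu>) * b x \<partial>lborel)
        = (\<integral>\<^sup>+x. ?I (\<tau> - (x + (\<tau> - 1) *\<^sub>R \<nu>) \<bullet> \<nu>) * b (x + (\<tau> - 1) *\<^sub>R \<nu>) \<partial>lborel)"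
      by (rule nn_integral_shift[symmetric]) simp
    also have "\<dots> = (\<integral>\<^sup>+x. ?I (x \<bullet> \<nu>) * b x \<partial>lborel)"
      by (intro nn_integral_cong) (auto simp: b inner_add_left \<nu>\<nu> indicator_def)
    finally have "(\<integral>\<^sup>+x. ?I (x \<bullet> \<nu>) * b x \<partial>lborel) * f \<tau> = (\<integral>\<^sup>+x. ?I (\<tau> - x \<bullet> \<nu>) * b x \<partial>lborel) * f \<tau>" by simp
    also have "\<dots> = (\<integral>\<^sup>+x. ?I (\<tau> - x \<bullet> \<nu>) * b x * f \<tau> \<partial>lborel)"
      by (rule nn_integral_multc[symmetric]) simp
    finally show "(\<integral>\<^sup>+x. ?I (\<tau> - x \<bullet> \<nu>) * (f \<tau> * b x) \<partial>lborel) = (\<integral>\<^sup>+x. ?I (x \<bullet> \<nu>) * b x \<partial>lborel) * f \<tau>"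
      by (simp add: mult_ac)
  qed
  also have "\<dots> = (\<integral>\<^sup>+x. ?I (x \<bullet> \<nu>) * b x \<partial>lborel) * (\<integral>\<^sup>+t. f t \<partial>lborel)"
    by (rule nn_integral_cmult) simp
  finally show ?thesis .
qed

lemma flat_le: "flat 0 t \<le> 1" "flat (Suc 0) t \<le> 2"
proof -
  show "flat 0 t \<le> 1" by (simp add: flat_0)
  show "flat (Suc 0) t \<le> 2"
  proof (cases "0 < t")
    case True
    define y where "y = 1 / t"
    have "1 + y + y\<^sup>2 / 2 \<le> exp y" "0 \<le> y"
      using exp_lower_Taylor_quadratic[of y] True by (simp_all add: y_def)
    then have "y\<^sup>2 \<le> 2 * exp y" by linarith
    then have "y\<^sup>2 * exp (- y) \<le> 2 * exp y * exp (- y)" by (intro mult_right_mono) auto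
    then have "(1 / t)\<^sup>2 * exp (- (1 / t)) \<le> 2" by (simp add: y_def mult.assoc mult_exp_exp)
    then show ?thesis using True by (simp add: flat_1 power_divide)
  qed (simp add: flat_def)
qed

text \<open>For a unit vector \<nu>, the squared distance to the axis spanned by \<nu>, written as a
  polynomial in inner products so that functions of it stay in \<open>flat_alg\<close>.\<close>

definition perp_sq :: "'a::euclidean_space \<Rightarrow> 'a \<Rightarrow> real" where
  "perp_sq \<nu> x = x \<bullet> x - (x \<bullet> \<nu>)\<^sup>2"

text \<open>For b constant along the unit vector \<nu> this is the integral of b over the hyperplane
  orthogonal to \<nu>, expressed without a measure on the hyperplane.\<close>

definition slab_mass :: "'a::euclidean_space \<Rightarrow> ('a \<Rightarrow> ennreal) \<Rightarrow> ennreal" where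
  "slab_mass \<nu> b = (\<integral>\<^sup>+x. indicator {0..1} (x \<bullet> \<nu>) * b x \<partial>lborel)"

context
  fixes \<nu> :: "'a::euclidean_space" and \<delta> :: real
  assumes \<nu>: "norm \<nu> = 1" and \<delta>: "0 < \<delta>" "4 * \<delta> \<le> 1"
begin

lemma inner_axis_self: "\<nu> \<bullet> \<nu> = 1"
  using \<nu> by (simp add: dot_square_norm)

text \<open>Switched on just above height \<delta>, then cut off at height 2 and at distance 1 from
  the axis. Only the first factor depends on \<delta>: as \<delta> tends to 0 the weighted mass
  concentrates near the boundary, where the function increases along \<nu>, and the two cut-offs
  become negligible in comparison.\<close>

definition profile :: "'a \<Rightarrow> real" where
  "profile x = flat 0 (x \<bullet> \<nu> / \<delta> - 1) * flat 0 (2 - x \<bullet> \<nu>) * flat 0 (1 - perp_sq \<nu> x)"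

lemma perp_sq_shift: "perp_sq \<nu> (x + t *\<^sub>R \<nu>) = perp_sq \<nu> x"
  using inner_axis_self
  by (simp add: perp_sq_def inner_add_left inner_add_right inner_commute power2_eq_square algebra_simps)

lemma perp_sq_eq_norm: "perp_sq \<nu> x = (norm (x - (x \<bullet> \<nu>) *\<^sub>R \<nu>))\<^sup>2"
  unfolding perp_sq_def power2_norm_eq_inner
  by (simp add: inner_diff_left inner_diff_right inner_commute[of \<nu> x] inner_axis_self power2_eq_square)

lemma profile_alg: "profile \<in> flat_alg"
proof -
  have "(\<lambda>x. inverse \<delta> * (x \<bullet> \<nu>) - 1) \<in> flat_alg" "(\<lambda>x. 2 - x \<bullet> \<nu>) \<in> flat_alg"
    "(\<lambda>x. 1 - ((x - 0) \<bullet> (x - 0) - (x \<bullet> \<nu>) * (x \<bullet> \<nu>))) \<in> flat_alg"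
    by (intro flat_alg_diff flat_alg_smul flat_alg_sq_dist flat_alg.intros)+
  then have "(\<lambda>x. flat 0 (inverse \<delta> * (x \<bullet> \<nu>) - 1) * flat 0 (2 - x \<bullet> \<nu>)
      * flat 0 (1 - ((x - 0) \<bullet> (x - 0) - (x \<bullet> \<nu>) * (x \<bullet> \<nu>)))) \<in> flat_alg"
    by (intro flat_alg.mult flat_alg.flat)
  moreover have "(\<lambda>x. flat 0 (inverse \<delta> * (x \<bullet> \<nu>) - 1) * flat 0 (2 - x \<bullet> \<nu>)
      * flat 0 (1 - ((x - 0) \<bullet> (x - 0) - (x \<bullet> \<nu>) * (x \<bullet> \<nu>)))) = profile"
    by (simp add: profile_def [abs_def] perp_sq_def divide_inverse power2_eq_square mult.commute)
  ultimately show ?thesis by simp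
qed

lemma smooth_profile: "smooth profile"
  by (rule smooth_flat_alg[OF profile_alg])

definition slab :: "'a set" where
  "slab = {x. \<delta> \<le> x \<bullet> \<nu> \<and> x \<bullet> \<nu> \<le> 2 \<and> perp_sq \<nu> x \<le> 1}"

lemma profile_eq_0: "x \<notin> slab \<Longrightarrow> profile x = 0"
  using \<delta> unfolding slab_def profile_def by (auto simp: flat_def not_le field_simps)

lemma continuous_on_perp_sq: "continuous_on A (perp_sq \<nu>)"
  unfolding perp_sq_def [abs_def] by (intro continuous_intros)

lemma norm_perp_le: "x \<in> slab \<Longrightarrow> norm (x - (x \<bullet> \<nu>) *\<^sub>R \<nu>) \<le> 1"
  by (rule power2_le_imp_le) (simp_all add: slab_def perp_sq_eq_norm)

lemma compact_slab: "compact slab"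
proof -
  have "closed slab"
    unfolding slab_def
    by (intro closed_Collect_conj closed_Collect_le continuous_on_perp_sq continuous_intros)
  moreover have "norm x \<le> 3" if "x \<in> slab" for x
  proof -
    have "norm (x - (x \<bullet> \<nu>) *\<^sub>R \<nu>) \<le> 1"
      using that by (rule norm_perp_le)
    moreover have "norm ((x \<bullet> \<nu>) *\<^sub>R \<nu>) \<le> 2" using that \<nu> \<delta> by (simp add: slab_def)
    ultimately show ?thesis using norm_triangle_ineq[of "x - (x \<bullet> \<nu>) *\<^sub>R \<nu>" "(x \<bullet> \<nu>) *\<^sub>R \<nu>"] by simp
  qed
  then have "bounded slab" by (auto simp: bounded_iff)
  ultimately show ?thesis by (simp add: compact_eq_bounded_closed)
qed

lemma profile_nonneg: "0 \<le> profile x"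
  by (simp add: profile_def flat_nonneg)

text \<open>The derivative along \<nu> of the first two factors of \<open>profile\<close>, that is,
  of its dependence on the height. Its only negative contribution comes from the cut-off at height
  2.\<close>

definition radial_part :: "'a \<Rightarrow> real" where
  "radial_part x = flat (Suc 0) (x \<bullet> \<nu> / \<delta> - 1) / \<delta> * flat 0 (2 - x \<bullet> \<nu>)
     - flat 0 (x \<bullet> \<nu> / \<delta> - 1) * flat (Suc 0) (2 - x \<bullet> \<nu>)"

lemma grad_profile:
  "grad profile x = (radial_part x * flat 0 (1 - perp_sq \<nu> x)) *\<^sub>R \<nu>
    + (- 2 * flat 0 (x \<bullet> \<nu> / \<delta> - 1) * flat 0 (2 - x \<bullet> \<nu>) * flat (Suc 0) (1 - perp_sq \<nu> x)) *\<^sub>R (x - (x \<bullet> \<nu>) *\<^sub>R \<nu>)"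
proof (rule grad_eqI[OF smooth_profile])
  note chain = has_derivative_compose[OF _ flat_has_derivative[unfolded has_field_derivative_def]]
  have 1: "((\<lambda>x. x \<bullet> \<nu> / \<delta> - 1) has_derivative (\<lambda>h. h \<bullet> \<nu> / \<delta>)) (at x)"
    using \<delta> by (auto intro!: derivative_eq_intros simp: divide_inverse mult.commute)
  have 2: "((\<lambda>x. 2 - x \<bullet> \<nu>) has_derivative (\<lambda>h. - (h \<bullet> \<nu>))) (at x)"
    by (auto intro!: derivative_eq_intros)
  have 3: "((\<lambda>x. 1 - perp_sq \<nu> x) has_derivative (\<lambda>h. - 2 * ((x - (x \<bullet> \<nu>) *\<^sub>R \<nu>) \<bullet> h))) (at x)"
    unfolding perp_sq_def power2_eq_square
    by (auto intro!: derivative_eq_intros simp: inner_commute inner_diff_left algebra_simps)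
  show "(profile has_derivative (\<bullet>) ((radial_part x * flat 0 (1 - perp_sq \<nu> x)) *\<^sub>R \<nu>
    + (- 2 * flat 0 (x \<bullet> \<nu> / \<delta> - 1) * flat 0 (2 - x \<bullet> \<nu>) * flat (Suc 0) (1 - perp_sq \<nu> x)) *\<^sub>R (x - (x \<bullet> \<nu>) *\<^sub>R \<nu>))) (at x)"
    unfolding profile_def [abs_def]
    by (rule has_derivative_eq_rhs[OF has_derivative_mult[OF has_derivative_mult[OF chain[OF 1] chain[OF 2]] chain[OF 3]]])
       (simp add: fun_eq_iff radial_part_def inner_add_left inner_diff_left inner_commute algebra_simps)
qed

lemma grad_profile_inner: "grad profile x \<bullet> \<nu> = radial_part x * flat 0 (1 - perp_sq \<nu> x)"
  using \<nu> by (simp add: grad_profile inner_add_left inner_diff_left dot_square_norm)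

lemma grad_profile_eq_0: "x \<notin> slab \<Longrightarrow> grad profile x = 0"
  using \<delta> unfolding grad_profile radial_part_def slab_def
  by (auto simp: flat_def not_le field_simps)

text \<open>Up to the two cut-offs the gradient is a nonnegative multiple of \<nu>. The cut-off at
  height 2 costs at most 4 (twice its negative slope), the lateral one at most 4, both independently
  of \<delta>.\<close>

lemma norm_grad_profile: "norm (grad profile x) \<le> grad profile x \<bullet> \<nu> + 8 * indicator slab x"
proof (cases "x \<in> slab")
  case True
  let ?a = "flat 0 (x \<bullet> \<nu> / \<delta> - 1)" and ?c = "flat 0 (2 - x \<bullet> \<nu>)" and ?b = "flat 0 (1 - perp_sq \<nu> x)"
  let ?y = "x - (x \<bullet> \<nu>) *\<^sub>R \<nu>"
  have "\<bar>radial_part x\<bar> \<le> radial_part x + 2 * (?a * flat (Suc 0) (2 - x \<bullet> \<nu>))"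
    using \<delta> flat_nonneg by (simp add: radial_part_def abs_le_iff)
  also have "?a * flat (Suc 0) (2 - x \<bullet> \<nu>) \<le> 1 * 2"
    by (intro mult_mono flat_le flat_nonneg) auto
  finally have "\<bar>radial_part x\<bar> * ?b \<le> (radial_part x + 4) * ?b"
    by (intro mult_right_mono flat_nonneg) simp
  also have "\<dots> \<le> radial_part x * ?b + 4"
    using flat_le(1)[of "1 - perp_sq \<nu> x"] by (simp add: algebra_simps)
  finally have 1: "norm ((radial_part x * ?b) *\<^sub>R \<nu>) \<le> grad profile x \<bullet> \<nu> + 4"
    using \<nu> by (simp add: grad_profile_inner abs_mult flat_nonneg)
  have "norm ?y \<le> 1"
    using True by (rule norm_perp_le)
  then have "2 * (?a * (?c * (flat (Suc 0) (1 - perp_sq \<nu> x) * norm ?y))) \<le> 2 * (1 * (1 * (2 * 1)))"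
    by (intro mult_mono mult_left_mono flat_le flat_nonneg mult_nonneg_nonneg norm_ge_zero zero_le_numeral zero_le_one)
  then have 2: "norm ((- 2 * ?a * ?c * flat (Suc 0) (1 - perp_sq \<nu> x)) *\<^sub>R ?y) \<le> 4"
    by (simp add: abs_mult flat_nonneg mult_ac)
  show ?thesis
    using norm_triangle_ineq[of "(radial_part x * ?b) *\<^sub>R \<nu>" "(- 2 * ?a * ?c * flat (Suc 0) (1 - perp_sq \<nu> x)) *\<^sub>R ?y"]
      1 2 True by (simp add: grad_profile)
next
  case False
  then show ?thesis by (simp add: grad_profile_eq_0)
qed

lemma slab_inner_pos: "x \<in> slab \<Longrightarrow> 0 < x \<bullet> \<nu>"
  using \<delta> by (simp add: slab_def)

lemma integrable_slab:
  assumes "\<And>x. x \<notin> slab \<Longrightarrow> f x = 0" "continuous_on slab f"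
  shows "integrable lborel (\<lambda>x. f x * (x \<bullet> \<nu>) powr a)"
  by (rule integrable_compact_support[OF compact_slab])
     (use assms slab_inner_pos in \<open>force intro!: continuous_intros\<close>)+

text \<open>The derivative along \<nu> of profile(x) (x . \<nu>)^(1-s) integrates to 0. So Hardy's
  inequality is an identity when the norm of the gradient is replaced by its component along
  \<nu>.\<close>

lemma profile_flux_zero:
  assumes "1 < s"
  shows "(\<integral>x. (grad profile x \<bullet> \<nu>) * (x \<bullet> \<nu>) powr (1 - s) \<partial>lborel) =
    (s - 1) * (\<integral>x. profile x * (x \<bullet> \<nu>) powr (- s) \<partial>lborel)"
proof -
  define F where "F x h = profile x * ((1 - s) * (x \<bullet> \<nu>) powr (- s) * (h \<bullet> \<nu>))
    + (grad profile x \<bullet> h) * (x \<bullet> \<nu>) powr (1 - s)" for x h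
  have low: "x \<notin> slab" if "x \<bullet> \<nu> < \<delta>" for x using that by (simp add: slab_def)
  have der: "((\<lambda>x. profile x * (x \<bullet> \<nu>) powr (1 - s)) has_derivative F x) (at x)" for x
  proof (cases "x \<bullet> \<nu> < \<delta>")
    case True
    have "F x = (\<lambda>_. 0)"
      using low[OF True] by (simp add: F_def fun_eq_iff profile_eq_0 grad_profile_eq_0)
    moreover have "((\<lambda>x. profile x * (x \<bullet> \<nu>) powr (1 - s)) has_derivative (\<lambda>_. 0)) (at x)"
    proof (rule has_derivative_transform_within_open[OF has_derivative_const])
      show "open {y. y \<bullet> \<nu> < \<delta>}" by (intro open_Collect_less continuous_intros)
      show "x \<in> {y. y \<bullet> \<nu> < \<delta>}" using True by simp
      show "0 = profile y * (y \<bullet> \<nu>) powr (1 - s)" if "y \<in> {y. y \<bullet> \<nu> < \<delta>}" for y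
        using that low[of y] by (simp add: profile_eq_0)
    qed
    ultimately show ?thesis by simp
  next
    case False
    then have pos: "0 < x \<bullet> \<nu>" using \<delta> by simp
    have 1: "((\<lambda>x. x \<bullet> \<nu>) has_derivative (\<lambda>h. h \<bullet> \<nu>)) (at x)"
      by (rule bounded_linear_imp_has_derivative[OF bounded_linear_inner_left])
    have "((\<lambda>x. (x \<bullet> \<nu>) powr (1 - s)) has_derivative (\<lambda>h. (1 - s) * (x \<bullet> \<nu>) powr (- s) * (h \<bullet> \<nu>))) (at x)"
      using has_derivative_compose[OF 1 has_real_derivative_powr[OF pos, of "1 - s", unfolded has_field_derivative_def]]
      by simp
    from has_derivative_mult[OF has_derivative_grad[OF smooth_profile] this]
    show ?thesis by (simp add: F_def [abs_def])
  qed
  \<comment> \<open>The power is regular only for x . \<nu> > 0, while the profile vanishes for x .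
    \<nu> < \<delta>; these two open sets overlap and cover the space.\<close>
  have "continuous_on ({x. 0 < x \<bullet> \<nu>} \<union> {x. x \<bullet> \<nu> < \<delta>}) (\<lambda>x. F x \<nu>)"
  proof (rule continuous_on_open_Un)
    show "open {x. 0 < x \<bullet> \<nu>}" "open {x. x \<bullet> \<nu> < \<delta>}" by (intro open_Collect_less continuous_intros)+
    show "continuous_on {x. 0 < x \<bullet> \<nu>} (\<lambda>x. F x \<nu>)"
      unfolding F_def
      by (intro continuous_intros continuous_on_smooth[OF smooth_profile] continuous_on_grad[OF smooth_profile]) auto
    show "continuous_on {x. x \<bullet> \<nu> < \<delta>} (\<lambda>x. F x \<nu>)"
      by (rule continuous_on_eq[where f = "\<lambda>_. 0"])
         (use low in \<open>simp_all add: F_def profile_eq_0 grad_profile_eq_0\<close>)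
  qed
  moreover have "{x. 0 < x \<bullet> \<nu>} \<union> {x. x \<bullet> \<nu> < \<delta>} = UNIV" using \<delta> by force
  ultimately have "continuous_on UNIV (\<lambda>x. F x \<nu>)" by simp
  from integral_directional_derivative(2)[OF compact_slab _ der this]
  have "(\<integral>x. F x \<nu> \<partial>lborel) = 0" by (simp add: profile_eq_0)
  moreover have "F x \<nu> = (grad profile x \<bullet> \<nu>) * (x \<bullet> \<nu>) powr (1 - s) - (s - 1) * (profile x * (x \<bullet> \<nu>) powr (- s))" for x
    by (simp add: F_def inner_axis_self algebra_simps)
  moreover have "integrable lborel (\<lambda>x. (grad profile x \<bullet> \<nu>) * (x \<bullet> \<nu>) powr (1 - s))"
    by (intro integrable_slab continuous_intros continuous_on_grad[OF smooth_profile]) (simp add: grad_profile_eq_0)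
  moreover have "integrable lborel (\<lambda>x. profile x * (x \<bullet> \<nu>) powr (- s))"
    by (intro integrable_slab continuous_on_smooth[OF smooth_profile] profile_eq_0)
  ultimately show ?thesis by simp
qed

lemma profile_energy_le:
  assumes "1 < s"
  shows "(\<integral>x. norm (grad profile x) * (x \<bullet> \<nu>) powr (1 - s) \<partial>lborel) \<le>
    (s - 1) * (\<integral>x. profile x * (x \<bullet> \<nu>) powr (- s) \<partial>lborel)
    + 8 * (\<integral>x. indicator slab x * (x \<bullet> \<nu>) powr (1 - s) \<partial>lborel)"
proof -
  have i1: "integrable lborel (\<lambda>x. (grad profile x \<bullet> \<nu>) * (x \<bullet> \<nu>) powr (1 - s))"
    and i2: "integrable lborel (\<lambda>x. norm (grad profile x) * (x \<bullet> \<nu>) powr (1 - s))"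
    by (intro integrable_slab continuous_intros continuous_on_grad[OF smooth_profile]; simp add: grad_profile_eq_0)+
  have i3: "integrable lborel (\<lambda>x. indicator slab x * (x \<bullet> \<nu>) powr (1 - s))"
    by (rule integrable_slab) (auto intro: continuous_on_eq[where f = "\<lambda>_. 1"])
  have "(\<integral>x. norm (grad profile x) * (x \<bullet> \<nu>) powr (1 - s) \<partial>lborel) \<le>
    (\<integral>x. (grad profile x \<bullet> \<nu>) * (x \<bullet> \<nu>) powr (1 - s) + 8 * (indicator slab x * (x \<bullet> \<nu>) powr (1 - s)) \<partial>lborel)"
  proof (intro integral_mono i2 Bochner_Integration.integrable_add i1 integrable_mult_right i3)
    fix x
    show "norm (grad profile x) * (x \<bullet> \<nu>) powr (1 - s) \<le>
      (grad profile x \<bullet> \<nu>) * (x \<bullet> \<nu>) powr (1 - s) + 8 * (indicator slab x * (x \<bullet> \<nu>) powr (1 - s))"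
      using mult_right_mono[OF norm_grad_profile[of x], of "(x \<bullet> \<nu>) powr (1 - s)"] by (simp add: algebra_simps)
  qed
  also have "\<dots> = (\<integral>x. (grad profile x \<bullet> \<nu>) * (x \<bullet> \<nu>) powr (1 - s) \<partial>lborel)
      + 8 * (\<integral>x. indicator slab x * (x \<bullet> \<nu>) powr (1 - s) \<partial>lborel)"
    using i1 i3 by simp
  finally show ?thesis by (simp add: profile_flux_zero[OF assms])
qed

lemma borel_measurable_perp_sq [measurable]: "perp_sq \<nu> \<in> borel_measurable borel"
  by (rule borel_measurable_continuous_onI[OF continuous_on_perp_sq])

text \<open>For t \<ge> \<delta>, t^(1-s) \<le> \<delta>^(1-s+\<theta>) t^(-\<theta>) because
  1-s+\<theta> \<le> 0, and t^(-\<theta>) has integral at most 2/(1/2) on the slab since \<theta>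
  \<le> 1/2. This avoids distinguishing s below, at and above 2; the gain \<delta>^\<theta> over
  \<delta>^(1-s) is what the comparison needs.\<close>

lemma slab_weight_le:
  assumes \<theta>: "0 < \<theta>" "\<theta> \<le> 1 / 2" "\<theta> \<le> s - 1"
    and fin: "slab_mass \<nu> (indicator {x. perp_sq \<nu> x \<le> 1}) = ennreal K" "0 \<le> K"
  shows "(\<integral>x. indicator slab x * (x \<bullet> \<nu>) powr (1 - s) \<partial>lborel) \<le> 4 * K * \<delta> powr (1 - s + \<theta>)"
proof -
  have i3: "integrable lborel (\<lambda>x. indicator slab x * (x \<bullet> \<nu>) powr (1 - s))"
    by (rule integrable_slab) (auto intro: continuous_on_eq[where f = "\<lambda>_. 1"])
  define f where "f t = ennreal (indicator {\<delta>..2} t * t powr (- \<theta>))" for t :: real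
  have [measurable]: "f \<in> borel_measurable borel" unfolding f_def by measurable
  have f4: "(\<integral>\<^sup>+t. f t \<partial>lborel) \<le> ennreal 4"
  proof -
    have "(\<integral>\<^sup>+t. f t \<partial>lborel) = (\<integral>\<^sup>+t. ennreal (t powr (- \<theta>)) * indicator {\<delta>..2} t \<partial>lborel)"
      by (intro nn_integral_cong) (auto simp: f_def indicator_def)
    also have "\<dots> = ennreal (2 powr (1 - \<theta>) / (1 - \<theta>) - \<delta> powr (1 - \<theta>) / (1 - \<theta>))"
    proof (rule nn_integral_FTC_Icc)
      fix t assume "t \<in> {\<delta>..2}"
      then have "0 < t" using \<delta> by simp
      from DERIV_cdivide[OF has_real_derivative_powr[OF this, of "1 - \<theta>"], of "1 - \<theta>"]
      show "((\<lambda>t. t powr (1 - \<theta>) / (1 - \<theta>)) has_real_derivative t powr (- \<theta>)) (at t)"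
        using \<theta> by simp
    qed (use \<delta> in auto)
    also have "\<dots> \<le> ennreal 4"
    proof (rule ennreal_leI)
      have "2 powr (1 - \<theta>) \<le> 2 powr 1" using \<theta> by (intro powr_mono) auto
      then have "2 powr (1 - \<theta>) / (1 - \<theta>) \<le> 2 / (1 / 2)"
        using \<theta> by (intro frac_le) auto
      moreover have "0 \<le> \<delta> powr (1 - \<theta>) / (1 - \<theta>)" using \<theta> by simp
      ultimately show "2 powr (1 - \<theta>) / (1 - \<theta>) - \<delta> powr (1 - \<theta>) / (1 - \<theta>) \<le> 4" by simp
    qed
    finally show ?thesis .
  qed
  have "ennreal (\<integral>x. indicator slab x * (x \<bullet> \<nu>) powr (1 - s) \<partial>lborel)
      = (\<integral>\<^sup>+x. ennreal (indicator slab x * (x \<bullet> \<nu>) powr (1 - s)) \<partial>lborel)"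
    by (rule nn_integral_eq_integral[symmetric, OF i3]) simp
  also have "\<dots> \<le> (\<integral>\<^sup>+x. ennreal (\<delta> powr (1 - s + \<theta>)) * (f (x \<bullet> \<nu>) * indicator {x. perp_sq \<nu> x \<le> 1} x) \<partial>lborel)"
  proof (rule nn_integral_mono)
    fix x
    show "ennreal (indicator slab x * (x \<bullet> \<nu>) powr (1 - s)) \<le>
      ennreal (\<delta> powr (1 - s + \<theta>)) * (f (x \<bullet> \<nu>) * indicator {x. perp_sq \<nu> x \<le> 1} x)"
    proof (cases "x \<in> slab")
      case True
      then have x: "\<delta> \<le> x \<bullet> \<nu>" "x \<bullet> \<nu> \<le> 2" "perp_sq \<nu> x \<le> 1" by (simp_all add: slab_def)
      have "(x \<bullet> \<nu>) powr (1 - s) = (x \<bullet> \<nu>) powr (1 - s + \<theta>) * (x \<bullet> \<nu>) powr (- \<theta>)"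
        by (simp add: powr_add [symmetric])
      also have "\<dots> \<le> \<delta> powr (1 - s + \<theta>) * (x \<bullet> \<nu>) powr (- \<theta>)"
        using x \<delta> \<theta> by (intro mult_right_mono powr_mono2') auto
      finally show ?thesis using True x by (simp add: f_def ennreal_mult [symmetric] ennreal_leI)
    qed simp
  qed
  also have "\<dots> = ennreal (\<delta> powr (1 - s + \<theta>)) * (slab_mass \<nu> (indicator {x. perp_sq \<nu> x \<le> 1}) * (\<integral>\<^sup>+t. f t \<partial>lborel))"
    unfolding slab_mass_def
    by (subst nn_integral_cmult, simp, subst nn_integral_slab[OF _ _ \<nu>])
       (auto simp: perp_sq_shift indicator_def)
  also have "\<dots> \<le> ennreal (\<delta> powr (1 - s + \<theta>)) * (ennreal K * ennreal 4)"
    unfolding fin(1) by (intro mult_left_mono f4) auto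
  finally have "ennreal (\<integral>x. indicator slab x * (x \<bullet> \<nu>) powr (1 - s) \<partial>lborel)
    \<le> ennreal (\<delta> powr (1 - s + \<theta>)) * (ennreal K * ennreal 4)"
    .
  also have "\<dots> = ennreal (4 * K * \<delta> powr (1 - s + \<theta>))"
    using fin(2) by (simp add: ennreal_mult mult_ac)
  finally show ?thesis using fin(2) by (simp add: ennreal_le_iff)
qed

text \<open>Keep only the heights between 2\<delta> and 4\<delta>: a window of length 2\<delta> on
  which the weight is at least (4\<delta>)^(-s). This already has the full order
  \<delta>^(1-s).\<close>

lemma profile_weight_ge:
  assumes s: "1 < s"
    and fin: "slab_mass \<nu> (\<lambda>x. ennreal (flat 0 (1 - perp_sq \<nu> x))) = ennreal K" "0 \<le> K"
  shows "exp (- 2) * (4 * \<delta>) powr (- s) * K * (2 * \<delta>) \<le> (\<integral>x. profile x * (x \<bullet> \<nu>) powr (- s) \<partial>lborel)"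
proof -
  have i: "integrable lborel (\<lambda>x. profile x * (x \<bullet> \<nu>) powr (- s))"
    by (intro integrable_slab continuous_on_smooth[OF smooth_profile] profile_eq_0)
  define b where "b x = ennreal (flat 0 (1 - perp_sq \<nu> x))" for x
  have cb: "continuous_on UNIV (\<lambda>x. flat 0 (1 - perp_sq \<nu> x))"
    by (intro continuous_intros continuous_on_perp_sq)
  have [measurable]: "b \<in> borel_measurable borel"
    unfolding b_def using borel_measurable_continuous_onI[OF cb] by measurable
  define c where "c = exp (- 2) * (4 * \<delta>) powr (- s)"
  have "ennreal (c * K * (2 * \<delta>)) = ennreal c * (slab_mass \<nu> b * (\<integral>\<^sup>+t. indicator {2 * \<delta>..4 * \<delta>} t \<partial>lborel))"
    using \<delta> fin by (simp add: c_def b_def [abs_def] ennreal_mult mult_ac)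
  also have "\<dots> = (\<integral>\<^sup>+x. ennreal c * (indicator {2 * \<delta>..4 * \<delta>} (x \<bullet> \<nu>) * b x) \<partial>lborel)"
    unfolding slab_mass_def
    by (subst nn_integral_cmult, simp, subst nn_integral_slab[OF _ _ \<nu>, of _ b])
       (auto simp: perp_sq_shift b_def)
  also have "\<dots> \<le> (\<integral>\<^sup>+x. ennreal (profile x * (x \<bullet> \<nu>) powr (- s)) \<partial>lborel)"
  proof (rule nn_integral_mono)
    fix x
    show "ennreal c * (indicator {2 * \<delta>..4 * \<delta>} (x \<bullet> \<nu>) * b x) \<le> ennreal (profile x * (x \<bullet> \<nu>) powr (- s))"
    proof (cases "x \<bullet> \<nu> \<in> {2 * \<delta>..4 * \<delta>}")
      case True
      have one: "exp (- 1) \<le> flat 0 t" if "1 \<le> t" for t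
        using that by (simp add: flat_0)
      \<comment> \<open>In the window both arguments x . \<nu> / \<delta> - 1 and 2 - x . \<nu> are
        at least 1, the latter by 4\<delta> \<le> 1; each factor is then at least exp(-1).\<close>
      have "2 \<le> x \<bullet> \<nu> / \<delta>" using True \<delta> by (simp add: pos_le_divide_eq)
      then have "exp (- 1) * exp (- 1) * flat 0 (1 - perp_sq \<nu> x) \<le> profile x"
        unfolding profile_def using True \<delta> by (intro mult_mono one flat_nonneg order_refl mult_nonneg_nonneg) auto
      then have "exp (- 2) * flat 0 (1 - perp_sq \<nu> x) \<le> profile x"
        by (simp add: mult_exp_exp)
      moreover have "(4 * \<delta>) powr (- s) \<le> (x \<bullet> \<nu>) powr (- s)"
        using True \<delta> s by (intro powr_mono2') auto
      ultimately have "exp (- 2) * flat 0 (1 - perp_sq \<nu> x) * (4 * \<delta>) powr (- s) \<le> profile x * (x \<bullet> \<nu>) powr (- s)"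
        by (intro mult_mono) (auto simp: profile_nonneg)
      then show ?thesis
        using True by (simp add: b_def c_def ennreal_mult [symmetric] flat_nonneg ennreal_leI mult_ac)
    qed simp
  qed
  also have "\<dots> = ennreal (\<integral>x. profile x * (x \<bullet> \<nu>) powr (- s) \<partial>lborel)"
    by (rule nn_integral_eq_integral[OF i]) (simp add: profile_nonneg)
  finally have "ennreal (c * K * (2 * \<delta>)) \<le> ennreal (\<integral>x. profile x * (x \<bullet> \<nu>) powr (- s) \<partial>lborel)" .
  moreover have "0 \<le> (\<integral>x. profile x * (x \<bullet> \<nu>) powr (- s) \<partial>lborel)"
    by (rule Bochner_Integration.integral_nonneg) (simp add: profile_nonneg)
  ultimately show ?thesis by (simp add: ennreal_le_iff c_def)
qed

end

lemma slab_mass_finite: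
  fixes \<nu> :: "'a::euclidean_space"
  assumes \<nu>: "norm \<nu> = 1" and b: "\<And>x. b x \<le> indicator {x. perp_sq \<nu> x \<le> 1} x"
  shows "slab_mass \<nu> b < \<infinity>"
proof -
  have "slab_mass \<nu> b \<le> (\<integral>\<^sup>+x. indicator (cball 0 2) (x :: 'a) \<partial>lborel)"
    unfolding slab_mass_def
  proof (rule nn_integral_mono)
    fix x :: 'a
    show "indicator {0..1} (x \<bullet> \<nu>) * b x \<le> indicator (cball 0 2) x"
    proof (cases "x \<bullet> \<nu> \<in> {0..1} \<and> perp_sq \<nu> x \<le> 1")
      case True
      then have "(x \<bullet> \<nu>)\<^sup>2 \<le> 1" by (simp add: power_le_one)
      then have "(norm x)\<^sup>2 \<le> 2\<^sup>2" using True by (simp add: perp_sq_def power2_norm_eq_inner)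
      then have "norm x \<le> 2" by (rule power2_le_imp_le) simp
      then show ?thesis using True b[of x] by simp
    next
      case False
      then show ?thesis using b[of x] by (auto simp: indicator_def)
    qed
  qed
  also have "\<dots> = emeasure lborel (cball (0 :: 'a) 2)" by simp
  also have "\<dots> < \<infinity>" by (rule emeasure_bounded_finite[OF bounded_cball])
  finally show ?thesis .
qed

lemma slab_mass_pos:
  fixes \<nu> :: "'a::euclidean_space"
  assumes \<nu>: "norm \<nu> = 1"
  shows "0 < slab_mass \<nu> (\<lambda>x. ennreal (flat 0 (1 - perp_sq \<nu> x)))"
proof -
  let ?B = "ball ((1 / 2) *\<^sub>R \<nu>) (1 / 4)"
  have "ennreal (exp (- 2)) * emeasure lborel ?B = (\<integral>\<^sup>+x. ennreal (exp (- 2)) * indicator ?B (x :: 'a) \<partial>lborel)"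
    by (rule nn_integral_cmult_indicator[symmetric]) simp
  also have "\<dots> \<le> slab_mass \<nu> (\<lambda>x. ennreal (flat 0 (1 - perp_sq \<nu> x)))"
    unfolding slab_mass_def
  proof (rule nn_integral_mono)
    fix x :: 'a
    show "ennreal (exp (- 2)) * indicator ?B x \<le> indicator {0..1} (x \<bullet> \<nu>) * ennreal (flat 0 (1 - perp_sq \<nu> x))"
    proof (cases "x \<in> ?B")
      case True
      define y where "y = x - (1 / 2) *\<^sub>R \<nu>"
      have x: "x = y + (1 / 2) *\<^sub>R \<nu>" by (simp add: y_def)
      have y: "norm y \<le> 1 / 4" using True by (simp add: y_def dist_norm norm_minus_commute)
      have \<nu>\<nu>: "\<nu> \<bullet> \<nu> = 1" using \<nu> by (simp add: dot_square_norm)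
      have "\<bar>y \<bullet> \<nu>\<bar> \<le> 1 / 4" using Cauchy_Schwarz_ineq2[of y \<nu>] y \<nu> by simp
      then have "0 \<le> y \<bullet> \<nu> + 1 / 2 \<and> y \<bullet> \<nu> + 1 / 2 \<le> 1" by linarith
      then have t: "x \<bullet> \<nu> \<in> {0..1}" by (simp add: x inner_add_left \<nu>\<nu>)
      have "perp_sq \<nu> x = y \<bullet> y - (y \<bullet> \<nu>)\<^sup>2"
        by (simp add: perp_sq_def x inner_add_left inner_add_right inner_commute[of \<nu> y] \<nu>\<nu> power2_eq_square algebra_simps)
      also have "\<dots> \<le> (norm y)\<^sup>2" by (simp add: power2_norm_eq_inner)
      also have "\<dots> \<le> (1 / 4)\<^sup>2" using y by (intro power_mono) auto
      finally have p: "perp_sq \<nu> x \<le> 1 / 2" by (simp add: power2_eq_square)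
      then have "1 / (1 - perp_sq \<nu> x) \<le> 2" by (simp add: pos_divide_le_eq)
      then have "exp (- 2) \<le> flat 0 (1 - perp_sq \<nu> x)" using p by (simp add: flat_0)
      then show ?thesis using True t by (simp add: ennreal_leI)
    qed simp
  qed
  finally have le: "ennreal (exp (- 2)) * emeasure lborel ?B \<le> \<dots>" .
  have "emeasure lborel ?B \<noteq> 0"
  proof
    assume "emeasure lborel ?B = 0"
    then show False using content_ball_pos[of "1 / 4" "(1 / 2) *\<^sub>R \<nu>"] by (simp add: measure_def)
  qed
  then have "0 < ennreal (exp (- 2)) * emeasure lborel ?B"
    by (simp add: ennreal_zero_less_mult_iff zero_less_iff_neq_zero)
  with le show ?thesis by (rule order_less_le_trans[rotated])
qed

text \<open>With X the weighted mass of the profile, the energy exceeds (s-1) X by at most order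
  \<delta>^(1-s+\<theta>), whereas X itself is at least of order \<delta>^(1-s). For small \<delta>
  the excess is absorbed by (C - (s-1)) X.\<close>

lemma half_space_sharp:
  fixes \<nu> :: "'a::euclidean_space"
  assumes \<nu>: "norm \<nu> = 1" and s: "1 < s" and C: "s - 1 < C"
  shows "\<exists>u S. smooth u \<and> compact S \<and> (\<forall>x. x \<notin> S \<longrightarrow> u x = 0) \<and> (\<forall>x\<in>S. 0 < x \<bullet> \<nu>) \<and>
    (\<integral>x. norm (grad u x) * (x \<bullet> \<nu>) powr (1 - s) \<partial>lborel) < C * (\<integral>x. \<bar>u x\<bar> * (x \<bullet> \<nu>) powr (- s) \<partial>lborel)"
proof -
  let ?b = "\<lambda>x. ennreal (flat 0 (1 - perp_sq \<nu> x))" and ?i = "indicator {x. perp_sq \<nu> x \<le> 1}"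
  have "?b x \<le> ?i x" for x
    using flat_le(1)[of "1 - perp_sq \<nu> x"] by (cases "perp_sq \<nu> x \<le> 1") (simp_all add: flat_nonpos_eq_0)
  then have fb: "slab_mass \<nu> ?b < \<infinity>" by (rule slab_mass_finite[OF \<nu>])
  have fi: "slab_mass \<nu> ?i < \<infinity>" by (rule slab_mass_finite[OF \<nu>]) simp
  define K where "K = enn2real (slab_mass \<nu> ?i)"
  define K0 where "K0 = enn2real (slab_mass \<nu> ?b)"
  have K: "slab_mass \<nu> ?i = ennreal K" "0 \<le> K" using fi by (simp_all add: K_def)
  have K0: "slab_mass \<nu> ?b = ennreal K0" "0 < K0"
    using fb slab_mass_pos[OF \<nu>] by (simp_all add: K0_def enn2real_positive_iff)
  define \<theta> where "\<theta> = min (1 / 2) (s - 1)"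
  have "0 < \<theta>" using s by (simp add: \<theta>_def)
  moreover have "\<theta> \<le> 1 / 2" "\<theta> \<le> s - 1"
    unfolding \<theta>_def by (rule min.cobounded1, rule min.cobounded2)
  ultimately have \<theta>: "0 < \<theta>" "\<theta> \<le> 1 / 2" "\<theta> \<le> s - 1" .
  \<comment> \<open>c \<delta>^(1-s) is C - (s-1) times the lower bound of
    \<open>profile_weight_ge\<close>. It competes with 32 K \<delta>^\<theta>, where 32 is the 8 of
    \<open>profile_energy_le\<close> times the 4 of \<open>slab_weight_le\<close>.\<close>
  define c where "c = (C - (s - 1)) * (exp (- 2) * 4 powr (- s) * K0 * 2)"
  have c: "0 < c" using C K0 by (simp add: c_def)
  have "((\<lambda>t. 32 * K * t powr \<theta>) \<longlongrightarrow> 32 * K * 0 powr \<theta>) (at_right 0)"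
    using \<theta> by (intro tendsto_intros) (auto simp: eventually_at_filter)
  then have "eventually (\<lambda>t. 32 * K * t powr \<theta> < c) (at_right 0)"
    using c by (intro order_tendstoD) auto
  moreover have "eventually (\<lambda>t::real. 0 < t \<and> t < 1 / 4) (at_right 0)"
    using eventually_at_right_less[of 0] eventually_at_right_field by (auto simp: eventually_at_right_field intro!: exI[of _ "1/4"])
  ultimately have "eventually (\<lambda>t. 32 * K * t powr \<theta> < c \<and> 0 < t \<and> t < 1 / 4) (at_right 0)"
    by (rule eventually_conj)
  then obtain \<delta> where "32 * K * \<delta> powr \<theta> < c \<and> 0 < \<delta> \<and> \<delta> < 1 / 4"
    using eventually_happens'[OF trivial_limit_at_right_real] by blast
  then have \<delta>: "32 * K * \<delta> powr \<theta> < c" "0 < \<delta>" "4 * \<delta> \<le> 1" by simp_all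
  note facts = \<nu> \<delta>(2,3)
  define X where "X = (\<integral>x. profile \<nu> \<delta> x * (x \<bullet> \<nu>) powr (- s) \<partial>lborel)"
  have "(C - (s - 1)) * (exp (- 2) * (4 * \<delta>) powr (- s) * K0 * (2 * \<delta>)) \<le> (C - (s - 1)) * X"
    unfolding X_def using C K0 profile_weight_ge[OF facts s K0(1)] by (intro mult_left_mono) auto
  also have "(C - (s - 1)) * (exp (- 2) * (4 * \<delta>) powr (- s) * K0 * (2 * \<delta>)) = c * \<delta> powr (1 - s)"
  proof -
    have "\<delta> powr (1 - s) = \<delta> * \<delta> powr (- s)" using \<delta>(2) powr_add[of \<delta> 1 "- s"] by simp
    then show ?thesis using \<delta>(2) by (simp add: c_def powr_mult)
  qed
  finally have 1: "c * \<delta> powr (1 - s) \<le> (C - (s - 1)) * X" .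
  have "(\<integral>x. norm (grad (profile \<nu> \<delta>) x) * (x \<bullet> \<nu>) powr (1 - s) \<partial>lborel) \<le>
      (s - 1) * X + 8 * (4 * K * \<delta> powr (1 - s + \<theta>))"
    using profile_energy_le[OF facts s] slab_weight_le[OF facts \<theta> K] by (simp add: X_def)
  also have "8 * (4 * K * \<delta> powr (1 - s + \<theta>)) = 32 * K * \<delta> powr \<theta> * \<delta> powr (1 - s)"
    by (simp add: powr_add)
  also have "\<dots> < c * \<delta> powr (1 - s)"
    using \<delta> by (intro mult_strict_right_mono) auto
  finally have "(\<integral>x. norm (grad (profile \<nu> \<delta>) x) * (x \<bullet> \<nu>) powr (1 - s) \<partial>lborel) < C * X"
    using 1 by (simp add: algebra_simps)
  then have "(\<integral>x. norm (grad (profile \<nu> \<delta>) x) * (x \<bullet> \<nu>) powr (1 - s) \<partial>lborel)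
      < C * (\<integral>x. \<bar>profile \<nu> \<delta> x\<bar> * (x \<bullet> \<nu>) powr (- s) \<partial>lborel)"
    by (simp add: X_def profile_nonneg[OF facts])
  then show ?thesis
    using smooth_profile[OF facts] compact_slab[OF facts] profile_eq_0[OF facts] slab_inner_pos[OF facts] by blast
qed

section \<open>Blow-up at a boundary point\<close>

text \<open>Take any point of \<Omega> as centre and its nearest point outside \<Omega> as p. The
  conjunction of \<open>p \<notin> \<Omega>\<close> and
  \<open>bdist \<Omega> (p + R *\<^sub>R \<nu>) = R\<close> encodes that the ball lies in \<Omega>
  and touches the complement at p.\<close>

lemma touching_ball:
  assumes "open \<Omega>" "\<Omega> \<noteq> UNIV" "\<Omega> \<noteq> {}"
  shows "\<exists>p \<nu> R. norm \<nu> = 1 \<and> 0 < R \<and> p \<notin> \<Omega> \<and> bdist \<Omega> (p + R *\<^sub>R \<nu>) = R"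
proof -
  obtain q where q: "q \<in> \<Omega>" using assms(3) by blast
  obtain p where p: "p \<notin> \<Omega>" "bdist \<Omega> q = dist q p" using bdist_attained[OF assms(1,2)] .
  define R where "R = bdist \<Omega> q"
  have R: "0 < R" unfolding R_def by (rule bdist_pos[OF assms(1,2) q])
  have n: "norm (q - p) = R" using p(2) by (simp add: R_def dist_norm)
  have "norm ((q - p) /\<^sub>R R) = 1" using R n by simp
  moreover have "p + R *\<^sub>R ((q - p) /\<^sub>R R) = q" using R by simp
  ultimately show ?thesis using R p(1) R_def by (intro exI[of _ p] exI[of _ "(q - p) /\<^sub>R R"] exI[of _ R]) simp
qed

definition blow :: "'a::euclidean_space set \<Rightarrow> 'a \<Rightarrow> real \<Rightarrow> 'a \<Rightarrow> real" where
  "blow \<Omega> p l x = bdist \<Omega> (p + l *\<^sub>R x) / l"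

context
  fixes \<Omega> :: "'a::euclidean_space set" and p \<nu> :: 'a and R :: real
  assumes \<nu>: "norm \<nu> = 1" and R: "0 < R" and p: "p \<notin> \<Omega>" and pR: "bdist \<Omega> (p + R *\<^sub>R \<nu>) = R"
begin

text \<open>Since d is 1-Lipschitz and equals R at the centre, d(p + h) \<ge> R - norm (h - R
  \<nu>); then expand the norm around - R \<nu>.\<close>

lemma bdist_ge_half_space: "h \<bullet> \<nu> - (norm h)\<^sup>2 / (2 * R) \<le> bdist \<Omega> (p + h)"
proof -
  have "norm (- R *\<^sub>R \<nu> + h) \<le> R + ((- R *\<^sub>R \<nu>) \<bullet> h) / R + (norm h)\<^sup>2 / (2 * R)"
    using norm_add_le_quadratic[of "- R *\<^sub>R \<nu>" h] \<nu> R by simp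
  also have "\<dots> = R - h \<bullet> \<nu> + (norm h)\<^sup>2 / (2 * R)" using R by (simp add: inner_commute)
  finally have "dist (p + h) (p + R *\<^sub>R \<nu>) \<le> R - h \<bullet> \<nu> + (norm h)\<^sup>2 / (2 * R)"
    by (simp add: dist_norm algebra_simps)
  then show ?thesis using bdist_lipschitz[of \<Omega> "p + h" "p + R *\<^sub>R \<nu>"] pR by linarith
qed

lemma blow_nonneg: "0 < l \<Longrightarrow> 0 \<le> blow \<Omega> p l x"
  by (simp add: blow_def bdist_nonneg)

lemma bdist_blow: "0 < l \<Longrightarrow> bdist \<Omega> (p + l *\<^sub>R x) = l * blow \<Omega> p l x"
  by (simp add: blow_def)

lemma continuous_on_blow: "continuous_on A (blow \<Omega> p l)"
  unfolding blow_def [abs_def] divide_inverse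
  by (intro continuous_intros continuous_on_compose2[OF continuous_on_bdist[of UNIV] _ subset_UNIV])

lemma blow_ge:
  assumes "0 < l"
  shows "x \<bullet> \<nu> - l * (norm x)\<^sup>2 / (2 * R) \<le> blow \<Omega> p l x"
proof -
  have "l * (x \<bullet> \<nu> - l * (norm x)\<^sup>2 / (2 * R)) \<le> l * blow \<Omega> p l x"
    using bdist_ge_half_space[of "l *\<^sub>R x"] assms
    by (simp add: bdist_blow power_mult_distrib right_diff_distrib power2_eq_square mult_ac)
  then show ?thesis using assms by simp
qed

lemma blow_lipschitz:
  assumes "0 < l"
  shows "\<bar>blow \<Omega> p l x - blow \<Omega> p l y\<bar> \<le> norm (x - y)"
proof -
  have "l * \<bar>blow \<Omega> p l x - blow \<Omega> p l y\<bar> = \<bar>l * blow \<Omega> p l x - l * blow \<Omega> p l y\<bar>"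
    using assms by (simp add: right_diff_distrib [symmetric] abs_mult)
  also have "\<dots> \<le> dist (p + l *\<^sub>R x) (p + l *\<^sub>R y)"
    using bdist_lipschitz[of \<Omega> "p + l *\<^sub>R x" "p + l *\<^sub>R y"] assms by (simp add: bdist_blow)
  also have "\<dots> = l * norm (x - y)"
    using assms by (simp add: dist_norm scaleR_diff_right [symmetric])
  finally show ?thesis using assms by simp
qed

text \<open>On the normal ray, up to the centre of the touching ball, d is exactly the distance to
  p: the Lipschitz bound from the centre gives \<ge>, and p itself gives \<le>. Hence the value at
  the centre T \<nu> of the average is T, and every radius below T is admissible.\<close>

lemma blow_mean_value:
  assumes super: "neg_laplacian_nonneg \<Omega> (bdist \<Omega>)"
    and l: "0 < l" "l * T \<le> R" and r: "0 < r" "r < T"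
  shows "(\<integral>z. ker z * blow \<Omega> p l (T *\<^sub>R \<nu> + r *\<^sub>R z) \<partial>lborel) \<le> T * integral\<^sup>L lborel (ker :: 'a \<Rightarrow> real)"
proof -
  define X where "X = p + (l * T) *\<^sub>R \<nu>"
  have "bdist \<Omega> (p + R *\<^sub>R \<nu>) - bdist \<Omega> X \<le> dist (p + R *\<^sub>R \<nu>) X"
    using bdist_lipschitz[of \<Omega> "p + R *\<^sub>R \<nu>" X] by simp
  also have "\<dots> = R - l * T"
    using l \<nu> by (simp add: X_def dist_norm scaleR_diff_left [symmetric])
  finally have "l * T \<le> bdist \<Omega> X" using pR by simp
  then have sub: "cball X (l * r) \<subseteq> \<Omega>"
    using mult_strict_left_mono[OF r(2) l(1)] by (intro cball_subset_bdist) simp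
  have "bdist \<Omega> X \<le> l * T" using bdist_le[OF p, of X] l r \<nu> by (simp add: X_def dist_norm)
  have "l * (\<integral>z. ker z * blow \<Omega> p l (T *\<^sub>R \<nu> + r *\<^sub>R z) \<partial>lborel) = (\<integral>z. ker z * bdist \<Omega> (X + (l * r) *\<^sub>R z) \<partial>lborel)"
  proof -
    have eq: "ker z * bdist \<Omega> (X + (l * r) *\<^sub>R z) = l * (ker z * blow \<Omega> p l (T *\<^sub>R \<nu> + r *\<^sub>R z))" for z
      using bdist_blow[OF l(1), of "T *\<^sub>R \<nu> + r *\<^sub>R z"] by (simp add: X_def scaleR_add_right add.assoc)
    show ?thesis unfolding eq by simp
  qed
  also have "\<dots> \<le> bdist \<Omega> X * integral\<^sup>L lborel (ker :: 'a \<Rightarrow> real)"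
    using l r by (intro ker_mean_value[OF continuous_on_bdist super _ sub]) simp
  also have "\<dots> \<le> (l * T) * integral\<^sup>L lborel (ker :: 'a \<Rightarrow> real)"
    using integral_ker_pos[where 'a = 'a] \<open>bdist \<Omega> X \<le> l * T\<close> by (intro mult_right_mono) auto
  finally show ?thesis using l by simp
qed

lemma integral_ker_odd: "(\<integral>z. ker z * (z \<bullet> \<nu>) \<partial>lborel) = 0"
proof -
  have "continuous_on UNIV (\<lambda>z. ker z * (z \<bullet> \<nu>))" by (intro continuous_intros)
  from integral_reflect[OF borel_measurable_continuous_onI[OF this]] show ?thesis by simp
qed

(* blow l - (x . v) is almost nonnegative with almost nonpositive mean over a ball around
   T v that contains x, so it is small at x: a quantitative strong minimum principle. *)
lemma blow_upper:
  assumes super: "neg_laplacian_nonneg \<Omega> (bdist \<Omega>)" and x: "0 < x \<bullet> \<nu>" and e: "0 < e"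
  shows "\<exists>l0>0. \<forall>l. 0 < l \<and> l < l0 \<longrightarrow> blow \<Omega> p l x \<le> x \<bullet> \<nu> + e"
proof -
  define \<kappa> where "\<kappa> = integral\<^sup>L lborel (ker :: 'a \<Rightarrow> real)"
  \<comment> \<open>With this T, norm (x - T \<nu>)^2 = T^2 - norm x^2, so x lies in the open ball
    about T \<nu> of radius T, which touches the boundary of the half space at 0.\<close>
  define T where "T = (norm x)\<^sup>2 / (x \<bullet> \<nu>)"
  have "x \<noteq> 0" using x by auto
  have T: "0 < T" "T * (x \<bullet> \<nu>) = (norm x)\<^sup>2" using x \<open>x \<noteq> 0\<close> by (simp_all add: T_def)
  have "(norm (x - T *\<^sub>R \<nu>))\<^sup>2 = (norm x)\<^sup>2 - 2 * (T * (x \<bullet> \<nu>)) + T\<^sup>2"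
  proof -
    have "(norm (x - T *\<^sub>R \<nu>))\<^sup>2 = x \<bullet> x - T * (x \<bullet> \<nu>) - (T * (x \<bullet> \<nu>) - T * (T * (\<nu> \<bullet> \<nu>)))"
      unfolding power2_norm_eq_inner inner_diff_left inner_diff_right inner_scaleR_left inner_scaleR_right
      by (simp only: inner_commute[of \<nu> x] right_diff_distrib)
    then show ?thesis by (simp add: \<nu> power2_norm_eq_inner [symmetric] power2_eq_square)
  qed
  then have "(norm (x - T *\<^sub>R \<nu>))\<^sup>2 < T\<^sup>2" proof -
    have "0 < (norm x)\<^sup>2" using \<open>x \<noteq> 0\<close> by simp
    with \<open>(norm (x - T *\<^sub>R \<nu>))\<^sup>2 = _\<close> T(2) show ?thesis by linarith
  qed
  then have nT: "norm (x - T *\<^sub>R \<nu>) < T" using T(1) by (rule power2_less_imp_less[OF _ less_imp_le])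
  obtain r where r: "0 < r" "r < T" "norm (x - T *\<^sub>R \<nu>) < r"
    using dense[OF nT] norm_ge_zero order_le_less_trans by blast
  define z0 where "z0 = (x - T *\<^sub>R \<nu>) /\<^sub>R r"
  have z0: "norm z0 < 1" using r by (simp add: z0_def pos_divide_less_eq divide_inverse_commute [symmetric])
  have xz: "x = T *\<^sub>R \<nu> + r *\<^sub>R z0" using r by (simp add: z0_def)
  \<comment> \<open>On the ball of radius \<rho> about z0 the point moves by at most e/4, so the
    rescaled distance and the linear function each change by at most e/4, leaving e/2 of the assumed
    excess e.\<close>
  define \<rho> where "\<rho> = e / (4 * r)"
  have \<rho>: "0 < \<rho>" using e r by (simp add: \<rho>_def)
  \<comment> \<open>The points used have norm at most 2T, so the quadratic loss in
    \<open>blow_ge\<close> is at most l (2T)^2 / (2R) = c l; adding c l makes G nonnegative.\<close>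
  define c where "c = 2 * T\<^sup>2 / R"
  have c: "0 < c" using T R by (simp add: c_def)
  define m where "m = (\<integral>z. indicator (ball z0 \<rho>) z *\<^sub>R ker z \<partial>lborel)"
  have im: "integrable lborel (\<lambda>z. indicator (ball z0 \<rho>) z *\<^sub>R ker z)"
    by (intro integrable_mult_indicator integrable_ker) simp
  have m: "0 < m"
    unfolding m_def
  proof (rule integral_pos_on_ball[OF im, of "min \<rho> (1 - norm z0)" z0])
    fix z assume z: "z \<in> ball z0 (min \<rho> (1 - norm z0))"
    then have "norm (z - z0) < 1 - norm z0" by (simp add: dist_norm norm_minus_commute)
    then have "norm z < 1" using norm_triangle_ineq2[of z z0] by linarith
    then show "0 < indicator (ball z0 \<rho>) z *\<^sub>R ker z" using z ker_pos[of z] by simp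
  qed (use \<rho> z0 in \<open>auto simp: ker_nonneg\<close>)
  have \<kappa>: "0 < \<kappa>" unfolding \<kappa>_def by (rule integral_ker_pos)
  show ?thesis
  \<comment> \<open>The first bound keeps T \<nu> within reach of the touching ball (l T \<le> R);
    the second makes c l \<kappa>, an upper bound for the integral of ker G, smaller than (e/2) m,
    its lower bound if the claim fails.\<close>
  proof (intro exI[of _ "min (R / T) (e * m / (2 * c * \<kappa>))"] conjI allI impI)
    show "0 < min (R / T) (e * m / (2 * c * \<kappa>))" using R T e m c \<kappa> by simp
    fix l assume "0 < l \<and> l < min (R / T) (e * m / (2 * c * \<kappa>))"
    then have l: "0 < l" "l < R / T" "l < e * m / (2 * c * \<kappa>)" by simp_all
    have l: "0 < l" "l * T \<le> R" "c * l * \<kappa> < e / 2 * m"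
    proof -
      have "l * (2 * c * \<kappa>) < e * m" using l(3) c \<kappa> by (simp add: pos_less_divide_eq)
      then show "c * l * \<kappa> < e / 2 * m" by (simp add: algebra_simps)
      show "l * T \<le> R" using l(2) T(1) by (simp add: pos_less_divide_eq)
    qed (rule l(1))
    show "blow \<Omega> p l x \<le> x \<bullet> \<nu> + e"
    proof (rule ccontr)
      assume "\<not> blow \<Omega> p l x \<le> x \<bullet> \<nu> + e"
      then have big: "x \<bullet> \<nu> + e < blow \<Omega> p l x" by simp
      define y where "y z = T *\<^sub>R \<nu> + r *\<^sub>R z" for z
      have y\<nu>: "y z \<bullet> \<nu> = T + r * (z \<bullet> \<nu>)" for z
        using \<nu> by (simp add: y_def inner_add_left dot_square_norm)
      define G where "G z = blow \<Omega> p l (y z) - y z \<bullet> \<nu> + c * l" for z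
      have G0: "0 \<le> G z" if "norm z \<le> 1" for z
      proof -
        have "norm (y z) \<le> norm (T *\<^sub>R \<nu>) + norm (r *\<^sub>R z)" unfolding y_def by (rule norm_triangle_ineq)
        also have "\<dots> \<le> T + T * 1"
        proof (rule add_mono)
          show "norm (T *\<^sub>R \<nu>) \<le> T" using T \<nu> by simp
          have "r * norm z \<le> T * 1" using r T that by (intro mult_mono) auto
          then show "norm (r *\<^sub>R z) \<le> T * 1" using r by simp
        qed
        finally have "(norm (y z))\<^sup>2 \<le> (2 * T)\<^sup>2" by (intro power_mono) auto
        then have "l * (norm (y z))\<^sup>2 / (2 * R) \<le> l * (2 * T)\<^sup>2 / (2 * R)"
          using l R by (intro divide_right_mono mult_left_mono) auto
        also have "\<dots> = c * l" by (simp add: c_def power2_eq_square)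
        finally show ?thesis using blow_ge[OF l(1), of "y z"] by (simp add: G_def)
      qed
      have G1: "e / 2 \<le> G z" if "z \<in> ball z0 \<rho>" for z
      proof -
        have "norm (x - y z) = r * norm (z0 - z)"
          using r by (simp add: xz y_def scaleR_diff_right [symmetric])
        also have "\<dots> \<le> r * \<rho>" using that r by (intro mult_left_mono) (auto simp: dist_norm)
        also have "\<dots> = e / 4" using r by (simp add: \<rho>_def)
        finally have d: "norm (x - y z) \<le> e / 4" .
        have "\<bar>(x - y z) \<bullet> \<nu>\<bar> \<le> norm (x - y z)" using Cauchy_Schwarz_ineq2[of "x - y z" \<nu>] \<nu> by simp
        then have "y z \<bullet> \<nu> \<le> x \<bullet> \<nu> + e / 4" using d by (simp add: inner_diff_left abs_le_iff)
        moreover have "blow \<Omega> p l x - e / 4 \<le> blow \<Omega> p l (y z)"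
          using blow_lipschitz[OF l(1), of x "y z"] d by (simp add: abs_le_iff)
        moreover have "0 < c * l" using c l by simp
        ultimately show ?thesis using big unfolding G_def by linarith
      qed
      have ib: "integrable lborel (\<lambda>z. ker z * blow \<Omega> p l (y z))"
        and iy: "integrable lborel (\<lambda>z. ker z * (z \<bullet> \<nu>))"
        unfolding y_def
        by (intro integrable_ker_mult continuous_intros continuous_on_compose2[OF continuous_on_blow[of UNIV] _ subset_UNIV])+
      have hG: "has_bochner_integral lborel (\<lambda>z. ker z * blow \<Omega> p l (y z) + (- r) * (ker z * (z \<bullet> \<nu>)) + (c * l - T) * ker z)
          ((\<integral>z. ker z * blow \<Omega> p l (y z) \<partial>lborel) + (- r) * 0 + (c * l - T) * \<kappa>)"
        by (intro has_bochner_integral_add has_bochner_integral_mult_right)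
           (simp_all add: has_bochner_integral_iff ib iy integrable_ker integral_ker_odd \<kappa>_def)
      moreover have "ker z * blow \<Omega> p l (y z) + (- r) * (ker z * (z \<bullet> \<nu>)) + (c * l - T) * ker z = ker z * G z" for z
        by (simp add: G_def y\<nu> algebra_simps)
      ultimately have iG: "integrable lborel (\<lambda>z. ker z * G z)"
        and IG: "(\<integral>z. ker z * G z \<partial>lborel) = (\<integral>z. ker z * blow \<Omega> p l (y z) \<partial>lborel) + (c * l - T) * \<kappa>"
        by (simp_all add: has_bochner_integral_iff)
      have "e / 2 * m = (\<integral>z. e / 2 * (indicator (ball z0 \<rho>) z *\<^sub>R ker z) \<partial>lborel)"
        unfolding m_def by (rule integral_mult_right_zero[symmetric])
      also have "\<dots> \<le> (\<integral>z. ker z * G z \<partial>lborel)"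
      proof (rule integral_mono[OF integrable_mult_right[OF im] iG])
        fix z :: 'a
        show "e / 2 * (indicator (ball z0 \<rho>) z *\<^sub>R ker z) \<le> ker z * G z"
        proof (cases "norm z < 1")
          case True
          show ?thesis
          proof (cases "z \<in> ball z0 \<rho>")
            case z: True
            then show ?thesis using mult_left_mono[OF G1[OF z] ker_nonneg[of z]] by (simp add: mult.commute)
          qed (use G0[of z] True in \<open>simp add: ker_nonneg\<close>)
        qed (simp add: ker_eq_0)
      qed
      \<comment> \<open>The linear part of G averages to T, which also bounds the average of the
        rescaled distance; only the shift c l remains.\<close>
      also have "\<dots> \<le> c * l * \<kappa>"
        using blow_mean_value[OF super l(1,2) r(1,2)] unfolding IG y_def \<kappa>_def by (simp add: algebra_simps)
      finally show False using l(3) by simp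
    qed
  qed
qed

lemma blow_tendsto:
  assumes super: "neg_laplacian_nonneg \<Omega> (bdist \<Omega>)" and x: "0 < x \<bullet> \<nu>"
  shows "((\<lambda>l. blow \<Omega> p l x) \<longlongrightarrow> x \<bullet> \<nu>) (at_right 0)"
proof (rule tendstoI)
  fix e :: real assume e: "0 < e"
  obtain l0 where l0: "0 < l0" "\<And>l. 0 < l \<Longrightarrow> l < l0 \<Longrightarrow> blow \<Omega> p l x \<le> x \<bullet> \<nu> + e / 2"
    using blow_upper[OF super x, of "e / 2"] e by auto
  define l1 where "l1 = min l0 (e * R / ((norm x)\<^sup>2 + 1))"
  have pos: "0 < (norm x)\<^sup>2 + 1" by (simp add: add_nonneg_pos)
  have "0 < l1" using l0 e R pos by (simp add: l1_def)
  moreover have "dist (blow \<Omega> p l x) (x \<bullet> \<nu>) < e" if l: "0 < l" "l < l1" for l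
  proof -
    have "l * ((norm x)\<^sup>2 + 1) < e * R" using l pos by (simp add: l1_def pos_less_divide_eq)
    then have "l * (norm x)\<^sup>2 < e * R" using l by (simp add: algebra_simps)
    then have "l * (norm x)\<^sup>2 / (2 * R) < e" proof -
      have "e * R < e * (2 * R)" using R e by simp
      then have "l * (norm x)\<^sup>2 < e * (2 * R)" using \<open>l * (norm x)\<^sup>2 < e * R\<close> by linarith
      then show ?thesis using R by (simp add: pos_divide_less_eq)
    qed
    then show ?thesis using blow_ge[OF l(1), of x] l0(2)[of l] l e by (simp add: dist_real_def l1_def abs_less_iff)
  qed
  ultimately show "eventually (\<lambda>l. dist (blow \<Omega> p l x) (x \<bullet> \<nu>) < e) (at_right 0)"
    by (auto simp: eventually_at_right_field)
qed

text \<open>In both integrals the volume gives l^n. In the first, the gradient gives 1/l and the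
  weight l^(1-s); in the second, the weight alone gives l^(-s). The common factor l^n l^(-s) cancels
  in the comparison.\<close>

lemma rescaled_energy:
  fixes u :: "'a \<Rightarrow> real"
  assumes u: "smooth u" and l: "0 < l"
  shows "(\<integral>x. norm (grad (\<lambda>x. u ((x - p) /\<^sub>R l)) x) * bdist \<Omega> x powr (1 - s) \<partial>lborel) =
      l ^ DIM('a) * l powr (- s) * (\<integral>x. norm (grad u x) * blow \<Omega> p l x powr (1 - s) \<partial>lborel)"
    and "(\<integral>x. \<bar>u ((x - p) /\<^sub>R l)\<bar> * bdist \<Omega> x powr (- s) \<partial>lborel) =
      l ^ DIM('a) * l powr (- s) * (\<integral>x. \<bar>u x\<bar> * blow \<Omega> p l x powr (- s) \<partial>lborel)"
proof -
  let ?v = "\<lambda>x. u ((x - p) /\<^sub>R l)"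
  have sv: "smooth ?v" using l by (intro smooth_affine[OF u]) simp
  have [measurable]: "bdist \<Omega> \<in> borel_measurable borel" "(\<lambda>x. norm (grad ?v x)) \<in> borel_measurable borel"
    "?v \<in> borel_measurable borel"
    by (intro borel_measurable_continuous_onI continuous_on_bdist continuous_intros
        continuous_on_grad[OF sv] continuous_on_smooth[OF sv])+
  have pt: "norm (grad ?v (p + l *\<^sub>R x)) * bdist \<Omega> (p + l *\<^sub>R x) powr (1 - s)
      = l powr (- s) * (norm (grad u x) * blow \<Omega> p l x powr (1 - s))" for x
  proof -
    have "l powr (1 - s) / l = l powr (- s)" using l powr_diff[of l "1 - s" 1] by simp
    then show ?thesis
      using l by (simp add: grad_affine[OF u] bdist_blow powr_mult blow_nonneg divide_inverse mult_ac)
  qed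
  show "(\<integral>x. norm (grad ?v x) * bdist \<Omega> x powr (1 - s) \<partial>lborel) =
      l ^ DIM('a) * l powr (- s) * (\<integral>x. norm (grad u x) * blow \<Omega> p l x powr (1 - s) \<partial>lborel)"
    using l by (subst integral_scale[of _ l p], simp, simp, unfold pt, simp)
  have pt': "\<bar>?v (p + l *\<^sub>R x)\<bar> * bdist \<Omega> (p + l *\<^sub>R x) powr (- s)
      = l powr (- s) * (\<bar>u x\<bar> * blow \<Omega> p l x powr (- s))" for x
    using l by (simp add: bdist_blow powr_mult blow_nonneg mult_ac)
  show "(\<integral>x. \<bar>?v x\<bar> * bdist \<Omega> x powr (- s) \<partial>lborel) =
      l ^ DIM('a) * l powr (- s) * (\<integral>x. \<bar>u x\<bar> * blow \<Omega> p l x powr (- s) \<partial>lborel)"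
    using l by (subst integral_scale[of _ l p], simp, simp, unfold pt', simp)
qed

end

text \<open>A function on the half space that violates the constant C is shrunk towards p. The
  touching ball bounds the rescaled distance below on its support by a positive constant; this puts
  the shrunken support inside \<Omega> and, the exponents being negative, supplies the dominating
  function for the passage to the limit.\<close>

lemma hardy_sharp:
  fixes \<Omega> :: "'a::euclidean_space set"
  assumes \<Omega>: "open \<Omega>" "\<Omega> \<noteq> UNIV" "\<Omega> \<noteq> {}" and super: "neg_laplacian_nonneg \<Omega> (bdist \<Omega>)"
    and s: "1 < s"
    and ineq: "\<And>u. test_fun \<Omega> u \<Longrightarrow> C * (\<integral>x. \<bar>u x\<bar> * bdist \<Omega> x powr (- s) \<partial>lborel)
      \<le> (\<integral>x. norm (grad u x) * bdist \<Omega> x powr (1 - s) \<partial>lborel)"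
  shows "C \<le> s - 1"
proof (rule ccontr)
  assume "\<not> C \<le> s - 1"
  then have C: "s - 1 < C" by simp
  from touching_ball[OF \<Omega>] obtain p \<nu> R
    where \<nu>: "norm \<nu> = 1" and R: "0 < R" and p: "p \<notin> \<Omega>" and pR: "bdist \<Omega> (p + R *\<^sub>R \<nu>) = R"
    by (elim exE conjE)
  from half_space_sharp[OF \<nu> s C] obtain u S where sm: "smooth u" and S: "compact S" and u0': "\<forall>x. x \<notin> S \<longrightarrow> u x = 0" and Spos': "\<forall>x\<in>S. 0 < x \<bullet> \<nu>"
    and less: "(\<integral>x. norm (grad u x) * (x \<bullet> \<nu>) powr (1 - s) \<partial>lborel) < C * (\<integral>x. \<bar>u x\<bar> * (x \<bullet> \<nu>) powr (- s) \<partial>lborel)"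
    by (elim exE conjE)
  have u0: "u x = 0" if "x \<notin> S" for x using u0' that by blast
  have Spos: "0 < x \<bullet> \<nu>" if "x \<in> S" for x using Spos' that by blast
  have cl: "closure {x. u x \<noteq> 0} \<subseteq> S"
    using u0 by (intro closure_minimal compact_imp_closed[OF S]) blast
  have "compact (closure {x. u x \<noteq> 0})"
    unfolding compact_eq_bounded_closed
    by (intro conjI closed_closure bounded_subset[OF compact_imp_bounded[OF S] cl])
  then have tu: "test_fun UNIV u"
    unfolding test_fun_def by (intro conjI sm subset_UNIV)
  have g0: "grad u x = 0" if "x \<notin> S" for x
    using test_fun_grad_zero[OF tu, of x] cl that by blast
  obtain \<tau> where \<tau>: "0 < \<tau>" "\<And>x. x \<in> S \<Longrightarrow> \<tau> \<le> x \<bullet> \<nu>"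
  proof (cases "S = {}")
    case False
    have "continuous_on S (\<lambda>x. x \<bullet> \<nu>)" by (intro continuous_intros)
    from continuous_attains_inf[OF S False this] obtain x0 where "x0 \<in> S" "\<forall>y\<in>S. x0 \<bullet> \<nu> \<le> y \<bullet> \<nu>" by blast
    then show ?thesis using Spos by (intro that[of "x0 \<bullet> \<nu>"]) auto
  qed (use that[of 1] in simp)
  obtain B where B: "\<And>x. x \<in> S \<Longrightarrow> norm x \<le> B"
    using compact_imp_bounded[OF S] bounded_iff by blast
  \<comment> \<open>Chosen so that the quadratic loss l (norm x)^2 / (2R) in \<open>blow_ge\<close>
    is at most \<tau>/2 on S; the added 1 avoids division by zero.\<close>
  define l1 where "l1 = \<tau> * R / (B\<^sup>2 + 1)"
  have B1: "0 < B\<^sup>2 + 1" by (simp add: add_nonneg_pos)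
  have l1: "0 < l1" using \<tau>(1) R B1 by (simp add: l1_def)
  have low: "\<tau> / 2 \<le> blow \<Omega> p l x" if l: "0 < l" "l \<le> l1" and x: "x \<in> S" for l x
  proof -
    have "(norm x)\<^sup>2 \<le> B\<^sup>2 + 1" using power_mono[OF B[OF x], of 2] by simp
    then have "l * (norm x)\<^sup>2 \<le> l1 * (B\<^sup>2 + 1)" using l by (intro mult_mono) auto
    also have "\<dots> = \<tau> * R" using B1 by (simp add: l1_def)
    finally have "l * (norm x)\<^sup>2 / (2 * R) \<le> \<tau> / 2" using R by (simp add: pos_divide_le_eq)
    then show ?thesis using blow_ge[OF \<nu> R p pR l(1), of x] \<tau>(2)[OF x] by linarith
  qed
  have scaled: "C * (\<integral>x. \<bar>u x\<bar> * blow \<Omega> p l x powr (- s) \<partial>lborel)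
      \<le> (\<integral>x. norm (grad u x) * blow \<Omega> p l x powr (1 - s) \<partial>lborel)" if l: "0 < l" "l \<le> l1" for l
  proof -
    define v where "v x = u ((x - p) /\<^sub>R l)" for x
    define S' where "S' = (\<lambda>x. p + l *\<^sub>R x) ` S"
    have cS': "compact S'"
      unfolding S'_def by (intro compact_continuous_image continuous_intros S)
    have "S' \<subseteq> \<Omega>"
    proof
      fix y assume "y \<in> S'"
      then obtain x where x: "x \<in> S" "y = p + l *\<^sub>R x" by (auto simp: S'_def)
      then have "0 < bdist \<Omega> y" using low[OF l x(1)] \<tau>(1) l by (simp add: bdist_blow[OF \<nu> R p pR])
      then show "y \<in> \<Omega>" using bdist_le[of y \<Omega> y] by force
    qed
    have "v y = 0" if "y \<notin> S'" for y
    proof -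
      have "(y - p) /\<^sub>R l \<notin> S"
      proof
        assume "(y - p) /\<^sub>R l \<in> S"
        then have "p + l *\<^sub>R ((y - p) /\<^sub>R l) \<in> S'" unfolding S'_def by (rule imageI)
        then show False using that l by simp
      qed
      then show ?thesis by (simp add: v_def u0)
    qed
    then have clv: "closure {x. v x \<noteq> 0} \<subseteq> S'"
      by (intro closure_minimal compact_imp_closed[OF cS']) blast
    have "compact (closure {x. v x \<noteq> 0})"
      unfolding compact_eq_bounded_closed
      by (intro conjI closed_closure bounded_subset[OF compact_imp_bounded[OF cS'] clv])
    moreover have "smooth v" unfolding v_def using l by (intro smooth_affine[OF sm]) simp
    ultimately have "test_fun \<Omega> v"
      unfolding test_fun_def by (intro conjI order_trans[OF clv \<open>S' \<subseteq> \<Omega>\<close>])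
    from ineq[OF this]
    have "l ^ DIM('a) * l powr (- s) * (C * (\<integral>x. \<bar>u x\<bar> * blow \<Omega> p l x powr (- s) \<partial>lborel))
        \<le> l ^ DIM('a) * l powr (- s) * (\<integral>x. norm (grad u x) * blow \<Omega> p l x powr (1 - s) \<partial>lborel)"
      unfolding v_def rescaled_energy[OF \<nu> R p pR sm l(1)] by (simp add: mult_ac)
    moreover have "0 < l ^ DIM('a) * l powr (- s)" using l by simp
    ultimately show ?thesis by (rule mult_left_le_imp_le)
  qed
  \<comment> \<open>A sequence of scales, because dominated convergence is applied along sequences;
    \<open>Suc\<close> keeps the scales positive and at most l1.\<close>
  define L where "L k = l1 / real (Suc k)" for k
  have L: "0 < L k" "L k \<le> l1" for k
    using l1 by (simp_all add: L_def divide_le_eq)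
  have "L \<longlonglongrightarrow> 0" unfolding L_def by (rule LIMSEQ_Suc[OF lim_const_over_n])
  then have Lr: "filterlim L (at_right 0) sequentially"
    using L by (intro tendsto_imp_filterlim_at_right) auto
  have lim: "(\<lambda>k. \<integral>x. w x * blow \<Omega> p (L k) x powr a \<partial>lborel) \<longlonglongrightarrow> (\<integral>x. w x * (x \<bullet> \<nu>) powr a \<partial>lborel)"
    if w: "continuous_on UNIV w" "\<And>x. x \<notin> S \<Longrightarrow> w x = 0" and a: "a < 0" for w a
  proof (rule integral_dominated_convergence[where w = "\<lambda>x. \<bar>w x\<bar> * (\<tau> / 2) powr a"])
    have [measurable]: "w \<in> borel_measurable borel" "blow \<Omega> p l \<in> borel_measurable borel" for l
      by (intro borel_measurable_continuous_onI w(1) continuous_on_blow[OF \<nu> R p pR])+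
    show "(\<lambda>x. w x * (x \<bullet> \<nu>) powr a) \<in> borel_measurable lborel"
      "(\<lambda>x. w x * blow \<Omega> p (L k) x powr a) \<in> borel_measurable lborel" for k
      by measurable
    show "integrable lborel (\<lambda>x. \<bar>w x\<bar> * (\<tau> / 2) powr a)"
      by (rule integrable_compact_support[OF S])
         (auto intro!: continuous_intros continuous_on_subset[OF w(1)] simp: w(2))
    show "AE x in lborel. (\<lambda>k. w x * blow \<Omega> p (L k) x powr a) \<longlonglongrightarrow> w x * (x \<bullet> \<nu>) powr a"
    proof (rule AE_I2)
      fix x
      show "(\<lambda>k. w x * blow \<Omega> p (L k) x powr a) \<longlonglongrightarrow> w x * (x \<bullet> \<nu>) powr a"
      proof (cases "x \<in> S")
        case True
        have "(\<lambda>k. blow \<Omega> p (L k) x) \<longlonglongrightarrow> x \<bullet> \<nu>"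
          by (rule filterlim_compose[OF blow_tendsto[OF \<nu> R p pR super Spos[OF True]] Lr])
        then show ?thesis using Spos[OF True] by (intro tendsto_intros) auto
      qed (simp add: w(2))
    qed
    show "AE x in lborel. norm (w x * blow \<Omega> p (L k) x powr a) \<le> \<bar>w x\<bar> * (\<tau> / 2) powr a" for k
    proof (rule AE_I2)
      fix x
      show "norm (w x * blow \<Omega> p (L k) x powr a) \<le> \<bar>w x\<bar> * (\<tau> / 2) powr a"
      proof (cases "x \<in> S")
        case True
        have "blow \<Omega> p (L k) x powr a \<le> (\<tau> / 2) powr a"
          using low[OF L True] \<tau>(1) a by (intro powr_mono2') auto
        then show ?thesis by (simp add: abs_mult mult_left_mono)
      qed (simp add: w(2))
    qed
  qed
  have "(\<lambda>k. \<integral>x. norm (grad u x) * blow \<Omega> p (L k) x powr (1 - s) \<partial>lborel)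
      \<longlonglongrightarrow> (\<integral>x. norm (grad u x) * (x \<bullet> \<nu>) powr (1 - s) \<partial>lborel)"
    using s by (intro lim continuous_intros continuous_on_grad[OF sm]) (simp_all add: g0)
  moreover have "(\<lambda>k. C * (\<integral>x. \<bar>u x\<bar> * blow \<Omega> p (L k) x powr (- s) \<partial>lborel))
      \<longlonglongrightarrow> C * (\<integral>x. \<bar>u x\<bar> * (x \<bullet> \<nu>) powr (- s) \<partial>lborel)"
    using s by (intro tendsto_mult_left lim continuous_intros continuous_on_smooth[OF sm]) (simp_all add: u0)
  ultimately have "C * (\<integral>x. \<bar>u x\<bar> * (x \<bullet> \<nu>) powr (- s) \<partial>lborel) \<le> (\<integral>x. norm (grad u x) * (x \<bullet> \<nu>) powr (1 - s) \<partial>lborel)"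
    using scaled[OF L] by (intro LIMSEQ_le) blast+
  with less show False by simp
qed

section \<open>Return to the integrals of the statement\<close>

lemma integral_weighted:
  fixes \<Omega> :: "'a::euclidean_space set"
  assumes \<Omega>: "open \<Omega>" "\<Omega> \<noteq> UNIV" and u: "test_fun \<Omega> u"
  shows "integral \<Omega> (\<lambda>x. norm (grad u x) / bdist \<Omega> x powr (s - 1)) = (\<integral>x. norm (grad u x) * bdist \<Omega> x powr (1 - s) \<partial>lborel)"
    and "integral \<Omega> (\<lambda>x. \<bar>u x\<bar> / bdist \<Omega> x powr s) = (\<integral>x. \<bar>u x\<bar> * bdist \<Omega> x powr (- s) \<partial>lborel)"
proof -
  have sub: "closure {x. u x \<noteq> 0} \<subseteq> \<Omega>" using u unfolding test_fun_def by blast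
  have out: "x \<notin> closure {x. u x \<noteq> 0}" if "x \<notin> \<Omega>" for x using sub that by blast
  \<comment> \<open>Valid for every real b: at b = 0 the power, its reciprocal and hence both sides
    are 0 by convention.\<close>
  have "a / b powr (s - 1) = a * b powr (1 - s)" "a / b powr s = a * b powr (- s)" for a b :: real
    using powr_minus[of b "s - 1"] powr_minus[of b s] by (simp_all add: divide_inverse)
  then show "integral \<Omega> (\<lambda>x. norm (grad u x) / bdist \<Omega> x powr (s - 1)) = (\<integral>x. norm (grad u x) * bdist \<Omega> x powr (1 - s) \<partial>lborel)"
    and "integral \<Omega> (\<lambda>x. \<bar>u x\<bar> / bdist \<Omega> x powr s) = (\<integral>x. \<bar>u x\<bar> * bdist \<Omega> x powr (- s) \<partial>lborel)"
    using integral_eq_lborel[OF integrable_weighted(1)[OF \<Omega> u, of "1 - s"], of \<Omega>]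
      integral_eq_lborel[OF integrable_weighted(2)[OF \<Omega> u, of "- s"], of \<Omega>]
    by (simp_all add: test_fun_zero[OF u out] test_fun_grad_zero[OF u out])
qed

text \<open>Nonemptiness of \<Omega> matters for sharpness: on the empty set the zero function is
  the only test function, and every constant would be admissible.\<close>

theorem theorem2p9:
  fixes \<Omega> :: "'a::euclidean_space set"
  assumes "open \<Omega>" and "\<Omega> \<noteq> UNIV" and "\<Omega> \<noteq> {}"
    and "neg_laplacian_nonneg \<Omega> (bdist \<Omega>)"
  shows "\<forall>s::real. s > 1 \<longrightarrow>
     (\<forall>u. test_fun \<Omega> u \<longrightarrow>
        integral \<Omega> (\<lambda>x. norm (grad u x) / bdist \<Omega> x powr (s - 1))
          \<ge> (s - 1) * integral \<Omega> (\<lambda>x. \<bar>u x\<bar> / bdist \<Omega> x powr s))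
   \<and> (\<forall>C. C > s - 1 \<longrightarrow> \<not> (\<forall>u. test_fun \<Omega> u \<longrightarrow>
        integral \<Omega> (\<lambda>x. norm (grad u x) / bdist \<Omega> x powr (s - 1))
          \<ge> C * integral \<Omega> (\<lambda>x. \<bar>u x\<bar> / bdist \<Omega> x powr s)))"
proof (intro allI impI conjI)
  fix s :: real and u assume "1 < s" "test_fun \<Omega> u"
  then show "(s - 1) * integral \<Omega> (\<lambda>x. \<bar>u x\<bar> / bdist \<Omega> x powr s)
      \<le> integral \<Omega> (\<lambda>x. norm (grad u x) / bdist \<Omega> x powr (s - 1))"
    using hardy_inequality[OF assms(1,2,4)] integral_weighted[OF assms(1,2)] by simp
next
  fix s C :: real assume s: "1 < s" and C: "s - 1 < C"
  show "\<not> (\<forall>u. test_fun \<Omega> u \<longrightarrow> C * integral \<Omega> (\<lambda>x. \<bar>u x\<bar> / bdist \<Omega> x powr s)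
      \<le> integral \<Omega> (\<lambda>x. norm (grad u x) / bdist \<Omega> x powr (s - 1)))"
  proof
    assume all: "\<forall>u. test_fun \<Omega> u \<longrightarrow> C * integral \<Omega> (\<lambda>x. \<bar>u x\<bar> / bdist \<Omega> x powr s)
      \<le> integral \<Omega> (\<lambda>x. norm (grad u x) / bdist \<Omega> x powr (s - 1))"
    have "C \<le> s - 1"
    proof (rule hardy_sharp[OF assms s])
      fix u assume u: "test_fun \<Omega> u"
      from all[rule_format, OF u]
      show "C * (\<integral>x. \<bar>u x\<bar> * bdist \<Omega> x powr (- s) \<partial>lborel)
        \<le> (\<integral>x. norm (grad u x) * bdist \<Omega> x powr (1 - s) \<partial>lborel)"
        by (simp only: integral_weighted[OF assms(1,2) u])
    qed
    with C show False by simp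
  qed
qed

end
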